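(* Let $0<\beta\le1$ and let $S_1,S_2,S_3\subset\mathbb{R}^3$ be $C^{1,\beta}$ hypersurfaces $S_i=\{(\varphi_i(\xi),\xi):\xi\in B_2\}$ given by functions $\varphi_1,\varphi_2,\varphi_3\in C^{1,\beta}(B_2)$, $B_2=\{\xi\in\mathbb{R}^2:|\xi|<2\}$, satisfying: (i) for $i=1,2,3$, $\varphi_i$ is radial; (ii) $|\nabla\varphi_i(\xi)|\sim1$ if $|\xi|\sim1$; (iii) if $\xi_1+\xi_2+\xi_3=0$, $\max_{i=1,2,3}|\xi_i|\sim1$ and $|\varphi_1(\xi_1)+\varphi_2(\xi_2)+\varphi_3(\xi_3)|\ll1$, then $$|\nabla\varphi_1(\xi_1)-\nabla\varphi_2(\xi_2)|+|\nabla\varphi_2(\xi_2)-\nabla\varphi_3(\xi_3)|\sim1.$$ Let $\varepsilon>0$ and, for $i=1,2,3$, let $N_i\in2^{\mathbb{Z}}$ and let $f_i\in L^2(S_i(\varepsilon))$ satisfy $\operatorname{supp}f_i\subset\{(\tau,\xi):|\xi|\sim N_i\}$. Assume $N_3\lesssim N_1\sim N_2\sim1$. Then, for $2\le p\le\infty$, $$|(f_1*f_2*f_3)(0)|\lesssim C(\varepsilon,p,N_3)\,\|f_1\|_{L^2_{\tau,r}L^p_\theta(S_1(\varepsilon))}\|f_2\|_{L^2(S_2(\varepsilon))}\|f_3\|_{L^2(S_3(\varepsilon))},$$ where $$C(\varepsilon,p,N_3)=\begin{cases}\varepsilon^{\frac32-\frac1p}N_3^{\frac1p}&(2\le p<\infty),\\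 \langle\log\varepsilon\rangle\,\varepsilon^{\frac32}&(p=\infty).\end{cases}$$
   Context: For $\varepsilon>0$ the thickened hypersurface is $S_i(\varepsilon)=\{(\tau,\xi)\in\mathbb{R}\times\mathbb{R}^2:\xi\in B_2,\ |\tau-\varphi_i(\xi)|\le\varepsilon\}$. Functions in $L^2(S_i(\varepsilon))$ are regarded as functions on $\mathbb{R}^3$ vanishing outside $S_i(\varepsilon)$, so $(f_1*f_2*f_3)(0)=\iint f_1(\zeta_1)f_2(\zeta_2)f_3(-\zeta_1-\zeta_2)\,d\zeta_1d\zeta_2$ over $\mathbb{R}^3\times\mathbb{R}^3$. The mixed norms are $$\|f\|_{L^2_{\tau,r}L^p_\theta(S_i(\varepsilon))}=\Big(\int_{\mathbb{R}}\int_0^\infty\Big(\int_0^{2\pi}\mathbf{1}_{S_i(\varepsilon)}|f(\tau,r\cos\theta,r\sin\theta)|^p\,d\theta\Big)^{2/p}r\,dr\,d\tau\Big)^{1/2}$$ for $2\le p<\infty$, and for $p=\infty$ the inner $L^p_\theta$ norm is replaced by the supremum over $\theta\in[0,2\pi)$. $\langle a\rangle=(1+|a|^2)^{1/2}$. $2^{\mathbb{Z}}=\{2^n:n\in\mathbb{Z}\}$. Conventions: $A\lesssim B$ means $A\le CB$ for some constant $C$; $A\sim B$ means $A\lesssim B\lesssim A$; $A\ll B$ means $A\le cB$ for a sufficiently small constant $c>0$. The implicit constant in the conclusion may depend on $p$, on $\beta$ and the $\varphi_i$ (through their $C^{1,\beta}$ norms and the constants in (i)–(iii)), and on the constants in the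 support and size conditions, but not on $\varepsilon,N_i,f_i$. *)

theory Defs
  imports "HOL-Analysis.Analysis"
begin

text \<open>Asymptotic comparisons with an explicit constant: \<open>a\<close> is at most a constant times \<open>b\<close>, and
  \<open>a\<close> is comparable to \<open>b\<close>. The relation \<open>a \<ll> 1\<close> is written \<open>a \<le> c\<close> with a parameter \<open>c > 0\<close>.\<close>

definition lesssim :: "real \<Rightarrow> real \<Rightarrow> real \<Rightarrow> bool" where
  "lesssim K a b \<longleftrightarrow> a \<le> K * b"

definition comparable :: "real \<Rightarrow> real \<Rightarrow> real \<Rightarrow> bool" where
  "comparable K a b \<longleftrightarrow> lesssim K a b \<and> lesssim K b a"

definition japanese :: "real \<Rightarrow> real" where
  "japanese a = sqrt (1 + \<bar>a\<bar>\<^sup>2)"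

definition dyadic :: "real set" where
  "dyadic = range (\<lambda>n::int. 2 powi n)"

definition B2 :: "(real^2) set" where
  "B2 = ball 0 2"

definition grad :: "('a::real_inner \<Rightarrow> real) \<Rightarrow> 'a \<Rightarrow> 'a" where
  "grad f x = (THE D. GDERIV f x :> D)"

definition C1_holder_norm :: "real \<Rightarrow> 'a::real_inner set \<Rightarrow> ('a \<Rightarrow> real) \<Rightarrow> ennreal" where
  "C1_holder_norm \<beta> U f =
     (SUP x\<in>U. ennreal \<bar>f x\<bar>) + (SUP x\<in>U. ennreal (norm (grad f x)))
     + (SUP (x, y)\<in>{(x, y). x \<in> U \<and> y \<in> U \<and> x \<noteq> y}.
          ennreal (norm (grad f x - grad f y) / norm (x - y) powr \<beta>))"

text \<open>Functions are total, but for open \<open>U\<close> only the values on \<open>U\<close> matter.\<close>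

definition C1_holder :: "real \<Rightarrow> 'a::real_inner set \<Rightarrow> ('a \<Rightarrow> real) set" where
  "C1_holder \<beta> U = {f. (\<forall>x\<in>U. f differentiable (at x)) \<and> continuous_on U (grad f)
                        \<and> C1_holder_norm \<beta> U f < \<infinity>}"

definition radial_on :: "'a::real_normed_vector set \<Rightarrow> ('a \<Rightarrow> 'b) \<Rightarrow> bool" where
  "radial_on U f \<longleftrightarrow> (\<forall>x\<in>U. \<forall>y\<in>U. norm x = norm y \<longrightarrow> f x = f y)"

text \<open>The hypersurface \<open>{(\<phi> \<xi>, \<xi>). \<xi> \<in> B2}\<close> thickened by \<open>\<epsilon>\<close> in the \<open>\<tau>\<close> direction; the space of
  \<open>(\<tau>, \<xi>)\<close> is \<open>real \<times> (real^2)\<close>.\<close>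

definition thickened :: "(real^2 \<Rightarrow> real) \<Rightarrow> real \<Rightarrow> (real \<times> (real^2)) set" where
  "thickened \<phi> \<epsilon> = {(\<tau>, \<xi>). \<xi> \<in> B2 \<and> \<bar>\<tau> - \<phi> \<xi>\<bar> \<le> \<epsilon>}"

text \<open>Powers of extended nonnegative reals, used for exponents \<open>a > 0\<close> only.\<close>

definition ennreal_powr :: "ennreal \<Rightarrow> real \<Rightarrow> ennreal" where
  "ennreal_powr x a = (if x = \<infinity> then \<infinity> else ennreal (enn2real x powr a))"

definition L2_norm_on :: "'a::euclidean_space set \<Rightarrow> ('a \<Rightarrow> complex) \<Rightarrow> ennreal" where
  "L2_norm_on S f =
     ennreal_powr (\<integral>\<^sup>+\<zeta>. indicator S \<zeta> * ennreal (cmod (f \<zeta>) ^ 2) \<partial>lebesgue) (1/2)"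

text \<open>Representatives of the elements of \<open>L\<^sup>2(S)\<close>, extended by zero to the whole space.\<close>

definition L2_on :: "'a::euclidean_space set \<Rightarrow> ('a \<Rightarrow> complex) set" where
  "L2_on S = {f. f \<in> borel_measurable lebesgue \<and> (\<forall>\<zeta>. \<zeta> \<notin> S \<longrightarrow> f \<zeta> = 0) \<and> L2_norm_on S f < \<infinity>}"

definition polar :: "real \<Rightarrow> real \<Rightarrow> real^2" where
  "polar r \<theta> = vector [r * cos \<theta>, r * sin \<theta>]"

definition Lp_theta :: "ennreal \<Rightarrow> (real \<Rightarrow> ennreal) \<Rightarrow> ennreal" where
  "Lp_theta p g =
     (if p = \<infinity> then SUP \<theta>\<in>{0..<2*pi}. g \<theta>
      else ennreal_powr (\<integral>\<^sup>+\<theta>\<in>{0..<2*pi}. ennreal_powr (g \<theta>) (enn2real p) \<partial>lebesgue) (1 / enn2real p))"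

definition mixed_norm_on ::
    "ennreal \<Rightarrow> (real \<times> (real^2)) set \<Rightarrow> (real \<times> (real^2) \<Rightarrow> complex) \<Rightarrow> ennreal" where
  "mixed_norm_on p S f =
     ennreal_powr
       (\<integral>\<^sup>+\<tau>. (\<integral>\<^sup>+r\<in>{0<..}.
           (Lp_theta p (\<lambda>\<theta>. indicator S (\<tau>, polar r \<theta>) * ennreal (cmod (f (\<tau>, polar r \<theta>)))))\<^sup>2
           * ennreal r \<partial>lebesgue) \<partial>lebesgue)
       (1/2)"

definition triple_conv_0 :: "('a::euclidean_space \<Rightarrow> complex) \<Rightarrow> ('a \<Rightarrow> complex) \<Rightarrow> ('a \<Rightarrow> complex) \<Rightarrow> complex" where
  "triple_conv_0 f1 f2 f3 =
     (LINT (\<zeta>1, \<zeta>2)|(lebesgue :: ('a \<times> 'a) measure). f1 \<zeta>1 * f2 \<zeta>2 * f3 (- \<zeta>1 - \<zeta>2))"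

definition conv_const :: "real \<Rightarrow> ennreal \<Rightarrow> real \<Rightarrow> real" where
  "conv_const \<epsilon> p N3 =
     (if p = \<infinity> then japanese (ln \<epsilon>) * \<epsilon> powr (3/2)
      else \<epsilon> powr (3/2 - 1 / enn2real p) * N3 powr (1 / enn2real p))"

text \<open>In the next two definitions \<open>A\<close> is the constant in the hypotheses \<open>\<bar>\<xi>\<bar> \<sim> 1\<close> and
  \<open>max \<bar>\<xi>\<^sub>i\<bar> \<sim> 1\<close>, \<open>B\<close> the constant in the conclusions \<open>\<sim> 1\<close>, and \<open>c\<close> the threshold in
  \<open>\<ll> 1\<close>.\<close>

definition gradient_condition :: "real \<Rightarrow> real \<Rightarrow> (real^2 \<Rightarrow> real) \<Rightarrow> bool" where
  "gradient_condition A B \<phi> \<longleftrightarrow>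
     (\<forall>\<xi>\<in>B2. comparable A (norm \<xi>) 1 \<longrightarrow> comparable B (norm (grad \<phi> \<xi>)) 1)"

definition transversality_condition ::
    "real \<Rightarrow> real \<Rightarrow> real \<Rightarrow> (real^2 \<Rightarrow> real) \<Rightarrow> (real^2 \<Rightarrow> real) \<Rightarrow> (real^2 \<Rightarrow> real) \<Rightarrow> bool" where
  "transversality_condition A B c \<phi>1 \<phi>2 \<phi>3 \<longleftrightarrow>
     (\<forall>\<xi>1\<in>B2. \<forall>\<xi>2\<in>B2. \<forall>\<xi>3\<in>B2.
        \<xi>1 + \<xi>2 + \<xi>3 = 0 \<and> comparable A (Max {norm \<xi>1, norm \<xi>2, norm \<xi>3}) 1 \<and>
        \<bar>\<phi>1 \<xi>1 + \<phi>2 \<xi>2 + \<phi>3 \<xi>3\<bar> \<le> c \<longrightarrow>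
        comparable B (norm (grad \<phi>1 \<xi>1 - grad \<phi>2 \<xi>2) + norm (grad \<phi>2 \<xi>2 - grad \<phi>3 \<xi>3)) 1)"

text \<open>In the theorem, \<open>K\<close> is the constant in the size and support conditions
  \<open>N\<^sub>3 \<lesssim> N\<^sub>1 \<sim> N\<^sub>2 \<sim> 1\<close> and \<open>\<bar>\<xi>\<bar> \<sim> N\<^sub>i\<close>. These give \<open>K\<^sup>-\<^sup>3 \<le> \<bar>\<xi>\<^sub>1\<bar>, \<bar>\<xi>\<^sub>2\<bar> \<le> K\<^sup>3\<close> and
  \<open>\<bar>\<xi>\<^sub>3\<bar> \<le> K\<^sup>4\<close>, so the assumption \<open>K ^ 4 \<le> A\<close> says that the range of the gradient and
  transversality conditions covers the frequencies that occur. Without such a compatibility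
  these conditions would say nothing about \<open>\<phi>\<^sub>i\<close> on the supports.\<close>

end

theory Submission
  imports Defs
begin

text \<open>
  Write \<open>\<xi>\<^sub>3 = - \<xi>\<^sub>1 - \<xi>\<^sub>2\<close> and \<open>H = \<phi>\<^sub>1(\<xi>\<^sub>1) + \<phi>\<^sub>2(\<xi>\<^sub>2) + \<phi>\<^sub>3(\<xi>\<^sub>3)\<close>; the integrand lives on
  \<open>\<bar>H\<bar> \<le> 3\<epsilon>\<close>. By (iii) one of \<open>\<nabla>\<phi>\<^sub>1(\<xi>\<^sub>1)\<close>, \<open>\<nabla>\<phi>\<^sub>2(\<xi>\<^sub>2)\<close> differs from \<open>\<nabla>\<phi>\<^sub>3(\<xi>\<^sub>3)\<close> there; say it is the second.
  Fix \<open>\<xi>\<^sub>1\<close> and let \<open>s = \<bar>\<xi>\<^sub>1 \<times> \<xi>\<^sub>3\<bar> / N\<^sub>3\<close>. Where \<open>\<xi>\<^sub>3\<close> is nearly parallel to \<open>\<xi>\<^sub>1\<close>, radiality forces all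
  gradients to be nearly parallel to \<open>\<xi>\<^sub>1\<close>, so \<open>H\<close> is transversal along lines in the direction of \<open>\<xi>\<^sub>1\<close>; elsewhere
  \<open>s\<close> is bounded below. Hence \<open>\<integral> s\<^bsup>-\<kappa>\<^esup> d\<xi>\<^sub>3 \<lesssim> \<epsilon> N\<^sub>3 / (1 - \<kappa>)\<close> over \<open>\<bar>H\<bar> \<le> 3\<epsilon>\<close> for every \<open>\<kappa> < 1\<close>.

  Cauchy--Schwarz with \<open>\<xi>\<^sub>1\<close> fixed gives the case \<open>p = 2\<close>, even with a factor \<open>s\<^bsup>-\<gamma>\<^esup>\<close> in the integrand
  (\<open>\<gamma> \<le> 1/4\<close>). If \<open>f\<^sub>1\<close> is radial then all three functions may be taken radial; now the other Cauchy--Schwarz factor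
  carries the weight \<open>s\<close>, which is the Jacobian of the angle against \<open>\<bar>\<xi>\<^sub>1\<bar>\<close>, and its integral over the
  angle is \<open>\<lesssim> \<epsilon> / N\<^sub>3\<close>. This yields \<open>\<epsilon>\<^bsup>3/2\<^esup>\<close> with a factor \<open>s\<^bsup>\<gamma>'\<^esup>\<close> in the integrand and
  constant \<open>\<gamma>'\<^bsup>-1/2\<^esup>\<close>. For \<open>2 \<le> p < \<infinity>\<close> let \<open>A\<close> be the angular \<open>L\<^sup>p\<close> norm of \<open>f\<^sub>1\<close> and bound \<open>f\<^sub>1\<close>
  pointwise by a combination of \<open>A\<^bsup>1-p/2\<^esup> f\<^sub>1\<^bsup>p/2\<^esup> s\<^bsup>-\<gamma>\<^esup>\<close> and \<open>A s\<^bsup>\<gamma>'\<^esup>\<close> with \<open>\<gamma>' = 1/(2p)\<close>; the constant is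
  \<open>O(\<surd>p)\<close>. The case \<open>p = \<infinity>\<close> follows with \<open>p = 2 + \<bar>log \<epsilon>\<bar>\<close>.
\<close>

section \<open>Rotations, Lebesgue measure and polar coordinates in the plane\<close>

section \<open>Rotations of the plane\<close>

text \<open>The obstacle is the exponent \<kappa> = 1. In the radial case Cauchy--Schwarz pairs the
  Jacobian s with the weight s^(-1), whose strip integral diverges logarithmically at collinear
  frequencies. Keeping a power s^\<gamma>' in the integrand lowers the exponent to \<kappa> = 1 -
  1/p, at the price 1/(1 - \<kappa>) = p. That power has to be repaid at p = 2, where the strip
  integral has room for s^(-2\<gamma>). With \<gamma> = (1 - 2/p)/4 and \<gamma>' = 1/(2p) one has
  \<gamma> (2/p) = \<gamma>' (1 - 2/p), so the powers of s cancel in the geometric mean with weights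
  2/p and 1 - 2/p. Splitting the function pointwise, instead of interpolating operators, keeps the
  dependence on p explicit, and its growth sqrt p is what becomes the logarithm.

  The roles are not symmetric: the fixed frequency is dictated by the gradients, while the angular
  norm always belongs to the first function. So the bounds are needed with the angular norm in the
  fixed slot and also in the other large-frequency slot. The third function, whose frequency may be
  small, keeps its place in both cases.\<close>

definition rot :: "real \<Rightarrow> real^2 \<Rightarrow> real^2" where
  "rot \<theta> \<xi> = vector [cos \<theta> * \<xi>$1 - sin \<theta> * \<xi>$2, sin \<theta> * \<xi>$1 + cos \<theta> * \<xi>$2]"

definition cross2 :: "real^2 \<Rightarrow> real^2 \<Rightarrow> real" where
  "cross2 a b = a$1 * b$2 - a$2 * b$1"

lemma norm_real2: "norm (\<xi>::real^2) = sqrt ((\<xi>$1)\<^sup>2 + (\<xi>$2)\<^sup>2)"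
  by (simp add: norm_vec_def L2_set_def UNIV_2)

lemma rot_nth [simp]:
  "rot \<theta> \<xi> $ 1 = cos \<theta> * \<xi>$1 - sin \<theta> * \<xi>$2" "rot \<theta> \<xi> $ 2 = sin \<theta> * \<xi>$1 + cos \<theta> * \<xi>$2"
  by (simp_all add: rot_def)

lemma norm_rot [simp]: "norm (rot \<theta> \<xi>) = norm \<xi>"
proof -
  have *: "(c * x - s * y)\<^sup>2 + (s * x + c * y)\<^sup>2 = (s\<^sup>2 + c\<^sup>2) * (x\<^sup>2 + y\<^sup>2)" for c s x y :: real
    by (simp add: power2_eq_square algebra_simps)
  show ?thesis by (simp add: norm_real2 *)
qed

lemma rot_rot: "rot \<theta> (rot \<eta> \<xi>) = rot (\<theta> + \<eta>) \<xi>"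
  by (simp add: vec_eq_iff forall_2 cos_add sin_add algebra_simps)

lemma rot_0 [simp]: "rot 0 \<xi> = \<xi>"
  by (simp add: vec_eq_iff forall_2)

lemma rot_inverse [simp]: "rot (-\<theta>) (rot \<theta> \<xi>) = \<xi>" "rot \<theta> (rot (-\<theta>) \<xi>) = \<xi>"
  by (simp_all only: rot_rot) simp_all

lemma rot_add: "rot \<theta> (a + b) = rot \<theta> a + rot \<theta> b"
  and rot_diff: "rot \<theta> (a - b) = rot \<theta> a - rot \<theta> b"
  and rot_minus: "rot \<theta> (- a) = - rot \<theta> a"
  and rot_scaleR: "rot \<theta> (c *\<^sub>R a) = c *\<^sub>R rot \<theta> a"
  by (simp_all add: vec_eq_iff forall_2 algebra_simps)

lemma rot_zero [simp]: "rot \<theta> 0 = 0"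
  by (simp add: vec_eq_iff forall_2)

lemma linear_rot: "linear (rot \<theta>)"
  by (rule linearI) (simp_all add: rot_add rot_scaleR)

lemma inner_rot: "rot \<theta> a \<bullet> rot \<theta> b = a \<bullet> b"
proof -
  have *: "(c * x - s * y) * (c * x' - s * y') + (s * x + c * y) * (s * x' + c * y')
    = (s\<^sup>2 + c\<^sup>2) * (x * x' + y * y')" for c s x y x' y' :: real
    by (simp add: power2_eq_square algebra_simps)
  show ?thesis by (simp add: inner_vec_def UNIV_2 *)
qed

lemma orthogonal_rot: "orthogonal_transformation (rot \<theta>)"
  by (simp add: orthogonal_transformation_def linear_rot inner_rot)

lemma cross2_rot [simp]: "cross2 (rot \<theta> a) (rot \<theta> b) = cross2 a b"
proof -
  have *: "(c * x - s * y) * (s * x' + c * y') - (s * x + c * y) * (c * x' - s * y')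
    = (s\<^sup>2 + c\<^sup>2) * (x * y' - y * x')" for c s x y x' y' :: real
    by (simp add: power2_eq_square algebra_simps)
  show ?thesis by (simp add: cross2_def *)
qed

lemma polar_nth [simp]: "polar r \<theta> $ 1 = r * cos \<theta>" "polar r \<theta> $ 2 = r * sin \<theta>"
  by (simp_all add: polar_def)

lemma rot_polar: "rot \<theta> (polar r \<alpha>) = polar r (\<theta> + \<alpha>)"
  by (simp add: vec_eq_iff forall_2 cos_add sin_add algebra_simps)

lemma ex_polar:
  obtains \<alpha> where "0 \<le> \<alpha>" "\<alpha> < 2 * pi" "\<xi> = polar (norm \<xi>) \<alpha>"
proof (cases "\<xi> = 0")
  case True
  then have "\<xi> = polar (norm \<xi>) 0" by (simp add: vec_eq_iff forall_2)
  then show ?thesis using that[of 0] by simp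
next
  case False
  then have n: "norm \<xi> > 0" by simp
  have sq: "(\<xi>$1)\<^sup>2 + (\<xi>$2)\<^sup>2 = (norm \<xi>)\<^sup>2" by (simp add: norm_real2)
  then have "(\<xi>$1 / norm \<xi>)\<^sup>2 + (\<xi>$2 / norm \<xi>)\<^sup>2 = 1"
    using n by (simp add: power_divide add_divide_distrib[symmetric])
  then obtain t where "0 \<le> t" "t < 2 * pi" "\<xi>$1 / norm \<xi> = cos t" "\<xi>$2 / norm \<xi> = sin t"
    using sincos_total_2pi by metis
  moreover from this have "\<xi> $ 1 = norm \<xi> * cos t" "\<xi> $ 2 = norm \<xi> * sin t"
    using n by (metis less_irrefl nonzero_mult_div_cancel_left times_divide_eq_right)+
  then have "\<xi> = polar (norm \<xi>) t" unfolding vec_eq_iff forall_2 polar_nth by blast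
  ultimately show ?thesis using that[of t] by blast
qed

lemma continuous_rot: "continuous_on UNIV (\<lambda>x. rot (fst x) (snd x))"
proof -
  have "rot \<theta> \<xi> = (cos \<theta> * \<xi>$1 - sin \<theta> * \<xi>$2) *\<^sub>R axis 1 1 + (sin \<theta> * \<xi>$1 + cos \<theta> * \<xi>$2) *\<^sub>R axis 2 1" for \<theta> \<xi>
    by (simp add: vec_eq_iff forall_2 axis_def)
  then show ?thesis
    by (auto intro!: continuous_intros)
qed

lemma rot_measurable [measurable]:
  assumes [measurable]: "f \<in> borel_measurable M" "g \<in> borel_measurable M"
  shows "(\<lambda>x. rot (f x) (g x)) \<in> borel_measurable M"
  using borel_measurable_continuous_Pair[OF assms, of rot] continuous_rot
  by (simp add: case_prod_beta)

lemma cross2_measurable [measurable]: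
  assumes [measurable]: "f \<in> borel_measurable M" "g \<in> borel_measurable M"
  shows "(\<lambda>x. cross2 (f x) (g x)) \<in> borel_measurable M"
proof -
  have [measurable]: "(\<lambda>v::real^2. v $ i) \<in> borel_measurable borel" for i
    by (intro borel_measurable_continuous_onI continuous_intros)
  show ?thesis unfolding cross2_def by measurable
qed

lemma distr_lborel_rot: "distr lborel borel (rot \<theta>) = (lborel :: (real^2) measure)"
proof (rule lborel_eqI[symmetric])
  fix l u :: "real^2" assume "\<And>b. b \<in> Basis \<Longrightarrow> l \<bullet> b \<le> u \<bullet> b"
  have [measurable]: "rot \<theta> \<in> borel_measurable borel" by simp
  have eq: "rot \<theta> -` box l u = rot (-\<theta>) ` box l u"
    by (auto simp: image_iff) (metis rot_inverse(1))+
  have "rot \<theta> -` box l u \<inter> space borel \<in> sets borel" by (rule measurable_sets[where A=borel]) auto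
  then have m: "rot \<theta> -` box l u \<in> sets lborel" by simp
  have S: "box l u \<in> lmeasurable" by simp
  have "emeasure (distr lborel borel (rot \<theta>)) (box l u) = emeasure lebesgue (rot (-\<theta>) ` box l u)"
  proof -
    have "emeasure (distr lborel borel (rot \<theta>)) (box l u) = emeasure lborel (rot \<theta> -` box l u)"
      by (subst emeasure_distr) auto
    then show ?thesis using m by (simp flip: eq)
  qed
  also have "\<dots> = measure lebesgue (rot (-\<theta>) ` box l u)"
    using measurable_orthogonal_image[OF orthogonal_rot S] by (simp add: emeasure_eq_measure2)
  also have "\<dots> = emeasure lborel (box l u)"
    using measure_orthogonal_image[OF orthogonal_rot S, of "-\<theta>"] S 
    by (simp add: emeasure_eq_measure2)
  finally show "emeasure (distr lborel borel (rot \<theta>)) (box l u) = (\<Prod>b\<in>Basis. (u - l) \<bullet> b)"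
    using \<open>\<And>b. b \<in> Basis \<Longrightarrow> l \<bullet> b \<le> u \<bullet> b\<close> by (simp add: emeasure_lborel_box_eq)
qed simp

lemma borel_measurable_vec_nth [measurable]: "(\<lambda>v::real^2. v $ i) \<in> borel_measurable borel"
  by (intro borel_measurable_continuous_onI continuous_intros)

lemma nn_integral_rot:
  assumes [measurable]: "f \<in> borel_measurable borel"
  shows "(\<integral>\<^sup>+\<xi>. f (rot \<theta> \<xi>) \<partial>lborel) = (\<integral>\<^sup>+\<xi>. f \<xi> \<partial>lborel)"
proof -
  have "(\<integral>\<^sup>+\<xi>. f \<xi> \<partial>lborel) = (\<integral>\<^sup>+\<xi>. f \<xi> \<partial>distr lborel borel (rot \<theta>))"
    by (simp add: distr_lborel_rot)
  also have "\<dots> = (\<integral>\<^sup>+\<xi>. f (rot \<theta> \<xi>) \<partial>lborel)"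
    by (rule nn_integral_distr) auto
  finally show ?thesis ..
qed

lemma lborel_vec2: "distr (lborel \<Otimes>\<^sub>M lborel) borel (\<lambda>(x, y). vector [x, y]) = (lborel :: (real^2) measure)"
proof (rule lborel_eqI[symmetric])
  fix l u :: "real^2" assume *: "\<And>b. b \<in> Basis \<Longrightarrow> l \<bullet> b \<le> u \<bullet> b"
  have le: "l $ i \<le> u $ i" for i
    using *[of "axis i 1"] by (simp add: inner_axis axis_in_Basis_iff)
  have vm: "(\<lambda>(x::real, y::real). vector [x, y] :: real^2) \<in> borel_measurable (borel \<Otimes>\<^sub>M borel)"
  proof -
    have "(\<lambda>(x::real, y::real). vector [x, y] :: real^2) = (\<lambda>z. fst z *\<^sub>R axis 1 1 + snd z *\<^sub>R axis 2 1)"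
      by (auto simp: vec_eq_iff forall_2 axis_def fun_eq_iff)
    then show ?thesis by simp
  qed
  have eq: "(\<lambda>(x::real, y::real). vector [x, y]) -` box l u = {l$1<..<u$1} \<times> {l$2<..<u$2}"
    by (auto simp: mem_box_cart forall_2)
  have "emeasure (distr (lborel \<Otimes>\<^sub>M lborel) borel (\<lambda>(x, y). vector [x, y])) (box l u)
     = emeasure (lborel \<Otimes>\<^sub>M lborel) ({l$1<..<u$1} \<times> {l$2<..<u$2})"
    using vm by (subst emeasure_distr) (auto simp: eq space_pair_measure)
  also have "\<dots> = ennreal ((u - l)$1 * (u - l)$2)"
    using le by (subst lborel.emeasure_pair_measure_Times) (auto simp: ennreal_mult)
  also have "(u - l)$1 * (u - l)$2 = (\<Prod>b\<in>Basis. (u - l) \<bullet> b)"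
  proof -
    have "(\<Prod>b\<in>(\<lambda>i. axis i 1) ` (UNIV::2 set). (u - l) \<bullet> b) = (\<Prod>i\<in>UNIV. (u - l) $ i)"
      by (subst prod.reindex) (auto simp: inj_on_def axis_eq_axis inner_axis)
    moreover have "(Basis :: (real^2) set) = (\<lambda>i. axis i 1) ` (UNIV::2 set)"
      by (auto simp: Basis_vec_def)
    ultimately show ?thesis by (simp add: UNIV_2)
  qed
  finally show "emeasure (distr (lborel \<Otimes>\<^sub>M lborel) borel (\<lambda>(x, y). vector [x, y])) (box l u)
    = (\<Prod>b\<in>Basis. (u - l) \<bullet> b)" .
qed simp

lemma nn_integral_vec2:
  assumes [measurable]: "f \<in> borel_measurable borel"
  shows "(\<integral>\<^sup>+\<xi>. f \<xi> \<partial>lborel) = (\<integral>\<^sup>+x. \<integral>\<^sup>+y. f (vector [x, y] :: real^2) \<partial>lborel \<partial>lborel)"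
    and "(\<integral>\<^sup>+\<xi>. f \<xi> \<partial>lborel) = (\<integral>\<^sup>+y. \<integral>\<^sup>+x. f (vector [x, y] :: real^2) \<partial>lborel \<partial>lborel)"
proof -
  have "(\<lambda>z::real\<times>real. vector [fst z, snd z] :: real^2) = (\<lambda>z. fst z *\<^sub>R axis 1 1 + snd z *\<^sub>R axis 2 1)"
    by (auto simp: vec_eq_iff forall_2 axis_def fun_eq_iff)
  then have vm [measurable]: "(\<lambda>z::real\<times>real. vector [fst z, snd z] :: real^2) \<in> borel_measurable (borel \<Otimes>\<^sub>M borel)"
    by simp
  have "(\<integral>\<^sup>+\<xi>. f \<xi> \<partial>lborel) = (\<integral>\<^sup>+\<xi>. f \<xi> \<partial>distr (lborel \<Otimes>\<^sub>M lborel) borel (\<lambda>z. vector [fst z, snd z]))"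
    using lborel_vec2 by (simp only: case_prod_beta')
  also have "\<dots> = (\<integral>\<^sup>+z. f (vector [fst z, snd z]) \<partial>(lborel \<Otimes>\<^sub>M lborel))"
    by (rule nn_integral_distr) (use vm in auto)
  finally have *: "(\<integral>\<^sup>+\<xi>. f \<xi> \<partial>lborel) = (\<integral>\<^sup>+z. f (vector [fst z, snd z]) \<partial>(lborel \<Otimes>\<^sub>M lborel))" .
  show "(\<integral>\<^sup>+\<xi>. f \<xi> \<partial>lborel) = (\<integral>\<^sup>+x. \<integral>\<^sup>+y. f (vector [x, y] :: real^2) \<partial>lborel \<partial>lborel)"
    unfolding * by (subst lborel.nn_integral_fst[symmetric]) simp_all
  show "(\<integral>\<^sup>+\<xi>. f \<xi> \<partial>lborel) = (\<integral>\<^sup>+y. \<integral>\<^sup>+x. f (vector [x, y] :: real^2) \<partial>lborel \<partial>lborel)"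
    unfolding * by (subst lborel_pair.nn_integral_snd[symmetric]) simp_all
qed

text \<open>The image of Lebesgue measure under the norm has density 2 pi r, because a closed disc
  of radius a has area pi a^2; the half-lines generate the Borel sets and have finite mass.\<close>

lemma nn_integral_radial:
  assumes [measurable]: "h \<in> borel_measurable borel"
  shows "(\<integral>\<^sup>+\<xi>. h (norm (\<xi> :: real^2)) \<partial>lborel) = (\<integral>\<^sup>+r. h r * ennreal (2 * pi * r) * indicator {0..} r \<partial>lborel)"
proof -
  let ?D = "density lborel (\<lambda>r::real. ennreal (2 * pi * r) * indicator {0..} r)"
  have "distr lborel borel (norm :: real^2 \<Rightarrow> real) = ?D"
  proof (rule measure_eqI_generator_eq[where E="range atMost" and \<Omega>=UNIV and A="\<lambda>i. {..real i}"])
    show "Int_stable (range (atMost :: real \<Rightarrow> _))"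
      by (auto simp: Int_stable_def)
    show "emeasure (distr lborel borel (norm :: real^2 \<Rightarrow> real)) X = emeasure ?D X" if "X \<in> range atMost" for X
    proof -
      from that obtain a where X: "X = {..a}" by auto
      have e1: "emeasure (distr lborel borel (norm :: real^2 \<Rightarrow> real)) X = emeasure lborel (cball (0::real^2) a)"
        by (subst emeasure_distr) (auto simp: X cball_def intro!: arg_cong[where f="emeasure lborel"])
      show ?thesis
      proof (cases "a < 0")
        case True
        have z: "ennreal (2 * pi * r) * indicator {0..} r * indicator {..a} r = 0" for r
          using True by (simp add: indicator_def)
        have "emeasure ?D X = 0"
          unfolding X by (subst emeasure_density) (simp_all add: z)
        then show ?thesis using e1 True by simp
      next
        case False
        have z: "ennreal (2 * pi * r) * indicator {0..} r * indicator {..a} r = ennreal (2 * pi * r) * indicator {0..a} r" for r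
          by (simp add: indicator_def)
        have "emeasure ?D X = (\<integral>\<^sup>+r. ennreal (2 * pi * r) * indicator {0..a} r \<partial>lborel)"
          unfolding X by (subst emeasure_density) (simp_all add: z)
        also have "\<dots> = ennreal (pi * a\<^sup>2 - pi * 0\<^sup>2)"
          using False by (intro nn_integral_FTC_Icc) (auto intro!: derivative_eq_intros)
        finally show ?thesis using e1 False emeasure_cball[of a "0::real^2"] by (simp add: unit_ball_vol_2 mult.commute)
      qed
    qed
    show "(\<Union>i. {..real i}) = UNIV" by (simp add: set_eq_iff real_arch_simple)
    show "emeasure (distr lborel borel (norm :: real^2 \<Rightarrow> real)) {..real i} \<noteq> \<infinity>" for i
    proof -
      have "emeasure (distr lborel borel (norm :: real^2 \<Rightarrow> real)) {..real i} = emeasure lborel (cball (0::real^2) i)"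
        by (subst emeasure_distr) (auto simp: cball_def intro!: arg_cong[where f="emeasure lborel"])
      then show ?thesis using emeasure_lborel_cball_finite[of "0::real^2" "real i"] by simp
    qed
    have "sets (borel :: real measure) = sigma_sets UNIV (range atMost)"
      by (subst borel_eq_atMost) simp
    then show "sets (distr lborel borel (norm :: real^2 \<Rightarrow> real)) = sigma_sets UNIV (range atMost)"
      "sets ?D = sigma_sets UNIV (range atMost)" by simp_all
  qed auto
  then have eq: "distr lborel borel (norm :: real^2 \<Rightarrow> real) = ?D" .
  have "(\<integral>\<^sup>+\<xi>. h (norm (\<xi> :: real^2)) \<partial>lborel) = (\<integral>\<^sup>+r. h r \<partial>distr lborel borel (norm :: real^2 \<Rightarrow> real))"
    by (rule nn_integral_distr[symmetric]) auto
  also have "\<dots> = (\<integral>\<^sup>+r. (ennreal (2 * pi * r) * indicator {0..} r) * h r \<partial>lborel)"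
    unfolding eq by (rule nn_integral_density) auto
  finally show ?thesis by (simp only: mult_ac)
qed

abbreviation circ :: "(real \<Rightarrow> ennreal) \<Rightarrow> ennreal" where
  "circ h \<equiv> \<integral>\<^sup>+\<theta>. h \<theta> * indicator {0..<2*pi} \<theta> \<partial>lborel"

text \<open>The rotations of \<open>\<xi>\<close> trace the circle through it, starting at its polar
  angle. By periodicity the window of length 2 pi can be moved back to start at 0.\<close>

lemma nn_integral_rot_angle:
  fixes k :: "real^2 \<Rightarrow> ennreal"
  assumes [measurable]: "k \<in> borel_measurable borel"
  shows "(circ (\<lambda>\<theta>. k (rot \<theta> \<xi>)))
    = (circ (\<lambda>\<theta>. k (polar (norm \<xi>) \<theta>)))"
proof -
  obtain \<alpha> where \<alpha>: "0 \<le> \<alpha>" "\<alpha> < 2 * pi" "\<xi> = polar (norm \<xi>) \<alpha>" by (rule ex_polar[of \<xi>])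
  define q where "q t = k (polar (norm \<xi>) t)" for t
  have pol: "polar (norm \<xi>) t = rot t (polar (norm \<xi>) 0)" for t by (simp add: rot_polar)
  have [measurable]: "q \<in> borel_measurable borel" unfolding q_def by (subst pol) measurable
  have per: "q (2 * pi + t) = q t" for t
    unfolding q_def polar_def by (simp add: sin_add cos_add)
  have "(circ (\<lambda>\<theta>. k (rot \<theta> \<xi>))) = (\<integral>\<^sup>+\<theta>. q (\<alpha> + 1 * \<theta>) * indicator {\<alpha>..<\<alpha>+2*pi} (\<alpha> + 1 * \<theta>) \<partial>lborel)"
    by (subst \<alpha>(3)) (auto intro!: nn_integral_cong simp: q_def rot_polar add.commute indicator_def)
  also have "\<dots> = (\<integral>\<^sup>+\<theta>. q \<theta> * indicator {\<alpha>..<\<alpha>+2*pi} \<theta> \<partial>lborel)"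
    by (subst nn_integral_real_affine[where c=1 and t=\<alpha> and f="\<lambda>\<theta>. q \<theta> * indicator {\<alpha>..<\<alpha>+2*pi} \<theta>"]) auto
  also have "\<dots> = (\<integral>\<^sup>+\<theta>. q \<theta> * indicator {\<alpha>..<2*pi} \<theta> + q \<theta> * indicator {2*pi..<2*pi+\<alpha>} \<theta> \<partial>lborel)"
    using \<alpha> by (intro nn_integral_cong) (auto simp: indicator_def)
  also have "\<dots> = (\<integral>\<^sup>+\<theta>. q \<theta> * indicator {\<alpha>..<2*pi} \<theta> \<partial>lborel) + (\<integral>\<^sup>+\<theta>. q \<theta> * indicator {2*pi..<2*pi+\<alpha>} \<theta> \<partial>lborel)"
    by (rule nn_integral_add) auto
  also have "(\<integral>\<^sup>+\<theta>. q \<theta> * indicator {2*pi..<2*pi+\<alpha>} \<theta> \<partial>lborel) = (\<integral>\<^sup>+\<theta>. q \<theta> * indicator {0..<\<alpha>} \<theta> \<partial>lborel)"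
    by (subst nn_integral_real_affine[where c=1 and t="2*pi"])
       (auto simp: per indicator_def intro!: nn_integral_cong)
  also have "(\<integral>\<^sup>+\<theta>. q \<theta> * indicator {\<alpha>..<2*pi} \<theta> \<partial>lborel) + \<dots>
     = (\<integral>\<^sup>+\<theta>. q \<theta> * indicator {\<alpha>..<2*pi} \<theta> + q \<theta> * indicator {0..<\<alpha>} \<theta> \<partial>lborel)"
    by (rule nn_integral_add[symmetric]) auto
  also have "\<dots> = (circ (\<lambda>\<theta>. q \<theta>))"
    using \<alpha> by (intro nn_integral_cong) (auto simp: indicator_def)
  finally show ?thesis by (simp add: q_def)
qed

section \<open>Sublevel sets on intervals, and the gradient of a radial phase\<close>

section \<open>Radial hypersurfaces\<close>

text \<open>The derivative may vanish elsewhere in \<open>I\<close>, so the set can have many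
  pieces. Two of its points in a cell of length at most \<open>\<delta>\<close> have
  \<open>\<bar>\<psi>'\<bar> \<ge> b / 2\<close> between them, and the mean value theorem makes them
  close. The number of cells depends only on \<open>\<beta>\<close>, \<open>Q\<close> and
  \<open>b\<close>, which gives uniformity in \<open>\<psi>\<close> and \<open>I\<close>.\<close>

lemma fiber_bound:
  fixes \<beta> Q b :: real
  assumes \<beta>: "0 < \<beta>" and Q: "0 \<le> Q" and b: "0 < b"
  obtains C where "C > 0"
    "\<And>(\<psi> :: real \<Rightarrow> real) \<psi>' I (e :: real). is_interval I \<Longrightarrow> I \<subseteq> {-2..2} \<Longrightarrow> (\<And>t. t \<in> I \<Longrightarrow> (\<psi> has_real_derivative \<psi>' t) (at t)) \<Longrightarrow>
      (\<And>s t. s \<in> I \<Longrightarrow> t \<in> I \<Longrightarrow> \<bar>\<psi>' s - \<psi>' t\<bar> \<le> Q * \<bar>s - t\<bar> powr \<beta>) \<Longrightarrow> 0 \<le> e \<Longrightarrow>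
      (\<integral>\<^sup>+t. indicator {t \<in> I. \<bar>\<psi> t\<bar> \<le> e \<and> b \<le> \<bar>\<psi>' t\<bar>} t \<partial>lborel) \<le> ennreal (C * e)"
proof -
  \<comment> \<open>Over a distance \<open>\<delta>\<close> the derivative changes by at most
    \<open>b / 2\<close>; the summand 1 keeps the quotient defined for \<open>Q = 0\<close>.\<close>
  define \<delta> where "\<delta> = (b / (2 * (Q + 1))) powr (1 / \<beta>)"
  have \<delta>: "\<delta> > 0" using b Q by (simp add: \<delta>_def)
  have Q\<delta>: "Q * \<delta> powr \<beta> \<le> b / 2"
  proof -
    have "\<delta> powr \<beta> = b / (2 * (Q + 1))" using b Q \<beta> by (simp add: \<delta>_def powr_powr)
    then have "Q * \<delta> powr \<beta> = (Q / (Q + 1)) * (b / 2)" using Q by (simp add: field_simps)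
    also have "\<dots> \<le> 1 * (b / 2)" using Q b by (intro mult_right_mono) auto
    finally show ?thesis by simp
  qed
  obtain n :: nat where n: "4 / \<delta> < real n" using reals_Archimedean2 by blast
  have n0: "real n > 0" using n \<delta> by (smt (verit) divide_pos_pos)
  have n\<delta>: "4 / real n \<le> \<delta>" using n \<delta> n0 by (simp add: field_simps)
  \<comment> \<open>There are \<open>n + 1\<close> cells, since the endpoint 2 has index
    \<open>n\<close>, and in each the set is covered by an interval of length
    \<open>8 * e / b\<close>.\<close>
  define C where "C = (real n + 1) * (8 / b)"
  show thesis
  proof (rule that[of C])
    show "C > 0" using b n0 by (simp add: C_def)
    fix \<psi> \<psi>' :: "real \<Rightarrow> real" and I and e :: real
    assume I: "is_interval I" "I \<subseteq> {-2..2}"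
      and D: "\<And>t. t \<in> I \<Longrightarrow> (\<psi> has_real_derivative \<psi>' t) (at t)"
      and H: "\<And>s t. s \<in> I \<Longrightarrow> t \<in> I \<Longrightarrow> \<bar>\<psi>' s - \<psi>' t\<bar> \<le> Q * \<bar>s - t\<bar> powr \<beta>"
      and e: "0 \<le> e"
    define T where "T = {t \<in> I. \<bar>\<psi> t\<bar> \<le> e \<and> b \<le> \<bar>\<psi>' t\<bar>}"
    define cell where "cell t = nat \<lfloor>(t + 2) * real n / 4\<rfloor>" for t
    have cell_le: "cell t \<le> n" if "t \<in> T" for t
    proof -
      have "t \<le> 2" using that I(2) by (auto simp: T_def)
      then have "(t + 2) * real n / 4 \<le> real n" using n0 by (simp add: field_simps)
      then show ?thesis unfolding cell_def by linarith
    qed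
    have cell_dist: "\<bar>s - t\<bar> \<le> \<delta>" if "s \<in> T" "t \<in> T" "cell s = cell t" for s t
    proof -
      have "0 \<le> (s + 2) * real n / 4" "0 \<le> (t + 2) * real n / 4"
        using that I(2) n0 by (auto simp: T_def)
      then have "\<lfloor>(s + 2) * real n / 4\<rfloor> = \<lfloor>(t + 2) * real n / 4\<rfloor>"
        using that(3) unfolding cell_def by (simp add: eq_nat_nat_iff)
      then have "\<bar>(s + 2) * real n / 4 - (t + 2) * real n / 4\<bar> \<le> 1" by linarith
      also have "(s + 2) * real n / 4 - (t + 2) * real n / 4 = (s - t) * (real n / 4)"
        by (simp add: field_simps)
      finally have "\<bar>s - t\<bar> * (real n / 4) \<le> 1" using n0 by (simp add: abs_mult)
      then have "\<bar>s - t\<bar> \<le> 4 / real n" using n0 by (simp add: field_simps)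
      then show ?thesis using n\<delta> by simp
    qed
    have close: "\<bar>s - t\<bar> \<le> 4 * e / b" if st: "s \<in> T" "t \<in> T" "cell s = cell t" for s t
    proof -
      have *: "\<bar>s - t\<bar> \<le> 4 * e / b" if st: "s \<in> T" "t \<in> T" "cell s = cell t" "s < t" for s t
      proof -
        have sub: "{s..t} \<subseteq> I"
          using I(1) st unfolding is_interval_1 T_def by (auto intro: less_imp_le)
        obtain z where z: "s < z" "z < t" "\<psi> t - \<psi> s = (t - s) * \<psi>' z"
          using MVT2[OF st(4), of \<psi> \<psi>'] D sub by (metis atLeastAtMost_iff subsetD)
        have zI: "z \<in> I" using sub z by auto
        have "\<bar>\<psi>' s - \<psi>' z\<bar> \<le> Q * \<bar>s - z\<bar> powr \<beta>" using H zI st by (auto simp: T_def)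
        also have "\<dots> \<le> Q * \<delta> powr \<beta>"
          using cell_dist[OF st(1-3)] z Q \<beta> by (intro mult_left_mono powr_mono2) auto
        finally have "\<bar>\<psi>' s - \<psi>' z\<bar> \<le> b / 2" using Q\<delta> by simp
        moreover have "b \<le> \<bar>\<psi>' s\<bar>" using st by (simp add: T_def)
        ultimately have "b / 2 \<le> \<bar>\<psi>' z\<bar>" by linarith
        then have "(t - s) * (b / 2) \<le> \<bar>\<psi> t - \<psi> s\<bar>" using z st(4) by (simp add: abs_mult mult_left_mono)
        also have "\<dots> \<le> 2 * e" using st by (auto simp: T_def)
        finally show ?thesis using b st(4) by (simp add: field_simps)
      qed
      consider "s < t" | "t < s" | "s = t" by linarith
      then show ?thesis using *[of s t] *[of t s] st e b by cases (auto simp: abs_minus_commute)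
    qed
    have "\<exists>t0. \<forall>t\<in>T. cell t = i \<longrightarrow> \<bar>t - t0\<bar> \<le> 4 * e / b" for i
      using close by metis
    then obtain t0 where t0: "\<And>i t. t \<in> T \<Longrightarrow> cell t = i \<Longrightarrow> \<bar>t - t0 i\<bar> \<le> 4 * e / b" by metis
    have "(\<integral>\<^sup>+t. indicator T t \<partial>lborel)
        \<le> (\<integral>\<^sup>+t. (\<Sum>i\<in>{..n}. indicator {t0 i - 4 * e / b..t0 i + 4 * e / b} t) \<partial>lborel)"
    proof (rule nn_integral_mono)
      fix t
      show "indicator T t \<le> (\<Sum>i\<in>{..n}. indicator {t0 i - 4 * e / b..t0 i + 4 * e / b} t :: ennreal)"
      proof (cases "t \<in> T")
        case True
        have "indicator T t \<le> (indicator {t0 (cell t) - 4 * e / b..t0 (cell t) + 4 * e / b} t :: ennreal)"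
          using t0[OF True refl] by (auto simp: indicator_def abs_le_iff)
        also have "\<dots> \<le> (\<Sum>i\<in>{..n}. indicator {t0 i - 4 * e / b..t0 i + 4 * e / b} t)"
          using cell_le[OF True] by (intro member_le_sum) auto
        finally show ?thesis .
      qed simp
    qed
    also have "\<dots> = (\<Sum>i\<in>{..n}. ennreal (8 * e / b))"
      using e b by (subst nn_integral_sum) (auto intro!: sum.cong)
    also have "\<dots> = ennreal (C * e)"
      using e b by (subst sum_ennreal) (auto simp: C_def algebra_simps add_divide_distrib)
    finally show "(\<integral>\<^sup>+t. indicator {t \<in> I. \<bar>\<psi> t\<bar> \<le> e \<and> b \<le> \<bar>\<psi>' t\<bar>} t \<partial>lborel) \<le> ennreal (C * e)"
      by (simp add: T_def)
  qed
qed

text \<open>Between the infimum and the supremum of \<open>T\<close> the function \<open>u\<close>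
  is monotone, so the integral there is a difference of two values. These endpoints need not lie in
  \<open>T\<close>; passing to the closure carries the oscillation bound over to them.\<close>

lemma nn_integral_deriv_small_osc:
  fixes u u' :: "real \<Rightarrow> real"
  assumes D: "\<And>x. (u has_real_derivative u' x) (at x)" and u': "u' \<in> borel_measurable borel"
    and pos: "\<And>x. x \<in> {a..b} \<Longrightarrow> 0 \<le> u' x"
    and T: "T \<subseteq> {a..b}" and osc: "\<And>x y. x \<in> T \<Longrightarrow> y \<in> T \<Longrightarrow> \<bar>u x - u y\<bar> \<le> d"
  shows "(\<integral>\<^sup>+x. indicator T x * ennreal (u' x) \<partial>lborel) \<le> ennreal d"
proof (cases "T = {}")
  case False
  have bd: "bdd_above T" "bdd_below T" using T by (auto intro: bdd_above_mono bdd_below_mono)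
  define m M where "m = Inf T" and "M = Sup T"
  have cu: "continuous_on UNIV u" using D by (meson DERIV_isCont continuous_at_imp_continuous_on)
  have "closure T \<subseteq> {x. \<bar>u x - u y\<bar> \<le> d}" if "y \<in> T" for y
    by (rule closure_minimal) (use that osc cu in \<open>auto intro!: closed_Collect_le continuous_intros\<close>)
  then have 1: "\<bar>u x - u y\<bar> \<le> d" if "y \<in> T" "x \<in> closure T" for x y using that by blast
  have "closure T \<subseteq> {y. \<bar>u x - u y\<bar> \<le> d}" if "x \<in> closure T" for x
    by (rule closure_minimal) (use that 1 cu in \<open>auto intro!: closed_Collect_le continuous_intros\<close>)
  moreover have "m \<in> closure T" "M \<in> closure T"
    using False bd by (auto simp: m_def M_def closure_contains_Inf closure_contains_Sup)
  ultimately have d: "\<bar>u M - u m\<bar> \<le> d" by blast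
  have mM: "T \<subseteq> {m..M}" using bd by (auto simp: m_def M_def cInf_lower cSup_upper)
  obtain x0 where x0: "x0 \<in> T" using False by blast
  then have "m \<le> M" using mM by fastforce
  have "a \<le> m" unfolding m_def by (rule cInf_greatest[OF False]) (use T in auto)
  moreover have "M \<le> b" unfolding M_def by (rule cSup_least[OF False]) (use T in auto)
  ultimately have sub: "{m..M} \<subseteq> {a..b}" by auto
  have "(\<integral>\<^sup>+x. indicator T x * ennreal (u' x) \<partial>lborel) \<le> (\<integral>\<^sup>+x. ennreal (u' x) * indicator {m..M} x \<partial>lborel)"
    using mM by (intro nn_integral_mono) (auto simp: indicator_def)
  also have "\<dots> = ennreal (u M - u m)"
  proof (rule nn_integral_FTC_Icc)
    show "(u has_real_derivative u' x) (at x)" for x by (rule D)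
    show "0 \<le> u' x" if "x \<in> {m..M}" for x using pos that sub by blast
  qed (use u' \<open>m \<le> M\<close> in auto)
  also have "\<dots> \<le> ennreal d" using d by (intro ennreal_leI) linarith
  finally show ?thesis .
qed simp


text \<open>The gradient is a parameter \<open>g\<close>, and \<open>\<phi>\<close> and
  \<open>g\<close> are Borel on the whole plane so that sets defined by them are measurable
  everywhere; the analytic conditions concern \<open>B2\<close> alone.\<close>

locale radial_C1 =
  fixes M \<beta> :: real and \<phi> :: "real^2 \<Rightarrow> real" and g :: "real^2 \<Rightarrow> real^2"
  assumes M: "0 \<le> M" and \<beta>: "0 < \<beta>" "\<beta> \<le> 1"
    and phi_measurable [measurable]: "\<phi> \<in> borel_measurable borel"
    and g_measurable [measurable]: "g \<in> borel_measurable borel"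
    and deriv: "x \<in> B2 \<Longrightarrow> (\<phi> has_derivative (\<lambda>v. v \<bullet> g x)) (at x)"
    and holder: "x \<in> B2 \<Longrightarrow> y \<in> B2 \<Longrightarrow> norm (g x - g y) \<le> M * norm (x - y) powr \<beta>"
    and phi_rot: "x \<in> B2 \<Longrightarrow> \<phi> (rot \<theta> x) = \<phi> x"
begin

lemma B2_rot [simp]: "rot \<theta> x \<in> B2 \<longleftrightarrow> x \<in> B2"
  by (simp add: B2_def)

lemma open_B2: "open B2"
  by (simp add: B2_def)

text \<open>By radiality \<open>\<phi>\<close> agrees near \<open>x\<close> with its composition
  with the rotation; uniqueness of the derivative then makes the gradient equivariant.\<close>

lemma g_rot:
  assumes "x \<in> B2"
  shows "g (rot \<theta> x) = rot \<theta> (g x)"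
proof -
  have rotx: "rot \<theta> x \<in> B2" using assms by simp
  have bl: "bounded_linear (rot \<theta>)" using linear_rot by (simp add: linear_linear)
  have "((\<lambda>x. \<phi> (rot \<theta> x)) has_derivative (\<lambda>v. rot \<theta> v \<bullet> g (rot \<theta> x))) (at x)"
    using has_derivative_compose[OF bounded_linear_imp_has_derivative[OF bl] deriv[OF rotx]] .
  then have "(\<phi> has_derivative (\<lambda>v. rot \<theta> v \<bullet> g (rot \<theta> x))) (at x)"
    using open_B2 assms by (rule has_derivative_transform_within_open) (simp add: phi_rot)
  from has_derivative_unique[OF this deriv[OF assms]]
  have "rot \<theta> v \<bullet> g (rot \<theta> x) = v \<bullet> g x" for v by (rule fun_cong)
  then have "v \<bullet> (g (rot \<theta> x) - rot \<theta> (g x)) = 0" for v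
    by (metis inner_diff_right inner_rot right_minus_eq rot_inverse(2))
  then show ?thesis by (metis inner_eq_zero_iff right_minus_eq)
qed

text \<open>Rotation by pi is -1, so the gradient at the origin equals its own negative. The Hoelder
  condition thereby becomes a size bound for the gradient.\<close>

lemma g_0: "g 0 = 0"
proof -
  have "g (rot pi 0) = rot pi (g 0)" by (rule g_rot) (simp add: B2_def)
  moreover have "rot pi (g 0) = - g 0" by (simp add: vec_eq_iff forall_2)
  ultimately show ?thesis by (simp add: vec_eq_iff)
qed

lemma norm_g: "x \<in> B2 \<Longrightarrow> norm (g x) \<le> M * norm x powr \<beta>"
  using holder[of x 0] g_0 by (simp add: B2_def)

text \<open>Differentiate \<open>\<phi>\<close> along the circle through \<open>x\<close>.\<close>

lemma cross2_g:
  assumes "x \<in> B2"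
  shows "cross2 x (g x) = 0"
proof -
  have eq: "rot \<theta> x = (cos \<theta> * x$1 - sin \<theta> * x$2) *\<^sub>R axis 1 1 + (sin \<theta> * x$1 + cos \<theta> * x$2) *\<^sub>R axis 2 1" for \<theta>
    by (simp add: vec_eq_iff forall_2 axis_def)
  have "((\<lambda>\<theta>. rot \<theta> x) has_vector_derivative (- x$2) *\<^sub>R axis 1 1 + x$1 *\<^sub>R axis 2 1) (at 0)"
    unfolding eq by (auto intro!: derivative_eq_intros)
  moreover have "(\<phi> has_derivative (\<lambda>v. v \<bullet> g x)) (at (rot 0 x))"
    using deriv[OF assms] by simp
  ultimately have "((\<lambda>\<theta>. \<phi> (rot \<theta> x)) has_derivative (\<lambda>t. (t *\<^sub>R ((- x$2) *\<^sub>R axis 1 1 + x$1 *\<^sub>R axis 2 1)) \<bullet> g x)) (at 0)"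
    unfolding has_vector_derivative_def by (rule has_derivative_compose)
  moreover have "((\<lambda>\<theta>. \<phi> (rot \<theta> x)) has_derivative (\<lambda>t. 0)) (at 0)"
    using assms by (simp add: phi_rot)
  ultimately have "(\<lambda>t. (t *\<^sub>R ((- x$2) *\<^sub>R axis 1 1 + x$1 *\<^sub>R axis 2 1)) \<bullet> g x) = (\<lambda>t::real. 0)"
    by (rule has_derivative_unique)
  from fun_cong[OF this, of 1] show ?thesis
    by (simp add: inner_add_left inner_axis' cross2_def algebra_simps)
qed

text \<open>Since \<open>g x\<close> is parallel to \<open>x\<close>, \<open>\<bar>g x $ 2\<bar> *
  norm x = \<bar>x $ 2\<bar> * norm (g x)\<close>, and \<open>norm x powr (\<beta> - 1)\<close> is
  largest for small norms because \<beta> \<le> 1. This measures near-parallelism: at small height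
  above the first axis every gradient has a small second component.\<close>

lemma g_snd_le:
  assumes "x \<in> B2"
  shows "\<bar>g x $ 2\<bar> \<le> M * \<bar>x $ 2\<bar> powr \<beta>"
proof (cases "x = 0")
  case False
  have c: "x$1 * g x $ 2 = x$2 * g x $ 1" using cross2_g[OF assms] by (simp add: cross2_def)
  have "(g x $ 2)\<^sup>2 * ((x$1)\<^sup>2 + (x$2)\<^sup>2) = (x$1 * g x $ 2)\<^sup>2 + (x$2)\<^sup>2 * (g x $ 2)\<^sup>2"
    by (simp add: algebra_simps power_mult_distrib)
  also have "\<dots> = (x$2)\<^sup>2 * ((g x $ 1)\<^sup>2 + (g x $ 2)\<^sup>2)"
    by (simp add: c algebra_simps power_mult_distrib)
  finally have "sqrt ((g x $ 2)\<^sup>2 * ((x$1)\<^sup>2 + (x$2)\<^sup>2)) = sqrt ((x$2)\<^sup>2 * ((g x $ 1)\<^sup>2 + (g x $ 2)\<^sup>2))"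
    by simp
  then have 1: "\<bar>g x $ 2\<bar> * norm x = \<bar>x$2\<bar> * norm (g x)"
    by (simp add: real_sqrt_mult norm_real2)
  show ?thesis
  proof (cases "x $ 2 = 0")
    case True
    then show ?thesis using 1 False M by simp
  next
    case x2: False
    have le: "\<bar>x $ 2\<bar> \<le> norm x" by (rule component_le_norm_cart)
    have n: "norm x > 0" using False by simp
    have "\<bar>g x $ 2\<bar> * norm x \<le> \<bar>x$2\<bar> * (M * norm x powr \<beta>)"
      unfolding 1 using norm_g[OF assms] by (intro mult_left_mono) auto
    also have "norm x powr \<beta> = norm x powr (\<beta> - 1) * norm x"
      using n by (simp add: powr_mult_base powr_diff)
    finally have "\<bar>g x $ 2\<bar> * norm x \<le> (M * (\<bar>x$2\<bar> * norm x powr (\<beta> - 1))) * norm x"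
      by (simp add: mult_ac)
    then have "\<bar>g x $ 2\<bar> \<le> M * (\<bar>x$2\<bar> * norm x powr (\<beta> - 1))" using n by simp
    also have "\<dots> \<le> M * (\<bar>x$2\<bar> * \<bar>x$2\<bar> powr (\<beta> - 1))"
      using M \<beta> x2 le by (intro mult_left_mono powr_mono2') auto
    also have "\<bar>x$2\<bar> * \<bar>x$2\<bar> powr (\<beta> - 1) = \<bar>x$2\<bar> powr \<beta>"
      using x2 by (simp add: powr_diff)
    finally show ?thesis .
  qed
qed (simp add: g_0 M)

text \<open>Along a ray the gradient is parallel to the ray, so its lower bound is a lower bound for
  the modulus of the derivative of the radial profile \<open>h\<close>. A short range of values of
  \<open>\<phi>\<close> then confines the radius to a short interval.\<close>

lemma dist_norm_le:
  assumes "1 \<le> A" "1 \<le> B"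
    and lower: "\<And>x. x \<in> B2 \<Longrightarrow> 1 / A \<le> norm x \<Longrightarrow> norm x \<le> A \<Longrightarrow> 1 / B \<le> norm (g x)"
    and xy: "x \<in> B2" "1 / A \<le> norm x" "norm x \<le> A" "y \<in> B2" "1 / A \<le> norm y" "norm y \<le> A"
  shows "\<bar>norm x - norm y\<bar> \<le> B * \<bar>\<phi> x - \<phi> y\<bar>"
proof -
  define h where "h t = \<phi> (t *\<^sub>R axis 1 1)" for t
  have h_norm: "h (norm x) = \<phi> x" if "x \<in> B2" for x
  proof -
    obtain \<alpha> where a: "x = polar (norm x) \<alpha>" using ex_polar[of x] by blast
    have "norm x *\<^sub>R axis 1 1 = rot (-\<alpha>) x"
    proof -
      have "rot (-\<alpha>) (polar (norm x) \<alpha>) = polar (norm x) 0" by (simp add: rot_polar)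
      also have "\<dots> = norm x *\<^sub>R axis 1 1" by (simp add: vec_eq_iff forall_2 axis_def)
      finally show ?thesis using a by simp
    qed
    then show ?thesis using that by (simp add: h_def phi_rot)
  qed
  have in_B2: "t *\<^sub>R axis 1 1 \<in> B2" if "0 \<le> t" "t < 2" for t
    using that by (simp add: B2_def)
  have Dh: "(h has_real_derivative g (t *\<^sub>R axis 1 1) $ 1) (at t)" if "0 \<le> t" "t < 2" for t
  proof -
    have "((\<lambda>t::real. t *\<^sub>R axis 1 1 :: real^2) has_derivative (\<lambda>s. s *\<^sub>R axis 1 1)) (at t)"
      by (auto intro!: derivative_eq_intros)
    from has_derivative_compose[OF this deriv[OF in_B2[OF that]]]
    show ?thesis
      unfolding h_def has_field_derivative_def by (simp add: inner_axis' mult_commute_abs)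
  qed
  have main: "t - s \<le> B * \<bar>h s - h t\<bar>"
    if "s < t" "1 / A \<le> s" "t \<le> A" "t < 2" for s t
  proof -
    have "0 < 1 / A" using \<open>1 \<le> A\<close> by simp
    then have s0: "0 < s" using that by linarith
    have "(h has_real_derivative g (u *\<^sub>R axis 1 1) $ 1) (at u)" if "s \<le> u" "u \<le> t" for u
      using that \<open>t < 2\<close> s0 by (intro Dh) auto
    from MVT2[OF \<open>s < t\<close> this]
    obtain z where z: "s < z" "z < t" "h t - h s = (t - s) * g (z *\<^sub>R axis 1 1) $ 1" by auto
    have zB: "z *\<^sub>R axis 1 1 \<in> B2" using z s0 that by (intro in_B2) auto
    have "1 / B \<le> norm (g (z *\<^sub>R axis 1 1))" using z s0 that zB by (intro lower) auto
    moreover have "g (z *\<^sub>R axis 1 1) $ 2 = 0"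
      using cross2_g[OF zB] z s0 by (simp add: cross2_def axis_def)
    ultimately have "1 / B \<le> \<bar>g (z *\<^sub>R axis 1 1) $ 1\<bar>" by (simp add: norm_real2)
    then have "(t - s) * (1 / B) \<le> (t - s) * \<bar>g (z *\<^sub>R axis 1 1) $ 1\<bar>"
      using \<open>s < t\<close> by (intro mult_left_mono) auto
    also have "\<dots> = \<bar>h s - h t\<bar>"
      using \<open>s < t\<close> z(3) by (simp add: abs_minus_commute[of "h s"] abs_mult)
    finally have "(t - s) * (1 / B) \<le> \<bar>h s - h t\<bar>" .
    then show ?thesis using \<open>1 \<le> B\<close> by (simp add: field_simps)
  qed
  have lt2: "norm x < 2" "norm y < 2" using xy by (auto simp: B2_def)
  consider "norm x < norm y" | "norm y < norm x" | "norm x = norm y" by linarith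
  then show ?thesis
  proof cases
    case 1
    from main[OF this] show ?thesis using xy lt2 1 h_norm by simp
  next
    case 2
    from main[OF this] show ?thesis using xy lt2 2 h_norm by (simp add: abs_minus_commute)
  next
    case 3
    then show ?thesis using \<open>1 \<le> B\<close> by simp
  qed
qed

end

section \<open>Weighted area of the resonance strip for one fixed frequency, and the angular change
  of variables\<close>

section \<open>Fibres of the resonance set\<close>

text \<open>The weight \<open>s\<^bsup>-\<kappa>\<^esup>\<close>, with value infinity at \<open>0\<close> even for \<open>\<kappa> = 0\<close>; \<open>0 powr a\<close> would be \<open>0\<close>.\<close>

definition wt :: "real \<Rightarrow> real \<Rightarrow> ennreal" where
  "wt \<kappa> s = (if s = 0 then \<infinity> else ennreal (s powr (-\<kappa>)))"

lemma wt_measurable [measurable]: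
  assumes [measurable]: "f \<in> borel_measurable M"
  shows "(\<lambda>x. wt \<kappa> (f x)) \<in> borel_measurable M"
  unfolding wt_def by measurable

text \<open>The infinite value of \<open>wt\<close> occurs only at y = 0. Dividing by
  \<open>L\<close> inside the weight makes the bound linear in \<open>L\<close>: the integral of
  (\<bar>y\<bar>/L)^(-\<kappa>) over [-L, L] is 2L/(1 - \<kappa>), and
  \<open>r powr (-\<kappa>) \<le> A\<close>.\<close>

lemma nn_integral_wt:
  assumes "0 \<le> \<kappa>" "\<kappa> < 1" "0 < L" "1 \<le> A" "1 / A \<le> r"
  shows "(\<integral>\<^sup>+y. indicator {-L..L} y * wt \<kappa> (\<bar>r * y\<bar> / L) \<partial>lborel) \<le> ennreal (2 * A * L / (1 - \<kappa>))"
proof -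
  define q where "q y = A * L powr \<kappa> * y powr (-\<kappa>)" for y
  have [measurable]: "q \<in> borel_measurable borel" unfolding q_def by measurable
  have r: "r > 0" using assms by (smt (verit) divide_pos_pos)
  have rA: "r powr (-\<kappa>) \<le> A"
  proof -
    have "r powr (-\<kappa>) \<le> (1 / A) powr (-\<kappa>)"
      using assms r by (intro powr_mono2') auto
    also have "\<dots> = A powr \<kappa>" using assms by (simp add: powr_minus_divide powr_divide)
    also have "\<dots> \<le> A powr 1" using assms by (intro powr_mono) auto
    finally show ?thesis using assms by simp
  qed
  have half: "(\<integral>\<^sup>+y. indicator {0..L} y * ennreal (q y) \<partial>lborel) = ennreal (A * L / (1 - \<kappa>))"
  proof -
    have "((\<lambda>y. (A * L powr \<kappa>) * y powr (-\<kappa>)) has_integral (A * L powr \<kappa>) * (L powr (-\<kappa> + 1) / (-\<kappa> + 1))) {0..L}"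
      using assms by (intro has_integral_mult_right has_integral_powr_from_0) auto
    moreover have "(A * L powr \<kappa>) * (L powr (-\<kappa> + 1) / (-\<kappa> + 1)) = A * L / (1 - \<kappa>)"
    proof -
      have "L powr \<kappa> * L powr (-\<kappa> + 1) = L" using assms by (simp flip: powr_add)
      then have "A * (L powr \<kappa> * L powr (-\<kappa> + 1)) / (1 - \<kappa>) = A * L / (1 - \<kappa>)" by simp
      then show ?thesis by simp
    qed
    ultimately have "(q has_integral A * L / (1 - \<kappa>)) {0..L}" unfolding q_def[abs_def] by (simp only:)
    then have "(\<integral>\<^sup>+y. ennreal (indicator {0..L} y * q y) \<partial>lborel) = ennreal (A * L / (1 - \<kappa>))"
      by (intro nn_integral_has_integral_lebesgue) (use assms in \<open>simp add: q_def\<close>)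
    moreover have "ennreal (indicator {0..L} y * q y) = indicator {0..L} y * ennreal (q y)" for y
      by (simp add: indicator_def)
    ultimately show ?thesis by simp
  qed
  have half': "(\<integral>\<^sup>+y. indicator {0..L} (-y) * ennreal (q (-y)) \<partial>lborel) = ennreal (A * L / (1 - \<kappa>))"
    using nn_integral_real_affine[of "\<lambda>y. indicator {0..L} y * ennreal (q y)" "-1" 0] half by simp
  have "(\<integral>\<^sup>+y. indicator {-L..L} y * wt \<kappa> (\<bar>r * y\<bar> / L) \<partial>lborel)
    \<le> (\<integral>\<^sup>+y. indicator {0..L} y * ennreal (q y) + indicator {0..L} (-y) * ennreal (q (-y)) \<partial>lborel)"
  proof (rule nn_integral_mono_AE)
    have "AE y in lborel. y \<noteq> (0::real)" by (rule AE_lborel_singleton)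
    then show "AE y in lborel. indicator {-L..L} y * wt \<kappa> (\<bar>r * y\<bar> / L)
        \<le> indicator {0..L} y * ennreal (q y) + indicator {0..L} (-y) * ennreal (q (-y))"
    proof eventually_elim
      case (elim y)
      have "wt \<kappa> (\<bar>r * y\<bar> / L) = ennreal ((r * \<bar>y\<bar> / L) powr (-\<kappa>))"
        using elim r assms by (simp add: wt_def abs_mult)
      also have "(r * \<bar>y\<bar> / L) powr (-\<kappa>) = r powr (-\<kappa>) * (L powr \<kappa> * \<bar>y\<bar> powr (-\<kappa>))"
        using r assms by (simp add: powr_mult powr_divide powr_minus field_simps)
      also have "\<dots> \<le> A * (L powr \<kappa> * \<bar>y\<bar> powr (-\<kappa>))"
        using rA by (intro mult_right_mono) auto
      finally have "wt \<kappa> (\<bar>r * y\<bar> / L) \<le> ennreal (q \<bar>y\<bar>)"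
        by (simp add: q_def mult_ac ennreal_leI)
      then show ?case
        by (cases "y \<in> {-L..L}"; cases "0 < y") (use elim in \<open>auto simp: indicator_def\<close>)
    qed
  qed
  also have "\<dots> = ennreal (A * L / (1 - \<kappa>)) + ennreal (A * L / (1 - \<kappa>))"
    by (subst nn_integral_add) (simp_all add: half half')
  also have "\<dots> = ennreal (2 * A * L / (1 - \<kappa>))"
    using assms by (simp flip: ennreal_plus)
  finally show ?thesis .
qed

text \<open>The alternative \<open>c < 3 * \<epsilon>\<close> covers large \<open>\<epsilon>\<close>, where (iii) gives nothing and the trivial area bound suffices.\<close>

definition strip_set :: "(real^2 \<Rightarrow> real) \<Rightarrow> (real^2 \<Rightarrow> real^2) \<Rightarrow> (real^2 \<Rightarrow> real) \<Rightarrow> (real^2 \<Rightarrow> real^2)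
    \<Rightarrow> real \<Rightarrow> real \<Rightarrow> real \<Rightarrow> real \<Rightarrow> real \<Rightarrow> real^2 \<Rightarrow> (real^2) set" where
  "strip_set \<phi>2 g2 \<phi>3 g3 b c \<epsilon> L t \<xi>1 = {\<xi>3. norm \<xi>3 \<le> L \<and> \<xi>3 \<in> B2 \<and> - \<xi>1 - \<xi>3 \<in> B2
      \<and> \<bar>t + \<phi>2 (- \<xi>1 - \<xi>3) + \<phi>3 \<xi>3\<bar> \<le> 3 * \<epsilon> \<and> (c < 3 * \<epsilon> \<or> b \<le> norm (g2 (- \<xi>1 - \<xi>3) - g3 \<xi>3))}"

abbreviation strip_integral where
  "strip_integral \<phi>2 g2 \<phi>3 g3 b c \<epsilon> L t \<kappa> \<xi>1 \<equiv>
     (\<integral>\<^sup>+\<xi>3. indicator (strip_set \<phi>2 g2 \<phi>3 g3 b c \<epsilon> L t \<xi>1) \<xi>3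
        * wt \<kappa> (\<bar>cross2 \<xi>1 \<xi>3\<bar> / L) \<partial>lborel)"

lemma B2_measurable [measurable]: "B2 \<in> sets borel"
  by (simp add: B2_def)

lemma strip_set_measurable:
  assumes [measurable]: "\<phi>2 \<in> borel_measurable borel" "g2 \<in> borel_measurable borel"
    "\<phi>3 \<in> borel_measurable borel" "g3 \<in> borel_measurable borel"
  shows "strip_set \<phi>2 g2 \<phi>3 g3 b c \<epsilon> L t \<xi>1 \<in> sets borel"
  unfolding strip_set_def by measurable

text \<open>With the fixed frequency on the first axis the weight depends on the second coordinate
  alone. Where the gradient difference has a large first component, horizontal fibres have length
  O(\<epsilon>) and the weight is integrated afterwards. Where the second component is large, the
  point is far from the axis, the weight is bounded, and vertical fibres do the same.\<close>

lemma strip_bound_axis: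
  assumes \<beta>: "0 < \<beta>" "\<beta> \<le> 1" and M: "0 \<le> M" and A: "1 \<le> A" and b: "0 < b" and c: "0 < c"
  obtains C where "C > 0"
    "\<And>\<phi>2 g2 \<phi>3 g3 \<epsilon> L \<kappa> t r. radial_C1 M \<beta> \<phi>2 g2 \<Longrightarrow> radial_C1 M \<beta> \<phi>3 g3 \<Longrightarrow> 0 < \<epsilon> \<Longrightarrow> 0 < L \<Longrightarrow> L \<le> A \<Longrightarrow>
       0 \<le> \<kappa> \<Longrightarrow> \<kappa> < 1 \<Longrightarrow> 1 / A \<le> r \<Longrightarrow>
      strip_integral \<phi>2 g2 \<phi>3 g3 b c \<epsilon> L t \<kappa> (vector [r, 0]) \<le> ennreal (C * \<epsilon> * L / (1 - \<kappa>))"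
proof -
  have b2: "b / 2 > 0" and M2: "0 \<le> 2 * M" using b M by simp_all
  obtain C0 where C0: "C0 > 0" and fib:
    "\<And>(\<psi> :: real \<Rightarrow> real) \<psi>' I (e :: real). is_interval I \<Longrightarrow> I \<subseteq> {-2..2} \<Longrightarrow> (\<And>t. t \<in> I \<Longrightarrow> (\<psi> has_real_derivative \<psi>' t) (at t)) \<Longrightarrow>
      (\<And>s t. s \<in> I \<Longrightarrow> t \<in> I \<Longrightarrow> \<bar>\<psi>' s - \<psi>' t\<bar> \<le> 2 * M * \<bar>s - t\<bar> powr \<beta>) \<Longrightarrow> 0 \<le> e \<Longrightarrow>
      (\<integral>\<^sup>+t. indicator {t \<in> I. \<bar>\<psi> t\<bar> \<le> e \<and> b / 2 \<le> \<bar>\<psi>' t\<bar>} t \<partial>lborel) \<le> ennreal (C0 * e)"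
    by (rule fiber_bound[OF \<beta>(1) M2 b2]) blast
  \<comment> \<open>Below height \<open>\<delta>\<close> the second component of the gradient
    difference is smaller than \<open>b / 2\<close>. The cap 1 ensures
    \<open>\<delta> / A\<^sup>2 \<le> 1\<close>, so that raising the exponent of the weight later is
    monotone.\<close>
  define \<delta> where "\<delta> = min 1 ((b / (4 * (M + 1))) powr (1 / \<beta>))"
  have \<delta>: "0 < \<delta>" "\<delta> \<le> 1" using b M by (auto simp: \<delta>_def)
  have \<delta>_le: "\<delta> \<le> \<bar>y\<bar>" if "b / 2 \<le> 2 * M * \<bar>y\<bar> powr \<beta>" for y
  proof (rule ccontr)
    assume "\<not> \<delta> \<le> \<bar>y\<bar>"
    then have "\<bar>y\<bar> < (b / (4 * (M + 1))) powr (1 / \<beta>)" by (auto simp: \<delta>_def)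
    then have "\<bar>y\<bar> powr \<beta> < ((b / (4 * (M + 1))) powr (1 / \<beta>)) powr \<beta>"
      using \<beta> by (intro powr_less_mono2) auto
    also have "\<dots> = b / (4 * (M + 1))" using b M \<beta> by (simp add: powr_powr)
    finally have y: "\<bar>y\<bar> powr \<beta> < b / (4 * (M + 1))" .
    have "2 * M * \<bar>y\<bar> powr \<beta> \<le> 2 * M * (b / (4 * (M + 1)))"
      using y M by (intro mult_left_mono) auto
    also have "\<dots> < b / 2" using M b by (simp add: field_simps)
    finally show False using that by simp
  qed
  \<comment> \<open>The three summands belong to large \<open>\<epsilon>\<close>, to the horizontal
    fibres and to the vertical fibres.\<close>
  define C where "C = 12 * A ^ 3 / c + C0 * 6 * A + C0 * 6 * A\<^sup>2 / \<delta>"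
  show thesis
  proof (rule that[of C])
    show "C > 0" using A C0 c \<delta> by (simp add: C_def add_pos_pos)
    fix \<phi>2 \<phi>3 :: "real^2 \<Rightarrow> real" and g2 g3 and \<epsilon> L \<kappa> t r :: real
    assume r2: "radial_C1 M \<beta> \<phi>2 g2" and r3: "radial_C1 M \<beta> \<phi>3 g3" and \<epsilon>: "0 < \<epsilon>" and L: "0 < L" "L \<le> A"
      and \<kappa>: "0 \<le> \<kappa>" "\<kappa> < 1" and r: "1 / A \<le> r"
    interpret p2: radial_C1 M \<beta> \<phi>2 g2 by (rule r2)
    interpret p3: radial_C1 M \<beta> \<phi>3 g3 by (rule r3)
    define S where "S = strip_set \<phi>2 g2 \<phi>3 g3 b c \<epsilon> L t (vector [r, 0])"
    have [measurable]: "S \<in> sets borel" unfolding S_def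
      by (rule strip_set_measurable) measurable
    define w where "w y = wt \<kappa> (\<bar>r * y\<bar> / L)" for y
    have [measurable]: "w \<in> borel_measurable borel" unfolding w_def by measurable
    have w: "wt \<kappa> (\<bar>cross2 (vector [r, 0]) \<xi>\<bar> / L) = w (\<xi> $ 2)" for \<xi>
      by (simp add: w_def cross2_def)
    define W where "W = (\<integral>\<^sup>+y. indicator {-L..L} y * w y \<partial>lborel)"
    have W: "W \<le> ennreal (2 * A * L / (1 - \<kappa>))"
      unfolding W_def w_def using \<kappa> L A r by (intro nn_integral_wt) auto
    have comp: "\<xi> $ 1 \<in> {-L..L}" "\<xi> $ 2 \<in> {-L..L}" if "\<xi> \<in> S" for \<xi>
      using that component_le_norm_cart[of \<xi> 1] component_le_norm_cart[of \<xi> 2]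
      by (auto simp: S_def strip_set_def abs_le_iff)
    have vm: "(\<lambda>z. vector [f z, h z] :: real^2) \<in> borel_measurable N"
      if [measurable]: "f \<in> borel_measurable N" "h \<in> borel_measurable N" for f h and N :: "'z measure"
    proof -
      have "(\<lambda>z. vector [f z, h z] :: real^2) = (\<lambda>z. f z *\<^sub>R axis 1 1 + h z *\<^sub>R axis 2 1)"
        by (auto simp: vec_eq_iff forall_2 axis_def fun_eq_iff)
      then show ?thesis by simp
    qed
    note [measurable] = vm
    have "(\<integral>\<^sup>+\<xi>. indicator S \<xi> * w (\<xi> $ 2) \<partial>lborel) \<le> ennreal (C * \<epsilon> * L / (1 - \<kappa>))"
    proof (cases "c < 3 * \<epsilon>")
      \<comment> \<open>Here \<open>\<epsilon> > c / 3\<close>, so a bound without any smallness in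
        \<open>\<epsilon>\<close> suffices: the whole square of side \<open>2 * L\<close> is used,
        and one factor \<open>L\<close> is absorbed by \<open>L \<le> A\<close>.\<close>
      case True
      have "(\<integral>\<^sup>+\<xi>. indicator S \<xi> * w (\<xi> $ 2) \<partial>lborel)
        = (\<integral>\<^sup>+x. \<integral>\<^sup>+y. indicator S (vector [x, y]) * w y \<partial>lborel \<partial>lborel)"
        by (subst nn_integral_vec2(1)) simp_all
      also have "\<dots> \<le> (\<integral>\<^sup>+x. indicator {-L..L} x * W \<partial>lborel)"
      proof (rule nn_integral_mono)
        fix x
        have "(\<integral>\<^sup>+y. indicator S (vector [x, y]) * w y \<partial>lborel)
          \<le> (\<integral>\<^sup>+y. indicator {-L..L} x * (indicator {-L..L} y * w y) \<partial>lborel)"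
          using comp by (intro nn_integral_mono) (fastforce simp: indicator_def)
        also have "\<dots> = indicator {-L..L} x * W"
          unfolding W_def by (rule nn_integral_cmult) measurable
        finally show "(\<integral>\<^sup>+y. indicator S (vector [x, y]) * w y \<partial>lborel) \<le> indicator {-L..L} x * W" .
      qed
      also have "\<dots> = ennreal (2 * L) * W"
        using L by (subst nn_integral_multc) auto
      also have "\<dots> \<le> ennreal (2 * L) * ennreal (2 * A * L / (1 - \<kappa>))"
        using W by (rule mult_left_mono) simp
      also have "\<dots> = ennreal (2 * L * (2 * A * L / (1 - \<kappa>)))"
        using L \<kappa> A by (simp flip: ennreal_mult)
      also have "\<dots> \<le> ennreal (C * \<epsilon> * L / (1 - \<kappa>))"
      proof (rule ennreal_leI)
        have "4 * A * L \<le> 4 * A * A" using L A by (intro mult_left_mono) auto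
        also have "\<dots> \<le> 4 * A ^ 3" using A by (simp add: power3_eq_cube)
        also have "\<dots> = 4 * A ^ 3 * 1" by simp
        also have "\<dots> \<le> 4 * A ^ 3 * (3 * \<epsilon> / c)"
          using True c A by (intro mult_left_mono) auto
        also have "\<dots> = (12 * A ^ 3 / c) * \<epsilon>" by simp
        also have "\<dots> \<le> C * \<epsilon>" using \<epsilon> C0 A \<delta> unfolding C_def by (intro mult_right_mono) auto
        finally have "(4 * A * L) * (L / (1 - \<kappa>)) \<le> (C * \<epsilon>) * (L / (1 - \<kappa>))"
          using L \<kappa> by (intro mult_right_mono) auto
        then show "2 * L * (2 * A * L / (1 - \<kappa>)) \<le> C * \<epsilon> * L / (1 - \<kappa>)" by (simp add: mult_ac)
      qed
      finally show ?thesis .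
    next
      case False
      define H where "H \<xi> = t + \<phi>2 (- vector [r, 0] - \<xi>) + \<phi>3 \<xi>" for \<xi>
      \<comment> \<open>\<open>G\<close> is the gradient of \<open>H\<close> in the third frequency;
        the minus sign comes from the second frequency being the negative of the sum of the other
        two.\<close>
      define G where "G \<xi> = g3 \<xi> - g2 (- vector [r, 0] - \<xi>)" for \<xi>
      have [measurable]: "H \<in> borel_measurable borel" "G \<in> borel_measurable borel"
        unfolding H_def G_def by measurable
      define U where "U = {\<xi>. \<xi> \<in> B2 \<and> - vector [r, 0] - \<xi> \<in> B2}"
      have [measurable]: "U \<in> sets borel" unfolding U_def by measurable
      have convU: "convex U"
      proof -
        have "U = ball 0 2 \<inter> ball (- vector [r, 0]) 2"
          by (auto simp: U_def B2_def dist_norm norm_minus_commute)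
        then show ?thesis by (simp add: convex_Int)
      qed
      have DH: "(H has_derivative (\<lambda>v. v \<bullet> G \<xi>)) (at \<xi>)" if "\<xi> \<in> U" for \<xi>
      proof -
        have "((\<lambda>\<xi>. - vector [r, 0] - \<xi>) has_derivative (\<lambda>v. - v)) (at \<xi>)"
          by (auto intro!: derivative_eq_intros)
        from has_derivative_compose[OF this p2.deriv] that
        have "((\<lambda>\<xi>. \<phi>2 (- vector [r, 0] - \<xi>)) has_derivative (\<lambda>v. - v \<bullet> g2 (- vector [r, 0] - \<xi>))) (at \<xi>)"
          by (simp add: U_def)
        moreover have "(\<phi>3 has_derivative (\<lambda>v. v \<bullet> g3 \<xi>)) (at \<xi>)" using p3.deriv that by (simp add: U_def)
        ultimately show ?thesis unfolding H_def G_def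
          by (auto intro!: derivative_eq_intros simp: inner_diff_right)
      qed
      have hol: "norm (G \<xi> - G \<eta>) \<le> 2 * M * norm (\<xi> - \<eta>) powr \<beta>" if "\<xi> \<in> U" "\<eta> \<in> U" for \<xi> \<eta>
      proof -
        have "norm (G \<xi> - G \<eta>) \<le> norm (g3 \<xi> - g3 \<eta>) + norm (g2 (- vector [r, 0] - \<eta>) - g2 (- vector [r, 0] - \<xi>))"
          unfolding G_def using norm_triangle_ineq[of "g3 \<xi> - g3 \<eta>" "g2 (- vector [r, 0] - \<eta>) - g2 (- vector [r, 0] - \<xi>)"]
          by (simp add: algebra_simps)
        also have "\<dots> \<le> M * norm (\<xi> - \<eta>) powr \<beta> + M * norm (\<xi> - \<eta>) powr \<beta>"
          using p3.holder[of \<xi> \<eta>] p2.holder[of "- vector [r, 0] - \<eta>" "- vector [r, 0] - \<xi>"] that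
          by (simp add: U_def)
        finally show ?thesis by simp
      qed
      have G2: "\<bar>G \<xi> $ 2\<bar> \<le> 2 * M * \<bar>\<xi> $ 2\<bar> powr \<beta>" if "\<xi> \<in> U" for \<xi>
        using p3.g_snd_le[of \<xi>] p2.g_snd_le[of "- vector [r, 0] - \<xi>"] that
        by (simp add: U_def G_def)
      define S1 where "S1 = {\<xi> \<in> U. \<bar>H \<xi>\<bar> \<le> 3 * \<epsilon> \<and> b / 2 \<le> \<bar>G \<xi> $ 1\<bar>}"
      define S2 where "S2 = {\<xi> \<in> U. \<bar>H \<xi>\<bar> \<le> 3 * \<epsilon> \<and> b / 2 \<le> \<bar>G \<xi> $ 2\<bar>}"
      have [measurable]: "S1 \<in> sets borel" "S2 \<in> sets borel" unfolding S1_def S2_def by measurable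
      have S12: "\<xi> \<in> S1 \<or> \<xi> \<in> S2" if "\<xi> \<in> S" for \<xi>
      proof -
        have "b \<le> norm (G \<xi>)" using that False by (simp add: S_def strip_set_def G_def norm_minus_commute)
        also have "\<dots> \<le> \<bar>G \<xi> $ 1\<bar> + \<bar>G \<xi> $ 2\<bar>" using norm_le_l1_cart[of "G \<xi>"] by (simp add: UNIV_2)
        finally have "b / 2 \<le> \<bar>G \<xi> $ 1\<bar> \<or> b / 2 \<le> \<bar>G \<xi> $ 2\<bar>" by linarith
        then show ?thesis using that by (auto simp: S1_def S2_def S_def strip_set_def U_def H_def)
      qed
      \<comment> \<open>A line parallel to a coordinate axis meets the convex set \<open>U\<close>
        in an interval. Along it \<open>H\<close> has derivative \<open>G $ i\<close>, whose Hoelder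
        constant \<open>2 * M\<close> collects both phases.\<close>
      have fibre: "(\<integral>\<^sup>+u. indicator {\<xi> \<in> U. \<bar>H \<xi>\<bar> \<le> 3 * \<epsilon> \<and> b / 2 \<le> \<bar>G \<xi> $ i\<bar>} (a + u *\<^sub>R axis i 1) \<partial>lborel) \<le> ennreal (C0 * (3 * \<epsilon>))"
        if a: "a $ i = 0" for a :: "real^2" and i
      proof -
        let ?\<gamma> = "\<lambda>u. a + u *\<^sub>R axis i 1 :: real^2"
        define I where "I = {u. ?\<gamma> u \<in> U}"
        have aff: "?\<gamma> (u * x + v * x') = u *\<^sub>R ?\<gamma> x + v *\<^sub>R ?\<gamma> x'" if "u + v = 1" for u v x x'
          using that by (simp add: algebra_simps flip: scaleR_left_distrib)
        have "is_interval I"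
          unfolding is_interval_convex_1 convex_def I_def using convU aff by (auto simp: convex_def)
        moreover have "I \<subseteq> {-2..2}"
        proof
          fix u assume "u \<in> I"
          then have "norm (?\<gamma> u) < 2" by (simp add: I_def U_def B2_def)
          then show "u \<in> {-2..2}" using component_le_norm_cart[of "?\<gamma> u" i] a by (simp add: abs_le_iff)
        qed
        moreover have "((\<lambda>u. H (?\<gamma> u)) has_real_derivative G (?\<gamma> u) $ i) (at u)" if "u \<in> I" for u
        proof -
          have "(?\<gamma> has_derivative (\<lambda>s. s *\<^sub>R axis i 1)) (at u)" by (auto intro!: derivative_eq_intros)
          from has_derivative_compose[OF this DH] that
          show ?thesis unfolding has_field_derivative_def by (simp add: I_def inner_axis' mult_commute_abs)
        qed
        moreover have "\<bar>G (?\<gamma> u) $ i - G (?\<gamma> v) $ i\<bar> \<le> 2 * M * \<bar>u - v\<bar> powr \<beta>" if "u \<in> I" "v \<in> I" for u v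
        proof -
          have "norm (?\<gamma> u - ?\<gamma> v) = \<bar>u - v\<bar>" by (simp flip: scaleR_left_diff_distrib)
          then show ?thesis
            using hol[of "?\<gamma> u" "?\<gamma> v"] that component_le_norm_cart[of "G (?\<gamma> u) - G (?\<gamma> v)" i] by (simp add: I_def)
        qed
        ultimately have "(\<integral>\<^sup>+u. indicator {u \<in> I. \<bar>H (?\<gamma> u)\<bar> \<le> 3 * \<epsilon> \<and> b / 2 \<le> \<bar>G (?\<gamma> u) $ i\<bar>} u \<partial>lborel) \<le> ennreal (C0 * (3 * \<epsilon>))"
          using \<epsilon> by (intro fib) auto
        then show ?thesis by (simp add: I_def indicator_def)
      qed
      have vec: "(vector [x, y] :: real^2) = vector [0, y] + x *\<^sub>R axis 1 1" "(vector [x, y] :: real^2) = vector [x, 0] + y *\<^sub>R axis 2 1" for x y :: real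
        by (simp_all add: vec_eq_iff forall_2 axis_def)
      have fx: "(\<integral>\<^sup>+x. indicator S1 (vector [x, y]) \<partial>lborel) \<le> ennreal (C0 * (3 * \<epsilon>))" for y
        unfolding S1_def by (subst vec(1)) (rule fibre, simp)
      have fy: "(\<integral>\<^sup>+y. indicator S2 (vector [x, y]) \<partial>lborel) \<le> ennreal (C0 * (3 * \<epsilon>))" for x
        unfolding S2_def by (subst vec(2)) (rule fibre, simp)
      \<comment> \<open>Height at least \<open>\<delta>\<close> gives
        \<open>r * \<bar>\<xi> $ 2\<bar> / L \<ge> \<delta> / A\<^sup>2\<close>. Replacing the
        exponent \<kappa> by 1 removes \<kappa> from the bound.\<close>
      have wS2: "w (\<xi> $ 2) \<le> ennreal (A\<^sup>2 / \<delta>)" if "\<xi> \<in> S2" for \<xi>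
      proof -
        have y: "\<delta> \<le> \<bar>\<xi> $ 2\<bar>" using that G2[of \<xi>] by (intro \<delta>_le) (auto simp: S2_def)
        have "(1 / A) * (\<delta> / A) \<le> r * (\<bar>\<xi> $ 2\<bar> / L)"
          using r y L A \<delta> by (intro mult_mono frac_le) (auto intro: order_trans[OF _ r])
        then have s: "\<delta> / A\<^sup>2 \<le> r * \<bar>\<xi> $ 2\<bar> / L" by (simp add: power2_eq_square)
        have r0: "r > 0" using r A by (smt (verit) divide_pos_pos)
        have sA: "0 < \<delta> / A\<^sup>2" "\<delta> / A\<^sup>2 \<le> 1"
        proof -
          show "0 < \<delta> / A\<^sup>2" using A \<delta> by simp
          have "\<delta> \<le> A\<^sup>2" using \<delta> A by (meson one_le_power order_trans)
          then show "\<delta> / A\<^sup>2 \<le> 1" using A by simp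
        qed
        have "w (\<xi> $ 2) = ennreal ((r * \<bar>\<xi> $ 2\<bar> / L) powr (-\<kappa>))"
          using y \<delta> r0 L by (auto simp: w_def wt_def abs_mult)
        also have "\<dots> \<le> ennreal ((\<delta> / A\<^sup>2) powr (-\<kappa>))"
          using s sA \<kappa> by (intro ennreal_leI powr_mono2') auto
        also have "\<dots> \<le> ennreal ((\<delta> / A\<^sup>2) powr (-1))"
          using sA \<kappa> by (intro ennreal_leI powr_mono') auto
        also have "(\<delta> / A\<^sup>2) powr (-1) = A\<^sup>2 / \<delta>" using sA \<delta> by (simp add: powr_minus_divide)
        finally show ?thesis .
      qed
      have le: "indicator S \<xi> * w (\<xi> $ 2) \<le> indicator {-L..L} (\<xi> $ 2) * (indicator S1 \<xi> * w (\<xi> $ 2))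
          + indicator {-L..L} (\<xi> $ 1) * indicator S2 \<xi> * ennreal (A\<^sup>2 / \<delta>)" for \<xi>
      proof (cases "\<xi> \<in> S")
        case True
        show ?thesis
        proof (cases "\<xi> \<in> S1")
          case False
          then have "\<xi> \<in> S2" using S12[OF True] by simp
          then show ?thesis using True comp[OF True] wS2[of \<xi>] False by (simp add: indicator_def)
        qed (use True comp[OF True] in simp)
      qed simp
      have "(\<integral>\<^sup>+\<xi>. indicator S \<xi> * w (\<xi> $ 2) \<partial>lborel)
        \<le> (\<integral>\<^sup>+\<xi>. indicator {-L..L} (\<xi> $ 2) * (indicator S1 \<xi> * w (\<xi> $ 2))
          + indicator {-L..L} (\<xi> $ 1) * indicator S2 \<xi> * ennreal (A\<^sup>2 / \<delta>) \<partial>lborel)"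
        by (rule nn_integral_mono) (rule le)
      also have "\<dots> = (\<integral>\<^sup>+\<xi>. indicator {-L..L} (\<xi> $ 2) * (indicator S1 \<xi> * w (\<xi> $ 2)) \<partial>lborel)
          + (\<integral>\<^sup>+\<xi>. indicator {-L..L} (\<xi> $ 1) * indicator S2 \<xi> * ennreal (A\<^sup>2 / \<delta>) \<partial>lborel)"
        by (rule nn_integral_add) measurable
      also have "(\<integral>\<^sup>+\<xi>. indicator {-L..L} (\<xi> $ 2) * (indicator S1 \<xi> * w (\<xi> $ 2)) \<partial>lborel)
         = (\<integral>\<^sup>+y. \<integral>\<^sup>+x. (indicator {-L..L} y * w y) * indicator S1 (vector [x, y]) \<partial>lborel \<partial>lborel)"
        by (subst nn_integral_vec2(2)) (simp_all add: mult_ac)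
      also have "\<dots> = (\<integral>\<^sup>+y. (indicator {-L..L} y * w y) * (\<integral>\<^sup>+x. indicator S1 (vector [x, y]) \<partial>lborel) \<partial>lborel)"
        by (intro nn_integral_cong nn_integral_cmult) measurable
      also have "\<dots> \<le> (\<integral>\<^sup>+y. (indicator {-L..L} y * w y) * ennreal (C0 * (3 * \<epsilon>)) \<partial>lborel)"
        using fx by (intro nn_integral_mono mult_left_mono) auto
      also have "\<dots> = W * ennreal (C0 * (3 * \<epsilon>))"
        unfolding W_def by (rule nn_integral_multc) measurable
      also have "\<dots> \<le> ennreal (2 * A * L / (1 - \<kappa>)) * ennreal (C0 * (3 * \<epsilon>))"
        using W by (rule mult_right_mono) simp
      also have "\<dots> = ennreal (C0 * 6 * A * (\<epsilon> * L / (1 - \<kappa>)))"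
        using A L \<kappa> C0 \<epsilon> by (simp add: mult_ac flip: ennreal_mult)
      also have "(\<integral>\<^sup>+\<xi>. indicator {-L..L} (\<xi> $ 1) * indicator S2 \<xi> * ennreal (A\<^sup>2 / \<delta>) \<partial>lborel)
         = (\<integral>\<^sup>+x. \<integral>\<^sup>+y. (indicator {-L..L} x * ennreal (A\<^sup>2 / \<delta>)) * indicator S2 (vector [x, y]) \<partial>lborel \<partial>lborel)"
        by (subst nn_integral_vec2(1)) (simp_all add: mult_ac)
      also have "\<dots> = (\<integral>\<^sup>+x. (indicator {-L..L} x * ennreal (A\<^sup>2 / \<delta>)) * (\<integral>\<^sup>+y. indicator S2 (vector [x, y]) \<partial>lborel) \<partial>lborel)"
        by (intro nn_integral_cong nn_integral_cmult) measurable
      also have "\<dots> \<le> (\<integral>\<^sup>+x. (indicator {-L..L} x * ennreal (A\<^sup>2 / \<delta>)) * ennreal (C0 * (3 * \<epsilon>)) \<partial>lborel)"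
        using fy by (intro nn_integral_mono mult_left_mono) auto
      also have "\<dots> = ennreal (2 * L) * ennreal (A\<^sup>2 / \<delta>) * ennreal (C0 * (3 * \<epsilon>))"
        using L by (simp add: nn_integral_multc)
      also have "\<dots> = ennreal (C0 * 6 * A\<^sup>2 / \<delta> * (\<epsilon> * L))"
        using L \<delta> C0 \<epsilon> by (simp add: mult_ac flip: ennreal_mult)
      also have "\<dots> \<le> ennreal (C0 * 6 * A\<^sup>2 / \<delta> * (\<epsilon> * L / (1 - \<kappa>)))"
      proof (intro ennreal_leI mult_left_mono)
        have "\<epsilon> * L * (1 - \<kappa>) \<le> \<epsilon> * L" using \<kappa> L \<epsilon> by (intro mult_left_le) auto
        then show "\<epsilon> * L \<le> \<epsilon> * L / (1 - \<kappa>)" using \<kappa> by (simp add: pos_le_divide_eq)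
      qed (use \<delta> C0 in auto)
      also have "ennreal (C0 * 6 * A * (\<epsilon> * L / (1 - \<kappa>))) + \<dots> = ennreal ((C0 * 6 * A + C0 * 6 * A\<^sup>2 / \<delta>) * (\<epsilon> * L / (1 - \<kappa>)))"
      proof -
        have sumX: "ennreal (u * X) + ennreal (v * X) = ennreal ((u + v) * X)" if "0 \<le> u" "0 \<le> v" "0 \<le> X" for u v X
          using that by (simp add: distrib_right)
        show ?thesis by (rule sumX) (use L \<delta> C0 \<epsilon> A \<kappa> in auto)
      qed
      also have "\<dots> \<le> ennreal (C * (\<epsilon> * L / (1 - \<kappa>)))"
        using L \<epsilon> A \<kappa> c unfolding C_def by (intro ennreal_leI mult_right_mono) auto
      finally show ?thesis by (simp add: mult_ac add_left_mono add_right_mono)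
    qed
    then show "strip_integral \<phi>2 g2 \<phi>3 g3 b c \<epsilon> L t \<kappa> (vector [r, 0]) \<le> ennreal (C * \<epsilon> * L / (1 - \<kappa>))"
      by (simp add: w S_def)
  qed
qed


text \<open>Strip, weight and Lebesgue measure are invariant when \<open>\<xi>1\<close> and
  \<open>\<xi>3\<close> are rotated together, so \<open>\<xi>1\<close> may be placed on the first
  axis.\<close>

lemma strip_bound:
  assumes "0 < \<beta>" "\<beta> \<le> 1" and "0 \<le> M" and A: "1 \<le> A" and "0 < b" and "0 < c"
  obtains C where "C > 0"
    "\<And>\<phi>2 g2 \<phi>3 g3 \<epsilon> L \<kappa> t \<xi>1. radial_C1 M \<beta> \<phi>2 g2 \<Longrightarrow> radial_C1 M \<beta> \<phi>3 g3 \<Longrightarrow> 0 < \<epsilon> \<Longrightarrow> 0 < L \<Longrightarrow> L \<le> A \<Longrightarrow>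
       0 \<le> \<kappa> \<Longrightarrow> \<kappa> < 1 \<Longrightarrow> 1 / A \<le> norm \<xi>1 \<Longrightarrow>
      strip_integral \<phi>2 g2 \<phi>3 g3 b c \<epsilon> L t \<kappa> \<xi>1 \<le> ennreal (C * \<epsilon> * L / (1 - \<kappa>))"
proof -
  obtain C where C: "C > 0" and bound:
    "\<And>\<phi>2 g2 \<phi>3 g3 \<epsilon> L \<kappa> t r. radial_C1 M \<beta> \<phi>2 g2 \<Longrightarrow> radial_C1 M \<beta> \<phi>3 g3 \<Longrightarrow> 0 < \<epsilon> \<Longrightarrow> 0 < L \<Longrightarrow> L \<le> A \<Longrightarrow>
       0 \<le> \<kappa> \<Longrightarrow> \<kappa> < 1 \<Longrightarrow> 1 / A \<le> r \<Longrightarrow>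
      strip_integral \<phi>2 g2 \<phi>3 g3 b c \<epsilon> L t \<kappa> (vector [r, 0]) \<le> ennreal (C * \<epsilon> * L / (1 - \<kappa>))"
    by (rule strip_bound_axis[OF assms]) blast
  show thesis
  proof (rule that[OF C])
    fix \<phi>2 \<phi>3 :: "real^2 \<Rightarrow> real" and g2 g3 and \<epsilon> L \<kappa> t :: real and \<xi>1 :: "real^2"
    assume r2: "radial_C1 M \<beta> \<phi>2 g2" and r3: "radial_C1 M \<beta> \<phi>3 g3" and *: "0 < \<epsilon>" "0 < L" "L \<le> A"
      "0 \<le> \<kappa>" "\<kappa> < 1" "1 / A \<le> norm \<xi>1"
    interpret p2: radial_C1 M \<beta> \<phi>2 g2 by (rule r2)
    interpret p3: radial_C1 M \<beta> \<phi>3 g3 by (rule r3)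
    obtain \<alpha> where "\<xi>1 = polar (norm \<xi>1) \<alpha>" by (rule ex_polar[of \<xi>1])
    then have \<xi>1: "\<xi>1 = rot \<alpha> (vector [norm \<xi>1, 0])"
      using rot_polar[of \<alpha> "norm \<xi>1" 0] by (simp add: polar_def)
    have inv: "rot \<alpha> \<xi> \<in> strip_set \<phi>2 g2 \<phi>3 g3 b c \<epsilon> L t (rot \<alpha> v) \<longleftrightarrow> \<xi> \<in> strip_set \<phi>2 g2 \<phi>3 g3 b c \<epsilon> L t v" for v \<xi>
    proof (cases "\<xi> \<in> B2 \<and> - v - \<xi> \<in> B2")
      case True
      have "- rot \<alpha> v - rot \<alpha> \<xi> = rot \<alpha> (- v - \<xi>)" by (simp add: rot_minus rot_diff)
      moreover have "g2 (rot \<alpha> (- v - \<xi>)) - g3 (rot \<alpha> \<xi>) = rot \<alpha> (g2 (- v - \<xi>) - g3 \<xi>)"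
        using p2.g_rot[of "- v - \<xi>" \<alpha>] p3.g_rot[of \<xi> \<alpha>] True by (simp only: rot_diff)
      ultimately show ?thesis using True by (simp add: strip_set_def p2.phi_rot p3.phi_rot)
    next
      case False
      have "- rot \<alpha> v - rot \<alpha> \<xi> = rot \<alpha> (- v - \<xi>)" by (simp add: rot_minus rot_diff)
      then show ?thesis using False by (auto simp: strip_set_def)
    qed
    have [measurable]: "strip_set \<phi>2 g2 \<phi>3 g3 b c \<epsilon> L t \<xi>1 \<in> sets borel"
      by (rule strip_set_measurable) measurable
    have "strip_integral \<phi>2 g2 \<phi>3 g3 b c \<epsilon> L t \<kappa> \<xi>1
      = (\<integral>\<^sup>+\<xi>3. indicator (strip_set \<phi>2 g2 \<phi>3 g3 b c \<epsilon> L t \<xi>1) (rot \<alpha> \<xi>3) * wt \<kappa> (\<bar>cross2 \<xi>1 (rot \<alpha> \<xi>3)\<bar> / L) \<partial>lborel)"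
      by (rule nn_integral_rot[symmetric]) measurable
    also have "\<dots> = (\<integral>\<^sup>+\<xi>3. indicator (strip_set \<phi>2 g2 \<phi>3 g3 b c \<epsilon> L t (vector [norm \<xi>1, 0])) \<xi>3
        * wt \<kappa> (\<bar>cross2 (vector [norm \<xi>1, 0]) \<xi>3\<bar> / L) \<partial>lborel)"
    proof (rule nn_integral_cong)
      fix \<xi>3
      have "cross2 \<xi>1 (rot \<alpha> \<xi>3) = cross2 (vector [norm \<xi>1, 0]) \<xi>3"
        using \<xi>1 cross2_rot by metis
      moreover have "rot \<alpha> \<xi>3 \<in> strip_set \<phi>2 g2 \<phi>3 g3 b c \<epsilon> L t \<xi>1 \<longleftrightarrow> \<xi>3 \<in> strip_set \<phi>2 g2 \<phi>3 g3 b c \<epsilon> L t (vector [norm \<xi>1, 0])"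
        using \<xi>1 inv by metis
      ultimately show "indicator (strip_set \<phi>2 g2 \<phi>3 g3 b c \<epsilon> L t \<xi>1) (rot \<alpha> \<xi>3) * wt \<kappa> (\<bar>cross2 \<xi>1 (rot \<alpha> \<xi>3)\<bar> / L)
        = indicator (strip_set \<phi>2 g2 \<phi>3 g3 b c \<epsilon> L t (vector [norm \<xi>1, 0])) \<xi>3 * wt \<kappa> (\<bar>cross2 (vector [norm \<xi>1, 0]) \<xi>3\<bar> / L)"
        by (simp add: indicator_def)
    qed
    also have "\<dots> \<le> ennreal (C * \<epsilon> * L / (1 - \<kappa>))"
      using r2 r3 * by (intro bound)
    finally show "strip_integral \<phi>2 g2 \<phi>3 g3 b c \<epsilon> L t \<kappa> \<xi>1
      \<le> ennreal (C * \<epsilon> * L / (1 - \<kappa>))" .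
  qed
qed

context radial_C1
begin

text \<open>With \<open>t\<close> the sum of the other two time variables, these are the frequencies
  still possible for the remaining function.\<close>

definition shell :: "real \<Rightarrow> real \<Rightarrow> real \<Rightarrow> (real^2) set" where
  "shell A t e = {x. x \<in> B2 \<and> 1 / A \<le> norm x \<and> norm x \<le> A \<and> \<bar>t + \<phi> x\<bar> \<le> e}"

lemma shell_measurable [measurable]: "shell A t e \<in> sets borel"
  unfolding shell_def by measurable

lemma shell_rot: "rot \<theta> x \<in> shell A t e \<longleftrightarrow> x \<in> shell A t e"
  by (auto simp: shell_def phi_rot)

text \<open>Up to a shift of the angle, the squared length of
  \<open>\<xi>2 + rot \<theta> \<xi>3\<close> is r2^2 + r3^2 + 2 r2 r3 cos \<theta>, so the cross
  product is half the modulus of its derivative. By \<open>dist_norm_le\<close> the length varies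
  little on the shell, and the substitution is monotone on each half circle.\<close>

lemma angle_bound:
  assumes "1 \<le> A" "1 \<le> B" "0 \<le> e"
    and lower: "\<And>x. x \<in> B2 \<Longrightarrow> 1 / A \<le> norm x \<Longrightarrow> norm x \<le> A \<Longrightarrow> 1 / B \<le> norm (g x)"
  shows "(circ (\<lambda>\<theta>. (ennreal \<bar>cross2 \<xi>2 (rot \<theta> \<xi>3)\<bar> * indicator (shell A t e) (- \<xi>2 - rot \<theta> \<xi>3))))
     \<le> ennreal (8 * B * e)"
proof -
  define k where "k \<zeta> = ennreal \<bar>cross2 \<xi>2 \<zeta>\<bar> * indicator (shell A t e) (- \<xi>2 - \<zeta>)" for \<zeta>
  have [measurable]: "k \<in> borel_measurable borel" unfolding k_def by measurable
  define r2 r3 where "r2 = norm \<xi>2" and "r3 = norm \<xi>3"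
  have rpos: "0 \<le> r2 * r3" by (simp add: r2_def r3_def)
  obtain \<alpha> where "\<xi>2 = polar r2 \<alpha>" unfolding r2_def by (rule ex_polar[of \<xi>2])
  then have \<xi>2: "\<xi>2 = rot \<alpha> (polar r2 0)" using rot_polar[of \<alpha> r2 0] by simp
  have krot: "k (rot \<alpha> \<zeta>) = ennreal \<bar>cross2 (polar r2 0) \<zeta>\<bar> * indicator (shell A t e) (- polar r2 0 - \<zeta>)" for \<zeta>
  proof -
    have "- \<xi>2 - rot \<alpha> \<zeta> = rot \<alpha> (- polar r2 0 - \<zeta>)" using \<xi>2 by (simp add: rot_diff rot_minus)
    moreover have "cross2 \<xi>2 (rot \<alpha> \<zeta>) = cross2 (polar r2 0) \<zeta>" using \<xi>2 cross2_rot by metis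
    ultimately show ?thesis by (simp add: k_def indicator_def shell_rot)
  qed
  have "(circ (\<lambda>\<theta>. k (rot \<theta> \<xi>3))) = (circ (\<lambda>\<theta>. k (polar r3 \<theta>)))"
    unfolding r3_def by (rule nn_integral_rot_angle) measurable
  \<comment> \<open>The integral over the full circle depends on \<open>\<xi>3\<close> only through
    its norm, so a rotation by \<open>\<alpha>\<close> can be inserted; it serves to turn
    \<open>\<xi>2\<close> onto the first axis.\<close>
  also have "\<dots> = (circ (\<lambda>\<theta>. k (rot \<theta> (rot \<alpha> \<xi>3))))"
    using nn_integral_rot_angle[of k "rot \<alpha> \<xi>3"] by (simp add: r3_def)
  also have "\<dots> = (circ (\<lambda>\<theta>. k (rot \<alpha> (rot \<theta> \<xi>3))))"
    by (simp only: rot_rot add.commute)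
  also have "\<dots> = (circ (\<lambda>\<theta>. k (rot \<alpha> (polar r3 \<theta>))))"
    using nn_integral_rot_angle[of "\<lambda>\<zeta>. k (rot \<alpha> \<zeta>)" \<xi>3] by (simp add: r3_def)
  also have "\<dots> \<le> (\<integral>\<^sup>+\<theta>. indicator {\<theta>\<in>{0..pi}. - polar r2 0 - polar r3 \<theta> \<in> shell A t e} \<theta> * ennreal (r2 * r3 * sin \<theta>)
      + indicator {\<theta>\<in>{pi..2*pi}. - polar r2 0 - polar r3 \<theta> \<in> shell A t e} \<theta> * ennreal (- (r2 * r3 * sin \<theta>)) \<partial>lborel)"
  proof (rule nn_integral_mono)
    fix \<theta> :: real
    have c: "cross2 (polar r2 0) (polar r3 \<theta>) = r2 * r3 * sin \<theta>" by (simp add: cross2_def)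
    show "k (rot \<alpha> (polar r3 \<theta>)) * indicator {0..<2*pi} \<theta> \<le> indicator {\<theta>\<in>{0..pi}. - polar r2 0 - polar r3 \<theta> \<in> shell A t e} \<theta> * ennreal (r2 * r3 * sin \<theta>)
      + indicator {\<theta>\<in>{pi..2*pi}. - polar r2 0 - polar r3 \<theta> \<in> shell A t e} \<theta> * ennreal (- (r2 * r3 * sin \<theta>))"
    proof (cases "\<theta> \<in> {0..<2*pi} \<and> - polar r2 0 - polar r3 \<theta> \<in> shell A t e")
      case True
      show ?thesis
      proof (cases "\<theta> \<le> pi")
        case le: True
        then have "0 \<le> sin \<theta>" using True by (intro sin_ge_zero) auto
        then show ?thesis using True le rpos by (simp add: krot c)
      next
        case False
        then have "sin \<theta> \<le> 0" using True by (intro sin_le_zero) auto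
        then have "r2 * r3 * sin \<theta> \<le> 0" using rpos by (intro mult_nonneg_nonpos) auto
        then show ?thesis using True False by (simp add: krot c)
      qed
    qed (auto simp: krot indicator_def)
  qed
  also have "\<dots> = (\<integral>\<^sup>+\<theta>. indicator {\<theta>\<in>{0..pi}. - polar r2 0 - polar r3 \<theta> \<in> shell A t e} \<theta> * ennreal (r2 * r3 * sin \<theta>) \<partial>lborel)
      + (\<integral>\<^sup>+\<theta>. indicator {\<theta>\<in>{pi..2*pi}. - polar r2 0 - polar r3 \<theta> \<in> shell A t e} \<theta> * ennreal (- (r2 * r3 * sin \<theta>)) \<partial>lborel)"
  proof -
    have "(\<lambda>\<theta>. rot \<theta> (polar r3 0)) \<in> borel_measurable borel" by measurable
    then have [measurable]: "polar r3 \<in> borel_measurable borel" by (simp add: rot_polar)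
    show ?thesis by (rule nn_integral_add) measurable
  qed
  also have "\<dots> \<le> ennreal (4 * B * e) + ennreal (4 * B * e)"
  proof -
    \<comment> \<open>Both lengths are below 2 and differ by at most \<open>2 * B * e\<close>, so
      their squares differ by at most \<open>8 * B * e\<close>; the square contains twice the cosine
      term.\<close>
    have osc: "\<bar>r2 * r3 * cos \<theta> - r2 * r3 * cos \<eta>\<bar> \<le> 4 * B * e"
      if "- polar r2 0 - polar r3 \<theta> \<in> shell A t e" "- polar r2 0 - polar r3 \<eta> \<in> shell A t e" for \<theta> \<eta>
    proof -
      define x y where "x = - polar r2 0 - polar r3 \<theta>" and "y = - polar r2 0 - polar r3 \<eta>"
      have sq: "(norm (- polar r2 0 - polar r3 \<tau>))\<^sup>2 = r2\<^sup>2 + r3\<^sup>2 + 2 * (r2 * r3 * cos \<tau>)" for \<tau>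
      proof -
        have "r3\<^sup>2 * (cos \<tau>)\<^sup>2 + r3\<^sup>2 * (sin \<tau>)\<^sup>2 = r3\<^sup>2" by (simp flip: distrib_left)
        moreover have "(norm v)\<^sup>2 = (v$1)\<^sup>2 + (v$2)\<^sup>2" for v :: "real^2" by (simp add: norm_real2)
        ultimately show ?thesis by (simp add: power2_diff power_mult_distrib)
      qed
      have xy: "x \<in> shell A t e" "y \<in> shell A t e" using that by (auto simp: x_def y_def)
      have n2: "norm x < 2" "norm y < 2" using xy by (auto simp: shell_def B2_def)
      have "\<bar>norm x - norm y\<bar> \<le> B * \<bar>\<phi> x - \<phi> y\<bar>"
        using xy assms by (intro dist_norm_le) (auto simp: shell_def)
      also have "\<dots> \<le> B * (2 * e)" using xy assms by (intro mult_left_mono) (auto simp: shell_def)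
      finally have d: "\<bar>norm x - norm y\<bar> \<le> 2 * B * e" by simp
      have "2 * (r2 * r3 * cos \<theta>) - 2 * (r2 * r3 * cos \<eta>) = (norm x)\<^sup>2 - (norm y)\<^sup>2"
        unfolding x_def y_def sq by simp
      also have "\<dots> = (norm x + norm y) * (norm x - norm y)" by (simp add: power2_eq_square algebra_simps)
      finally have "\<bar>2 * (r2 * r3 * cos \<theta>) - 2 * (r2 * r3 * cos \<eta>)\<bar> = \<bar>(norm x + norm y) * (norm x - norm y)\<bar>"
        by (rule arg_cong)
      then have "2 * \<bar>r2 * r3 * cos \<theta> - r2 * r3 * cos \<eta>\<bar> = (norm x + norm y) * \<bar>norm x - norm y\<bar>"
        unfolding abs_mult by (simp only: right_diff_distrib[symmetric] abs_mult) simp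
      also have "\<dots> \<le> 4 * (2 * B * e)" using n2 d by (intro mult_mono) auto
      finally show ?thesis by simp
    qed
    have 1: "(\<integral>\<^sup>+\<theta>. indicator {\<theta>\<in>{0..pi}. - polar r2 0 - polar r3 \<theta> \<in> shell A t e} \<theta> * ennreal (r2 * r3 * sin \<theta>) \<partial>lborel) \<le> ennreal (4 * B * e)"
    proof (rule nn_integral_deriv_small_osc[where u="\<lambda>\<theta>. - (r2 * r3 * cos \<theta>)" and a=0 and b=pi])
      show "((\<lambda>\<theta>. - (r2 * r3 * cos \<theta>)) has_real_derivative r2 * r3 * sin x) (at x)" for x
        by (auto intro!: derivative_eq_intros)
      show "0 \<le> r2 * r3 * sin x" if "x \<in> {0..pi}" for x
        using that by (intro mult_nonneg_nonneg[OF rpos] sin_ge_zero) auto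
    qed (use osc in \<open>auto simp: abs_minus_commute\<close>)
    have 2: "(\<integral>\<^sup>+\<theta>. indicator {\<theta>\<in>{pi..2*pi}. - polar r2 0 - polar r3 \<theta> \<in> shell A t e} \<theta> * ennreal (- (r2 * r3 * sin \<theta>)) \<partial>lborel) \<le> ennreal (4 * B * e)"
    proof (rule nn_integral_deriv_small_osc[where u="\<lambda>\<theta>. r2 * r3 * cos \<theta>" and a=pi and b="2*pi"])
      show "((\<lambda>\<theta>. r2 * r3 * cos \<theta>) has_real_derivative - (r2 * r3 * sin x)) (at x)" for x
        by (auto intro!: derivative_eq_intros)
      show "0 \<le> - (r2 * r3 * sin x)" if "x \<in> {pi..2*pi}" for x
      proof (cases "x = 2 * pi")
        case False
        then have "sin x \<le> 0" using that by (intro sin_le_zero) auto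
        then show ?thesis using rpos by (simp add: mult_nonneg_nonpos)
      qed simp
    qed (use osc in auto)
    show ?thesis using 1 2 by (rule add_mono)
  qed
  also have "\<dots> = ennreal (8 * B * e)"
    using assms by (simp flip: ennreal_plus)
  finally show ?thesis by (simp add: k_def)
qed

end

section \<open>Trilinear integrals over x + y + z = 0: Cauchy--Schwarz, rotations and
  radialization\<close>

section \<open>Trilinear forms\<close>

definition esqrt :: "ennreal \<Rightarrow> ennreal" where
  "esqrt x = ennreal_powr x (1/2)"

lemma esqrt_measurable [measurable]:
  assumes [measurable]: "f \<in> borel_measurable M"
  shows "(\<lambda>x. esqrt (f x)) \<in> borel_measurable M"
  unfolding esqrt_def ennreal_powr_def by measurable

lemma esqrt_power2 [simp]: "(esqrt x)\<^sup>2 = x"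
proof (cases x)
  case (real r)
  then show ?thesis
    by (cases "r = 0") (simp_all add: esqrt_def ennreal_powr_def powr_half_sqrt ennreal_power)
qed (simp add: esqrt_def ennreal_powr_def)

lemma ennreal_power2_le_imp_le:
  assumes "(a::ennreal)\<^sup>2 \<le> b\<^sup>2"
  shows "a \<le> b"
proof (cases a; cases b)
  fix r s assume *: "0 \<le> r" "a = ennreal r" "0 \<le> s" "b = ennreal s"
  then have "r\<^sup>2 \<le> s\<^sup>2" using assms by (simp add: ennreal_power)
  then have "r \<le> s" using *(3) by (rule power2_le_imp_le)
  then show ?thesis using * by (simp add: ennreal_leI)
next
  fix s assume *: "a = top" "0 \<le> s" "b = ennreal s"
  then show ?thesis using assms by (simp add: ennreal_power top_unique)
qed simp_all

type_synonym pt = "real \<times> (real^2)"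

text \<open>Joint measurability for the product of Borel algebras allows composition with any three
  measurable maps, hence restriction to x + y + z = 0 in every choice of coordinates.\<close>

definition meas3 :: "(pt \<Rightarrow> pt \<Rightarrow> pt \<Rightarrow> ennreal) \<Rightarrow> bool" where
  "meas3 F \<longleftrightarrow> (\<lambda>w. F (fst w) (fst (snd w)) (snd (snd w))) \<in> borel_measurable (borel \<Otimes>\<^sub>M borel \<Otimes>\<^sub>M borel)"

lemma meas3D:
  assumes F: "meas3 F" and [measurable]: "f \<in> borel_measurable N" "g \<in> borel_measurable N" "h \<in> borel_measurable N"
  shows "(\<lambda>x. F (f x) (g x) (h x)) \<in> borel_measurable N"
proof -
  have "(\<lambda>x. (f x, g x, h x)) \<in> N \<rightarrow>\<^sub>M borel \<Otimes>\<^sub>M borel \<Otimes>\<^sub>M borel" by measurable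
  from measurable_compose[OF this F[unfolded meas3_def]] show ?thesis by simp
qed

text \<open>Any two of the three variables are coordinates on x + y + z = 0 with the same measure.
  The two factors of Cauchy--Schwarz are computed in different coordinates.\<close>

definition tri :: "(pt \<Rightarrow> pt \<Rightarrow> pt \<Rightarrow> ennreal) \<Rightarrow> ennreal" where
  "tri F = (\<integral>\<^sup>+w. F (fst w) (snd w) (- fst w - snd w) \<partial>(lborel :: (pt \<times> pt) measure))"

lemma tri_measurable:
  assumes F: "meas3 F"
  shows "(\<lambda>w. F (fst w) (snd w) (- fst w - snd w)) \<in> borel_measurable (lborel \<Otimes>\<^sub>M lborel)"
  by (rule meas3D[OF F]) measurable

lemma tri_measurable':
  assumes F: "meas3 F"
  shows "(\<lambda>w. F (fst w) (snd w) (- fst w - snd w)) \<in> borel_measurable lborel"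
  using tri_measurable[OF F] by (simp only: lborel_prod)

lemma tri_mono: "(\<And>x y z. x + y + z = 0 \<Longrightarrow> F x y z \<le> G x y z) \<Longrightarrow> tri F \<le> tri G"
  unfolding tri_def by (rule nn_integral_mono) simp

lemma tri_add:
  assumes "meas3 F" "meas3 G"
  shows "tri (\<lambda>x y z. F x y z + G x y z) = tri F + tri G"
  unfolding tri_def by (rule nn_integral_add) (rule tri_measurable'[OF assms(1)] tri_measurable'[OF assms(2)])+

lemma tri_cmult:
  assumes "meas3 F"
  shows "tri (\<lambda>x y z. c * F x y z) = c * tri F"
  unfolding tri_def by (rule nn_integral_cmult) (rule tri_measurable'[OF assms])

lemma tri_Cauchy_Schwarz:
  assumes "meas3 F" "meas3 G"
  shows "(tri (\<lambda>x y z. F x y z * G x y z))\<^sup>2 \<le> tri (\<lambda>x y z. (F x y z)\<^sup>2) * tri (\<lambda>x y z. (G x y z)\<^sup>2)"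
  unfolding tri_def by (rule Cauchy_Schwarz_nn_integral) (rule tri_measurable'[OF assms(1)] tri_measurable'[OF assms(2)])+

lemma nn_integral_reflect:
  fixes f :: "'a::euclidean_space \<Rightarrow> ennreal"
  assumes [measurable]: "f \<in> borel_measurable borel"
  shows "(\<integral>\<^sup>+y. f (t - y) \<partial>lborel) = (\<integral>\<^sup>+y. f y \<partial>lborel)"
proof -
  have "(lborel :: 'a measure) = distr lborel borel (\<lambda>x. t + (-1) *\<^sub>R x)"
    using lborel_affine[of "-1" t] by (simp add: density_1)
  then have "(\<integral>\<^sup>+y. f y \<partial>lborel) = (\<integral>\<^sup>+y. f y \<partial>distr lborel borel (\<lambda>x. t + (-1) *\<^sub>R x))" by simp
  also have "\<dots> = (\<integral>\<^sup>+y. f (t + (-1) *\<^sub>R y) \<partial>lborel)"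
    by (rule nn_integral_distr) auto
  finally show ?thesis by simp
qed

lemma tri_12:
  assumes F: "meas3 F"
  shows "tri F = (\<integral>\<^sup>+x. \<integral>\<^sup>+y. F x y (- x - y) \<partial>lborel \<partial>lborel)"
  unfolding tri_def lborel_prod[where 'a=pt and 'b=pt, symmetric]
  by (subst lborel.nn_integral_fst[symmetric, OF tri_measurable[OF F]]) simp

lemma tri_21:
  assumes F: "meas3 F"
  shows "tri F = (\<integral>\<^sup>+y. \<integral>\<^sup>+x. F x y (- x - y) \<partial>lborel \<partial>lborel)"
  unfolding tri_def lborel_prod[where 'a=pt and 'b=pt, symmetric]
  by (subst lborel_pair.nn_integral_snd[symmetric]) (use tri_measurable[OF F] in simp_all)

lemma tri_13:
  assumes F: "meas3 F"
  shows "tri F = (\<integral>\<^sup>+x. \<integral>\<^sup>+z. F x (- x - z) z \<partial>lborel \<partial>lborel)"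
proof -
  note [measurable (raw)] = meas3D[OF F]
  have "(\<integral>\<^sup>+y. F x y (- x - y) \<partial>lborel) = (\<integral>\<^sup>+z. F x (- x - z) z \<partial>lborel)" for x
    using nn_integral_reflect[of "\<lambda>y. F x y (- x - y)" "- x"] by (simp add: F)
  then show ?thesis by (simp add: tri_12[OF F])
qed

lemma tri_23:
  assumes F: "meas3 F"
  shows "tri F = (\<integral>\<^sup>+y. \<integral>\<^sup>+z. F (- y - z) y z \<partial>lborel \<partial>lborel)"
proof -
  note [measurable (raw)] = meas3D[OF F]
  have "(\<integral>\<^sup>+x. F x y (- x - y) \<partial>lborel) = (\<integral>\<^sup>+z. F (- y - z) y z \<partial>lborel)" for y
    using nn_integral_reflect[of "\<lambda>x. F x y (- x - y)" "- y"] by (simp add: F)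
  then show ?thesis by (simp add: tri_21[OF F])
qed

lemma tri_swap:
  assumes F: "meas3 F"
  shows "tri (\<lambda>x y z. F y x z) = tri F"
proof -
  note [measurable (raw)] = meas3D[OF F]
  have "meas3 (\<lambda>x y z. F y x z)" unfolding meas3_def using F by measurable
  then show ?thesis by (simp add: tri_12 tri_21[OF F] minus_diff_commute)
qed

definition rotz :: "real \<Rightarrow> pt \<Rightarrow> pt" where
  "rotz \<theta> x = (fst x, rot \<theta> (snd x))"

lemma rotz_simps [simp]: "fst (rotz \<theta> x) = fst x" "snd (rotz \<theta> x) = rot \<theta> (snd x)"
  by (simp_all add: rotz_def)

lemma fst_borel_measurable [measurable (raw)]:
  fixes f :: "'z \<Rightarrow> 'a::second_countable_topology \<times> 'b::second_countable_topology"
  shows "f \<in> borel_measurable M \<Longrightarrow> (\<lambda>x. fst (f x)) \<in> borel_measurable M"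
  by (simp add: borel_prod[symmetric])

lemma snd_borel_measurable [measurable (raw)]:
  fixes f :: "'z \<Rightarrow> 'a::second_countable_topology \<times> 'b::second_countable_topology"
  shows "f \<in> borel_measurable M \<Longrightarrow> (\<lambda>x. snd (f x)) \<in> borel_measurable M"
  by (simp add: borel_prod[symmetric])

lemma rotz_measurable [measurable (raw)]:
  assumes [measurable]: "f \<in> borel_measurable M" "g \<in> borel_measurable M"
  shows "(\<lambda>x. rotz (f x) (g x)) \<in> borel_measurable M"
  unfolding rotz_def by measurable

lemma rotz_diff: "rotz \<theta> (- x - y) = - rotz \<theta> x - rotz \<theta> y"
  by (simp add: rotz_def prod_eq_iff rot_diff rot_minus)

lemma nn_integral_rotz:
  assumes [measurable]: "f \<in> borel_measurable borel"
  shows "(\<integral>\<^sup>+x. f (rotz \<theta> x) \<partial>lborel) = (\<integral>\<^sup>+x. f x \<partial>lborel)"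
proof -
  have *: "(\<integral>\<^sup>+x. h x \<partial>lborel) = (\<integral>\<^sup>+\<tau>. \<integral>\<^sup>+\<xi>. h (\<tau>, \<xi>) \<partial>lborel \<partial>lborel)"
    if "h \<in> borel_measurable borel" for h :: "pt \<Rightarrow> ennreal"
    unfolding lborel_prod[symmetric]
    by (rule lborel.nn_integral_fst[symmetric]) (use that in \<open>simp add: borel_prod[symmetric]\<close>)
  have "(\<integral>\<^sup>+x. f (rotz \<theta> x) \<partial>lborel) = (\<integral>\<^sup>+\<tau>. \<integral>\<^sup>+\<xi>. f (\<tau>, rot \<theta> \<xi>) \<partial>lborel \<partial>lborel)"
    by (subst *) (simp_all add: rotz_def)
  also have "\<dots> = (\<integral>\<^sup>+\<tau>. \<integral>\<^sup>+\<xi>. f (\<tau>, \<xi>) \<partial>lborel \<partial>lborel)"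
    by (intro nn_integral_cong nn_integral_rot) measurable
  finally show ?thesis by (simp add: *)
qed

text \<open>Cauchy--Schwarz separates \<open>g1\<close> times \<open>w\<close> from
  \<open>g2\<close> times \<open>g3\<close>. The latter is an exact product in the coordinates (y,
  z); in the coordinates (x, z) the former leaves the inner integral controlled by
  \<open>Q\<close>.\<close>

lemma tri_bound_fixed:
  assumes [measurable]: "g1 \<in> borel_measurable borel" "g2 \<in> borel_measurable borel" "g3 \<in> borel_measurable borel"
    and w: "meas3 w" and Q: "\<And>x. (\<integral>\<^sup>+z. (w x (- x - z) z)\<^sup>2 \<partial>lborel) \<le> Q"
  shows "(tri (\<lambda>x y z. g1 x * g2 y * g3 z * w x y z))\<^sup>2
    \<le> Q * ((\<integral>\<^sup>+x. (g1 x)\<^sup>2 \<partial>lborel) * (\<integral>\<^sup>+x. (g2 x)\<^sup>2 \<partial>lborel) * (\<integral>\<^sup>+x. (g3 x)\<^sup>2 \<partial>lborel))"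
proof -
  note [measurable (raw)] = meas3D[OF w]
  have m1: "meas3 (\<lambda>x y z. g1 x * w x y z)" and m2: "meas3 (\<lambda>x y z. g2 y * g3 z)"
    unfolding meas3_def using w by measurable
  have m1': "meas3 (\<lambda>x y z. (g1 x * w x y z)\<^sup>2)" and m2': "meas3 (\<lambda>x y z. (g2 y * g3 z)\<^sup>2)"
    unfolding meas3_def using w by measurable
  have "(tri (\<lambda>x y z. g1 x * g2 y * g3 z * w x y z))\<^sup>2 = (tri (\<lambda>x y z. (g1 x * w x y z) * (g2 y * g3 z)))\<^sup>2"
    by (simp only: mult_ac)
  also have "\<dots> \<le> tri (\<lambda>x y z. (g1 x * w x y z)\<^sup>2) * tri (\<lambda>x y z. (g2 y * g3 z)\<^sup>2)"
    by (rule tri_Cauchy_Schwarz[OF m1 m2])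
  also have "\<dots> \<le> (Q * (\<integral>\<^sup>+x. (g1 x)\<^sup>2 \<partial>lborel)) * ((\<integral>\<^sup>+x. (g2 x)\<^sup>2 \<partial>lborel) * (\<integral>\<^sup>+x. (g3 x)\<^sup>2 \<partial>lborel))"
  proof (rule mult_mono)
    show "tri (\<lambda>x y z. (g2 y * g3 z)\<^sup>2) \<le> (\<integral>\<^sup>+x. (g2 x)\<^sup>2 \<partial>lborel) * (\<integral>\<^sup>+x. (g3 x)\<^sup>2 \<partial>lborel)"
      by (subst tri_23[OF m2']) (simp add: power_mult_distrib nn_integral_cmult nn_integral_multc)
    show "tri (\<lambda>x y z. (g1 x * w x y z)\<^sup>2) \<le> Q * (\<integral>\<^sup>+x. (g1 x)\<^sup>2 \<partial>lborel)"
    proof -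
      have "tri (\<lambda>x y z. (g1 x * w x y z)\<^sup>2) = (\<integral>\<^sup>+x. (g1 x)\<^sup>2 * (\<integral>\<^sup>+z. (w x (- x - z) z)\<^sup>2 \<partial>lborel) \<partial>lborel)"
      proof -
        have "(\<integral>\<^sup>+z. (g1 x * w x (- x - z) z)\<^sup>2 \<partial>lborel) = (g1 x)\<^sup>2 * (\<integral>\<^sup>+z. (w x (- x - z) z)\<^sup>2 \<partial>lborel)" for x
          unfolding power_mult_distrib using w by (intro nn_integral_cmult) measurable
        then show ?thesis by (simp add: tri_13[OF m1'])
      qed
      also have "\<dots> \<le> (\<integral>\<^sup>+x. (g1 x)\<^sup>2 * Q \<partial>lborel)"
        using Q by (intro nn_integral_mono mult_left_mono) auto
      also have "\<dots> = Q * (\<integral>\<^sup>+x. (g1 x)\<^sup>2 \<partial>lborel)" by (subst nn_integral_multc) (simp_all add: mult.commute)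
      finally show ?thesis .
    qed
  qed simp_all
  finally show ?thesis by (simp only: mult_ac)
qed

text \<open>Here a part \<open>u\<close> of the weight goes to the factor with \<open>g2\<close> and
  \<open>g3\<close>. For fixed \<open>y\<close> the variable \<open>z\<close> can be averaged over
  rotations without changing \<open>g3\<close>, so an integral of \<open>u\<close> squared over the
  angle takes the place of a supremum.\<close>

lemma tri_bound_radial:
  assumes [measurable]: "g1 \<in> borel_measurable borel" "g2 \<in> borel_measurable borel" "g3 \<in> borel_measurable borel"
    and g3: "\<And>\<theta> z. g3 (rotz \<theta> z) = g3 z"
    and u: "meas3 u" and v: "meas3 v"
    and Q: "\<And>x. (\<integral>\<^sup>+z. (v x (- x - z) z)\<^sup>2 \<partial>lborel) \<le> Q"
    and P: "\<And>y z. (circ (\<lambda>\<theta>. (u (- y - rotz \<theta> z) y (rotz \<theta> z))\<^sup>2)) \<le> P"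
  shows "(tri (\<lambda>x y z. g1 x * g2 y * g3 z * (u x y z * v x y z)))\<^sup>2
    \<le> Q * P * ((\<integral>\<^sup>+x. (g1 x)\<^sup>2 \<partial>lborel) * (\<integral>\<^sup>+x. (g2 x)\<^sup>2 \<partial>lborel) * (\<integral>\<^sup>+x. (g3 x)\<^sup>2 \<partial>lborel))"
proof -
  note [measurable (raw)] = meas3D[OF u] meas3D[OF v]
  have m1: "meas3 (\<lambda>x y z. g1 x * v x y z)" and m2: "meas3 (\<lambda>x y z. g2 y * g3 z * u x y z)"
    unfolding meas3_def using u v by measurable
  have m1': "meas3 (\<lambda>x y z. (g1 x * v x y z)\<^sup>2)" and m2': "meas3 (\<lambda>x y z. (g2 y * g3 z * u x y z)\<^sup>2)"
    unfolding meas3_def using u v by measurable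
  have "(tri (\<lambda>x y z. g1 x * g2 y * g3 z * (u x y z * v x y z)))\<^sup>2 = (tri (\<lambda>x y z. (g1 x * v x y z) * (g2 y * g3 z * u x y z)))\<^sup>2"
    by (simp only: mult_ac)
  also have "\<dots> \<le> tri (\<lambda>x y z. (g1 x * v x y z)\<^sup>2) * tri (\<lambda>x y z. (g2 y * g3 z * u x y z)\<^sup>2)"
    by (rule tri_Cauchy_Schwarz[OF m1 m2])
  also have "\<dots> \<le> (Q * (\<integral>\<^sup>+x. (g1 x)\<^sup>2 \<partial>lborel)) * (P * ((\<integral>\<^sup>+x. (g2 x)\<^sup>2 \<partial>lborel) * (\<integral>\<^sup>+x. (g3 x)\<^sup>2 \<partial>lborel)))"
  proof (rule mult_mono)
    show "tri (\<lambda>x y z. (g2 y * g3 z * u x y z)\<^sup>2) \<le> P * ((\<integral>\<^sup>+x. (g2 x)\<^sup>2 \<partial>lborel) * (\<integral>\<^sup>+x. (g3 x)\<^sup>2 \<partial>lborel))"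
    proof -
      define T where "T = tri (\<lambda>x y z. (g2 y * g3 z * u x y z)\<^sup>2)"
      have T: "T = (\<integral>\<^sup>+y. (g2 y)\<^sup>2 * (\<integral>\<^sup>+z. (g3 z)\<^sup>2 * (u (- y - z) y z)\<^sup>2 \<partial>lborel) \<partial>lborel)"
      proof -
        have "(\<integral>\<^sup>+z. (g2 y * g3 z * u (- y - z) y z)\<^sup>2 \<partial>lborel) = (g2 y)\<^sup>2 * (\<integral>\<^sup>+z. (g3 z)\<^sup>2 * (u (- y - z) y z)\<^sup>2 \<partial>lborel)" for y
          unfolding power_mult_distrib mult.assoc using u by (intro nn_integral_cmult) measurable
        then show ?thesis by (simp add: T_def tri_23[OF m2'])
      qed
      have inner: "ennreal (2 * pi) * (\<integral>\<^sup>+z. (g3 z)\<^sup>2 * (u (- y - z) y z)\<^sup>2 \<partial>lborel) \<le> P * (\<integral>\<^sup>+x. (g3 x)\<^sup>2 \<partial>lborel)" for y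
      proof -
        define q where "q z = (g3 z)\<^sup>2 * (u (- y - z) y z)\<^sup>2" for z
        have [measurable]: "q \<in> borel_measurable borel" unfolding q_def using u by measurable
        have "ennreal (2 * pi) * (\<integral>\<^sup>+z. q z \<partial>lborel) = (\<integral>\<^sup>+\<theta>. (\<integral>\<^sup>+z. q z \<partial>lborel) * indicator {0..<2*pi} \<theta> \<partial>(lborel::real measure))"
          by (subst nn_integral_cmult_indicator) (simp_all add: mult.commute)
        also have "\<dots> = (\<integral>\<^sup>+\<theta>. \<integral>\<^sup>+z. q (rotz \<theta> z) * indicator {0..<2*pi} \<theta> \<partial>lborel \<partial>lborel)"
          by (intro nn_integral_cong) (simp add: nn_integral_multc nn_integral_rotz)
        also have "\<dots> = (\<integral>\<^sup>+z. circ (\<lambda>\<theta>. q (rotz \<theta> z)) \<partial>lborel)"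
          by (rule lborel_pair.Fubini') measurable
        also have "\<dots> = (\<integral>\<^sup>+z. (g3 z)\<^sup>2 * (circ (\<lambda>\<theta>. (u (- y - rotz \<theta> z) y (rotz \<theta> z))\<^sup>2)) \<partial>lborel)"
          unfolding q_def g3 mult.assoc using u by (intro nn_integral_cong nn_integral_cmult) measurable
        also have "\<dots> \<le> (\<integral>\<^sup>+z. (g3 z)\<^sup>2 * P \<partial>lborel)"
          using P by (intro nn_integral_mono mult_left_mono) auto
        also have "\<dots> = P * (\<integral>\<^sup>+x. (g3 x)\<^sup>2 \<partial>lborel)" by (subst nn_integral_multc) (simp_all add: mult.commute)
        finally show ?thesis by (simp add: q_def)
      qed
      \<comment> \<open>The averaged bound controls \<open>2 * pi\<close> times the integral; since
        this factor is at least 1 it is simply dropped.\<close>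
      have "T \<le> ennreal (2 * pi) * T"
      proof -
        have "1 \<le> ennreal (2 * pi)" using pi_ge_two by (simp add: ennreal_ge_1)
        then show ?thesis using mult_right_mono[of 1 "ennreal (2 * pi)" T] by simp
      qed
      also have "\<dots> = (\<integral>\<^sup>+y. (g2 y)\<^sup>2 * (ennreal (2 * pi) * (\<integral>\<^sup>+z. (g3 z)\<^sup>2 * (u (- y - z) y z)\<^sup>2 \<partial>lborel)) \<partial>lborel)"
      proof -
        have "(\<lambda>w. (g3 (snd w))\<^sup>2 * (u (- fst w - snd w) (fst w) (snd w))\<^sup>2) \<in> borel_measurable (lborel \<Otimes>\<^sub>M lborel)"
          using u by measurable
        then have [measurable]: "(\<lambda>y. \<integral>\<^sup>+z. (g3 z)\<^sup>2 * (u (- y - z) y z)\<^sup>2 \<partial>lborel) \<in> borel_measurable borel"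
          using lborel.borel_measurable_nn_integral_fst[of "\<lambda>w. (g3 (snd w))\<^sup>2 * (u (- fst w - snd w) (fst w) (snd w))\<^sup>2" lborel] by simp
        show ?thesis unfolding T by (subst nn_integral_cmult[symmetric]) (simp_all add: mult_ac)
      qed
      also have "\<dots> \<le> (\<integral>\<^sup>+y. (g2 y)\<^sup>2 * (P * (\<integral>\<^sup>+x. (g3 x)\<^sup>2 \<partial>lborel)) \<partial>lborel)"
        using inner by (intro nn_integral_mono mult_left_mono) auto
      also have "\<dots> = P * ((\<integral>\<^sup>+x. (g2 x)\<^sup>2 \<partial>lborel) * (\<integral>\<^sup>+x. (g3 x)\<^sup>2 \<partial>lborel))"
        by (subst nn_integral_multc) (simp_all add: mult_ac)
      finally show ?thesis by (simp add: T_def)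
    qed
    show "tri (\<lambda>x y z. (g1 x * v x y z)\<^sup>2) \<le> Q * (\<integral>\<^sup>+x. (g1 x)\<^sup>2 \<partial>lborel)"
    proof -
      have "tri (\<lambda>x y z. (g1 x * v x y z)\<^sup>2) = (\<integral>\<^sup>+x. (g1 x)\<^sup>2 * (\<integral>\<^sup>+z. (v x (- x - z) z)\<^sup>2 \<partial>lborel) \<partial>lborel)"
      proof -
        have "(\<integral>\<^sup>+z. (g1 x * v x (- x - z) z)\<^sup>2 \<partial>lborel) = (g1 x)\<^sup>2 * (\<integral>\<^sup>+z. (v x (- x - z) z)\<^sup>2 \<partial>lborel)" for x
          unfolding power_mult_distrib using v by (intro nn_integral_cmult) measurable
        then show ?thesis by (simp add: tri_13[OF m1'])
      qed
      also have "\<dots> \<le> (\<integral>\<^sup>+x. (g1 x)\<^sup>2 * Q \<partial>lborel)"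
        using Q by (intro nn_integral_mono mult_left_mono) auto
      also have "\<dots> = Q * (\<integral>\<^sup>+x. (g1 x)\<^sup>2 \<partial>lborel)" by (subst nn_integral_multc) (simp_all add: mult.commute)
      finally show ?thesis .
    qed
  qed simp_all
  finally show ?thesis by (simp only: mult_ac)
qed

text \<open>The angular norm is not normalized, so each use multiplies the squared norm by 2 pi.
  These factors are removed in \<open>radialize_cancel\<close>.\<close>

definition radialize :: "(pt \<Rightarrow> ennreal) \<Rightarrow> pt \<Rightarrow> ennreal" where
  "radialize g x = esqrt (circ (\<lambda>\<theta>. (g (rotz \<theta> x))\<^sup>2))"

lemma nn_integral_rotz_angle:
  assumes [measurable]: "k \<in> borel_measurable borel"
  shows "(circ (\<lambda>\<theta>. k (rotz \<theta> x)))
    = (circ (\<lambda>\<theta>. k (fst x, polar (norm (snd x)) \<theta>)))"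
  unfolding rotz_def using nn_integral_rot_angle[of "\<lambda>\<xi>. k (fst x, \<xi>)" "snd x"] by simp

lemma nn_integral_rotz_angle_rotz:
  assumes [measurable]: "k \<in> borel_measurable borel"
  shows "(circ (\<lambda>\<theta>. k (rotz \<theta> (rotz \<eta> x))))
    = (circ (\<lambda>\<theta>. k (rotz \<theta> x)))"
  by (simp only: nn_integral_rotz_angle[OF assms] rotz_simps norm_rot)

lemma nn_integral_angle_measurable [measurable]:
  assumes [measurable]: "k \<in> borel_measurable borel"
  shows "(\<lambda>x. circ (\<lambda>\<theta>. k (rotz \<theta> x))) \<in> borel_measurable borel"
proof -
  have "(\<lambda>w. k (rotz (snd w) (fst w)) * indicator {0..<2*pi} (snd w)) \<in> borel_measurable (lborel \<Otimes>\<^sub>M lborel)"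
    by measurable
  then show ?thesis
    using lborel.borel_measurable_nn_integral_fst[of "\<lambda>w. k (rotz (snd w) (fst w)) * indicator {0..<2*pi} (snd w)" lborel] by simp
qed

lemma nn_integral_rotz_average:
  assumes [measurable]: "k \<in> borel_measurable borel"
  shows "(\<integral>\<^sup>+x. circ (\<lambda>\<theta>. k (rotz \<theta> x)) \<partial>lborel) = ennreal (2 * pi) * (\<integral>\<^sup>+x. k x \<partial>lborel)"
proof -
  have "(\<integral>\<^sup>+x. circ (\<lambda>\<theta>. k (rotz \<theta> x)) \<partial>lborel)
    = (\<integral>\<^sup>+\<theta>. \<integral>\<^sup>+x. k (rotz \<theta> x) * indicator {0..<2*pi} \<theta> \<partial>lborel \<partial>lborel)"
    by (rule lborel_pair.Fubini') measurable
  also have "\<dots> = (circ (\<lambda>\<theta>. (\<integral>\<^sup>+x. k x \<partial>lborel)))"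
    by (intro nn_integral_cong) (simp add: nn_integral_multc nn_integral_rotz)
  also have "\<dots> = ennreal (2 * pi) * (\<integral>\<^sup>+x. k x \<partial>lborel)"
    by (subst nn_integral_cmult_indicator) (simp_all add: mult.commute)
  finally show ?thesis .
qed

lemma radialize_measurable [measurable]:
  assumes [measurable]: "g \<in> borel_measurable borel"
  shows "radialize g \<in> borel_measurable borel"
proof -
  have "(\<lambda>x. circ (\<lambda>\<theta>. (g (rotz \<theta> x))\<^sup>2)) \<in> borel_measurable borel"
    by (rule nn_integral_angle_measurable) measurable
  then show ?thesis unfolding radialize_def[abs_def] by measurable
qed

lemma radialize_rotz:
  assumes [measurable]: "g \<in> borel_measurable borel"
  shows "radialize g (rotz \<theta> x) = radialize g x"
  unfolding radialize_def using nn_integral_rotz_angle_rotz[of "\<lambda>x. (g x)\<^sup>2"] by simp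

lemma nn_integral_radialize:
  assumes [measurable]: "g \<in> borel_measurable borel"
  shows "(\<integral>\<^sup>+x. (radialize g x)\<^sup>2 \<partial>lborel) = ennreal (2 * pi) * (\<integral>\<^sup>+x. (g x)\<^sup>2 \<partial>lborel)"
  unfolding radialize_def esqrt_power2 by (rule nn_integral_rotz_average[of "\<lambda>x. (g x)\<^sup>2"]) measurable

text \<open>A common rotation of the three variables preserves the measure on x + y + z = 0. After
  averaging, the invariant factors \<open>g1\<close> and \<open>m\<close> leave the angular
  integral, and Cauchy--Schwarz in the angle acts on \<open>g2\<close> and
  \<open>g3\<close>.\<close>

lemma tri_radialize:
  assumes [measurable]: "g1 \<in> borel_measurable borel" "g2 \<in> borel_measurable borel" "g3 \<in> borel_measurable borel"
    and m: "meas3 m"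
    and g1: "\<And>\<theta> z. g1 (rotz \<theta> z) = g1 z"
    and minv: "\<And>\<theta> x y z. m (rotz \<theta> x) (rotz \<theta> y) (rotz \<theta> z) = m x y z"
  shows "ennreal (2 * pi) * tri (\<lambda>x y z. g1 x * g2 y * g3 z * m x y z)
    \<le> tri (\<lambda>x y z. g1 x * radialize g2 y * radialize g3 z * m x y z)"
proof -
  note [measurable (raw)] = meas3D[OF m]
  define F where "F = (\<lambda>x y z. g1 x * g2 y * g3 z * m x y z)"
  have F: "meas3 F" unfolding F_def meas3_def using m by measurable
  note [measurable (raw)] = meas3D[OF F]
  have rotF: "tri (\<lambda>x y z. F (rotz \<theta> x) (rotz \<theta> y) (rotz \<theta> z)) = tri F" for \<theta>
  proof -
    have F': "meas3 (\<lambda>x y z. F (rotz \<theta> x) (rotz \<theta> y) (rotz \<theta> z))"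
      unfolding meas3_def using F by measurable
    have mm: "(\<lambda>w. F (fst w) (snd w) (- fst w - snd w)) \<in> borel_measurable (borel \<Otimes>\<^sub>M lborel)"
      using F by measurable
    have [measurable]: "(\<lambda>x. \<integral>\<^sup>+y. F x y (- x - y) \<partial>lborel) \<in> borel_measurable borel"
      using lborel.borel_measurable_nn_integral_fst[OF mm] by simp
    have "tri (\<lambda>x y z. F (rotz \<theta> x) (rotz \<theta> y) (rotz \<theta> z))
      = (\<integral>\<^sup>+x. \<integral>\<^sup>+y. F (rotz \<theta> x) (rotz \<theta> y) (- rotz \<theta> x - rotz \<theta> y) \<partial>lborel \<partial>lborel)"
      unfolding tri_12[OF F'] by (simp add: rotz_diff)
    also have "\<dots> = (\<integral>\<^sup>+x. \<integral>\<^sup>+y. F (rotz \<theta> x) y (- rotz \<theta> x - y) \<partial>lborel \<partial>lborel)"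
      using F by (intro nn_integral_cong nn_integral_rotz) measurable
    also have "\<dots> = (\<integral>\<^sup>+x. \<integral>\<^sup>+y. F x y (- x - y) \<partial>lborel \<partial>lborel)"
      by (rule nn_integral_rotz) measurable
    finally show ?thesis by (simp add: tri_12[OF F])
  qed
  have "ennreal (2 * pi) * tri F = (\<integral>\<^sup>+\<theta>. tri F * indicator {0..<2*pi} \<theta> \<partial>(lborel::real measure))"
    by (subst nn_integral_cmult_indicator) (simp_all add: mult.commute)
  also have "\<dots> = (\<integral>\<^sup>+\<theta>. \<integral>\<^sup>+w. F (rotz \<theta> (fst w)) (rotz \<theta> (snd w)) (rotz \<theta> (- fst w - snd w)) * indicator {0..<2*pi} \<theta> \<partial>(lborel :: (pt \<times> pt) measure) \<partial>lborel)"
  proof (rule nn_integral_cong)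
    fix \<theta> :: real
    have "(\<lambda>w. F (rotz \<theta> (fst w)) (rotz \<theta> (snd w)) (rotz \<theta> (- fst w - snd w))) \<in> borel_measurable (borel :: (pt \<times> pt) measure)"
      using F by measurable
    moreover have "tri F = (\<integral>\<^sup>+w. F (rotz \<theta> (fst w)) (rotz \<theta> (snd w)) (rotz \<theta> (- fst w - snd w)) \<partial>(lborel :: (pt \<times> pt) measure))"
      using rotF[of \<theta>] by (simp add: tri_def)
    ultimately show "tri F * indicator {0..<2*pi} \<theta> = (\<integral>\<^sup>+w. F (rotz \<theta> (fst w)) (rotz \<theta> (snd w)) (rotz \<theta> (- fst w - snd w)) * indicator {0..<2*pi} \<theta> \<partial>(lborel :: (pt \<times> pt) measure))"
      by (subst nn_integral_multc) simp_all
  qed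
  also have "\<dots> = (\<integral>\<^sup>+w. circ (\<lambda>\<theta>. F (rotz \<theta> (fst w)) (rotz \<theta> (snd w)) (rotz \<theta> (- fst w - snd w))) \<partial>(lborel :: (pt \<times> pt) measure))"
    by (rule lborel_pair.Fubini') (use F in measurable)
  also have "\<dots> = tri (\<lambda>x y z. circ (\<lambda>\<theta>. F (rotz \<theta> x) (rotz \<theta> y) (rotz \<theta> z)))"
    by (simp add: tri_def)
  also have "\<dots> \<le> tri (\<lambda>x y z. g1 x * radialize g2 y * radialize g3 z * m x y z)"
  proof (rule tri_mono)
    fix x y z
    have i2: "(indicator {0..<2*pi} \<theta> :: ennreal)\<^sup>2 = indicator {0..<2*pi} \<theta>" for \<theta>
      by (simp add: indicator_def)
    have "(\<integral>\<^sup>+\<theta>. (g2 (rotz \<theta> y) * indicator {0..<2*pi} \<theta>) * (g3 (rotz \<theta> z) * indicator {0..<2*pi} \<theta>) \<partial>lborel)\<^sup>2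
      \<le> (\<integral>\<^sup>+\<theta>. (g2 (rotz \<theta> y) * indicator {0..<2*pi} \<theta>)\<^sup>2 \<partial>lborel) * (\<integral>\<^sup>+\<theta>. (g3 (rotz \<theta> z) * indicator {0..<2*pi} \<theta>)\<^sup>2 \<partial>lborel)"
      by (rule Cauchy_Schwarz_nn_integral) measurable
    also have "\<dots> = (radialize g2 y * radialize g3 z)\<^sup>2"
      by (simp add: radialize_def power_mult_distrib i2)
    finally have cs: "(\<integral>\<^sup>+\<theta>. (g2 (rotz \<theta> y) * indicator {0..<2*pi} \<theta>) * (g3 (rotz \<theta> z) * indicator {0..<2*pi} \<theta>) \<partial>lborel)
      \<le> radialize g2 y * radialize g3 z" by (rule ennreal_power2_le_imp_le)
    have "(circ (\<lambda>\<theta>. F (rotz \<theta> x) (rotz \<theta> y) (rotz \<theta> z)))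
      = (\<integral>\<^sup>+\<theta>. (g1 x * m x y z) * ((g2 (rotz \<theta> y) * indicator {0..<2*pi} \<theta>) * (g3 (rotz \<theta> z) * indicator {0..<2*pi} \<theta>)) \<partial>lborel)"
      by (intro nn_integral_cong) (simp add: F_def g1 minv indicator_def mult_ac)
    also have "\<dots> = (g1 x * m x y z) * (\<integral>\<^sup>+\<theta>. (g2 (rotz \<theta> y) * indicator {0..<2*pi} \<theta>) * (g3 (rotz \<theta> z) * indicator {0..<2*pi} \<theta>) \<partial>lborel)"
      by (rule nn_integral_cmult) measurable
    also have "\<dots> \<le> (g1 x * m x y z) * (radialize g2 y * radialize g3 z)"
      using cs by (rule mult_left_mono) simp
    finally show "(circ (\<lambda>\<theta>. F (rotz \<theta> x) (rotz \<theta> y) (rotz \<theta> z)))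
      \<le> g1 x * radialize g2 y * radialize g3 z * m x y z" by (simp add: mult_ac)
  qed
  finally show ?thesis unfolding F_def .
qed

section \<open>The weighted L^2 bound and the weighted radial bound\<close>

section \<open>Bounds on the transversal region\<close>

lemma wt_power2: "(wt \<gamma> s)\<^sup>2 = wt (2 * \<gamma>) s"
proof -
  have "(s powr (- \<gamma>))\<^sup>2 = s powr (- (2 * \<gamma>))" by (simp add: power2_eq_square flip: powr_add)
  then show ?thesis by (simp add: wt_def ennreal_power)
qed

definition n2 :: "(pt \<Rightarrow> ennreal) \<Rightarrow> ennreal" where
  "n2 h = (\<integral>\<^sup>+x. (h x)\<^sup>2 \<partial>lborel)"

text \<open>The first slot holds the frequency to be fixed. The locale is instantiated a second time
  with phases 1 and 2 exchanged, for the region where the other gradient differs from the third.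
  \<open>L\<close> bounds the third frequency, and \<open>C0\<close> is the constant of
  \<open>strip_bound\<close>.\<close>

locale trilinear = p1: radial_C1 M \<beta> \<phi>1 g1 + p2: radial_C1 M \<beta> \<phi>2 g2 + p3: radial_C1 M \<beta> \<phi>3 g3
  for M \<beta> :: real and \<phi>1 g1 \<phi>2 g2 \<phi>3 g3 +
  fixes A B b c \<epsilon> L C0 :: real
  assumes A: "1 \<le> A" and B: "1 \<le> B" and \<epsilon>: "0 < \<epsilon>" and L: "0 < L" and C0: "0 < C0"
    and lower: "\<And>x. x \<in> B2 \<Longrightarrow> 1 / A \<le> norm x \<Longrightarrow> norm x \<le> A \<Longrightarrow> 1 / B \<le> norm (g1 x)"
    and strip: "\<And>\<kappa> t \<xi>1. 0 \<le> \<kappa> \<Longrightarrow> \<kappa> < 1 \<Longrightarrow> 1 / A \<le> norm \<xi>1 \<Longrightarrow>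
      strip_integral \<phi>2 g2 \<phi>3 g3 b c \<epsilon> L t \<kappa> \<xi>1 \<le> ennreal (C0 * \<epsilon> * L / (1 - \<kappa>))"
begin

definition core :: "pt \<Rightarrow> pt \<Rightarrow> pt \<Rightarrow> bool" where
  "core x y z \<longleftrightarrow> snd x \<in> B2 \<and> snd y \<in> B2 \<and> snd z \<in> B2 \<and> \<bar>fst x - \<phi>1 (snd x)\<bar> \<le> \<epsilon> \<and> \<bar>fst y - \<phi>2 (snd y)\<bar> \<le> \<epsilon>
    \<and> \<bar>fst z - \<phi>3 (snd z)\<bar> \<le> \<epsilon> \<and> 1 / A \<le> norm (snd x) \<and> norm (snd x) \<le> A \<and> norm (snd z) \<le> L
    \<and> (c < 3 * \<epsilon> \<or> b \<le> norm (g2 (snd y) - g3 (snd z)))"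

definition chi :: "pt \<Rightarrow> pt \<Rightarrow> pt \<Rightarrow> ennreal" where
  "chi x y z = (if core x y z then 1 else 0)"

text \<open>The separation s, normalized by \<open>L\<close> rather than by the dyadic size; the two
  differ by the fixed factor \<open>K\<close>.\<close>

definition sep :: "pt \<Rightarrow> pt \<Rightarrow> real" where
  "sep x z = \<bar>cross2 (snd x) (snd z)\<bar> / L"

lemma sep_nonneg: "0 \<le> sep x z"
  using L by (simp add: sep_def)

lemma sep_measurable [measurable (raw)]:
  assumes [measurable]: "f \<in> borel_measurable N" "h \<in> borel_measurable N"
  shows "(\<lambda>x. sep (f x) (h x)) \<in> borel_measurable N"
  unfolding sep_def by measurable

lemma chi_measurable [measurable (raw)]:
  assumes [measurable]: "f \<in> borel_measurable N" "h \<in> borel_measurable N" "k \<in> borel_measurable N"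
  shows "(\<lambda>x. chi (f x) (h x) (k x)) \<in> borel_measurable N"
  unfolding chi_def core_def by measurable

lemma core_rotz: "core (rotz \<theta> x) (rotz \<theta> y) (rotz \<theta> z) \<longleftrightarrow> core x y z"
proof (cases "snd x \<in> B2 \<and> snd y \<in> B2 \<and> snd z \<in> B2")
  case True
  then have "norm (g2 (rot \<theta> (snd y)) - g3 (rot \<theta> (snd z))) = norm (g2 (snd y) - g3 (snd z))"
    by (simp add: p2.g_rot p3.g_rot flip: rot_diff)
  then show ?thesis using True by (simp add: core_def p1.phi_rot p2.phi_rot p3.phi_rot)
qed (auto simp: core_def)

lemma chi_rotz: "chi (rotz \<theta> x) (rotz \<theta> y) (rotz \<theta> z) = chi x y z"
  by (simp add: chi_def core_rotz)

lemma sep_rotz: "sep (rotz \<theta> x) (rotz \<theta> z) = sep x z"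
  by (simp add: sep_def)

text \<open>Adding the three conditions on \<tau> - \<phi>, with times that sum to zero, puts the
  third frequency in the strip of width \<open>3 * \<epsilon>\<close>. For each such frequency its
  time variable has an interval of length \<open>2 * \<epsilon>\<close>, which supplies the second
  power of \<open>\<epsilon>\<close>.\<close>

lemma core_strip:
  assumes \<kappa>: "0 \<le> \<kappa>" "\<kappa> < 1"
  shows "(\<integral>\<^sup>+z. chi x (- x - z) z * wt \<kappa> (sep x z) \<partial>lborel) \<le> ennreal (2 * C0 * \<epsilon>\<^sup>2 * L / (1 - \<kappa>))"
proof (cases "1 / A \<le> norm (snd x) \<and> \<bar>fst x - \<phi>1 (snd x)\<bar> \<le> \<epsilon>")
  case False
  then have "chi x y z = 0" for y z by (auto simp: chi_def core_def)
  then show ?thesis by simp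
next
  case True
  define S where "S = strip_set \<phi>2 g2 \<phi>3 g3 b c \<epsilon> L (\<phi>1 (snd x)) (snd x)"
  have [measurable]: "S \<in> sets borel" unfolding S_def by (rule strip_set_measurable) measurable
  have le: "chi x (- x - z) z \<le> indicator S (snd z) * indicator {\<phi>3 (snd z) - \<epsilon>..\<phi>3 (snd z) + \<epsilon>} (fst z)" for z
  proof (cases "core x (- x - z) z")
    case core: True
    have "\<bar>\<phi>1 (snd x) + \<phi>2 (- snd x - snd z) + \<phi>3 (snd z)\<bar> \<le> 3 * \<epsilon>"
      using core True by (auto simp: core_def abs_le_iff)
    then have "snd z \<in> S" using core by (auto simp: S_def strip_set_def core_def)
    moreover have "fst z \<in> {\<phi>3 (snd z) - \<epsilon>..\<phi>3 (snd z) + \<epsilon>}" using core by (auto simp: core_def abs_le_iff)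
    ultimately show ?thesis by (simp add: chi_def)
  qed (simp add: chi_def)
  define w where "w \<xi> = wt \<kappa> (\<bar>cross2 (snd x) \<xi>\<bar> / L)" for \<xi>
  have [measurable]: "w \<in> borel_measurable borel" unfolding w_def by measurable
  have "(\<integral>\<^sup>+z. chi x (- x - z) z * wt \<kappa> (sep x z) \<partial>lborel)
    \<le> (\<integral>\<^sup>+z. (indicator S (snd z) * w (snd z)) * indicator {- \<epsilon>..\<epsilon>} (fst z - \<phi>3 (snd z)) \<partial>lborel)"
  proof (rule nn_integral_mono)
    fix z
    have "chi x (- x - z) z * wt \<kappa> (sep x z) \<le> (indicator S (snd z) * indicator {\<phi>3 (snd z) - \<epsilon>..\<phi>3 (snd z) + \<epsilon>} (fst z)) * wt \<kappa> (sep x z)"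
      using le by (rule mult_right_mono) simp
    also have "\<dots> = (indicator S (snd z) * w (snd z)) * indicator {- \<epsilon>..\<epsilon>} (fst z - \<phi>3 (snd z))"
      by (auto simp: w_def sep_def indicator_def)
    finally show "chi x (- x - z) z * wt \<kappa> (sep x z) \<le> (indicator S (snd z) * w (snd z)) * indicator {- \<epsilon>..\<epsilon>} (fst z - \<phi>3 (snd z))" .
  qed
  also have "\<dots> = (\<integral>\<^sup>+\<xi>. \<integral>\<^sup>+\<tau>. (indicator S \<xi> * w \<xi>) * indicator {- \<epsilon>..\<epsilon>} (\<tau> - \<phi>3 \<xi>) \<partial>lborel \<partial>lborel)"
    unfolding lborel_prod[where 'a=real and 'b="real^2", symmetric]
    by (subst lborel_pair.nn_integral_snd[symmetric]) simp_all
  also have "\<dots> = (\<integral>\<^sup>+\<xi>. (indicator S \<xi> * w \<xi>) * ennreal (2 * \<epsilon>) \<partial>lborel)"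
  proof (rule nn_integral_cong)
    fix \<xi>
    have "(\<integral>\<^sup>+\<tau>. (indicator S \<xi> * w \<xi>) * indicator {- \<epsilon>..\<epsilon>} (\<tau> - \<phi>3 \<xi>) \<partial>lborel)
      = (\<integral>\<^sup>+\<tau>. (indicator S \<xi> * w \<xi>) * indicator {\<phi>3 \<xi> - \<epsilon>..\<phi>3 \<xi> + \<epsilon>} \<tau> \<partial>lborel)"
      by (intro nn_integral_cong) (auto simp: indicator_def)
    also have "\<dots> = (indicator S \<xi> * w \<xi>) * ennreal (2 * \<epsilon>)"
      using \<epsilon> by (subst nn_integral_cmult_indicator) simp_all
    finally show "(\<integral>\<^sup>+\<tau>. (indicator S \<xi> * w \<xi>) * indicator {- \<epsilon>..\<epsilon>} (\<tau> - \<phi>3 \<xi>) \<partial>lborel) = (indicator S \<xi> * w \<xi>) * ennreal (2 * \<epsilon>)" .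
  qed
  also have "\<dots> = (\<integral>\<^sup>+\<xi>. indicator S \<xi> * w \<xi> \<partial>lborel) * ennreal (2 * \<epsilon>)"
    by (rule nn_integral_multc) measurable
  also have "\<dots> \<le> ennreal (C0 * \<epsilon> * L / (1 - \<kappa>)) * ennreal (2 * \<epsilon>)"
    using strip[OF \<kappa>, of "snd x" "\<phi>1 (snd x)"] True by (intro mult_right_mono) (auto simp: S_def w_def)
  also have "\<dots> = ennreal (2 * C0 * \<epsilon>\<^sup>2 * L / (1 - \<kappa>))"
    using C0 \<epsilon> L \<kappa> by (simp add: power2_eq_square mult_ac flip: ennreal_mult)
  finally show ?thesis .
qed

text \<open>While only the direction of \<open>z\<close> turns, \<open>fst y + fst z\<close> stays
  constant, and the condition on the first variable says that its frequency lies in the shell. As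
  the frequencies sum to zero, the cross product of the first and third is, up to sign, that of the
  second and third.\<close>

lemma core_angle:
  "(circ (\<lambda>\<theta>. (chi (- y - rotz \<theta> z) y (rotz \<theta> z) * ennreal (sep (- y - rotz \<theta> z) (rotz \<theta> z)))))
    \<le> ennreal (8 * B * \<epsilon> / L)"
proof -
  define t where "t = fst y + fst z"
  have "(circ (\<lambda>\<theta>. (chi (- y - rotz \<theta> z) y (rotz \<theta> z) * ennreal (sep (- y - rotz \<theta> z) (rotz \<theta> z)))))
    \<le> (\<integral>\<^sup>+\<theta>. ennreal (1 / L) * ((ennreal \<bar>cross2 (snd y) (rot \<theta> (snd z))\<bar> * indicator (p1.shell A t \<epsilon>) (- snd y - rot \<theta> (snd z))) * indicator {0..<2*pi} \<theta>) \<partial>lborel)"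
  proof (rule nn_integral_mono)
    fix \<theta> :: real
    have "cross2 (- snd y - rot \<theta> (snd z)) (rot \<theta> (snd z)) = - cross2 (snd y) (rot \<theta> (snd z))"
      by (simp add: cross2_def algebra_simps)
    then have "sep (- y - rotz \<theta> z) (rotz \<theta> z) = (1 / L) * \<bar>cross2 (snd y) (rot \<theta> (snd z))\<bar>"
      by (simp add: sep_def)
    moreover have "ennreal ((1 / L) * q) = ennreal (1 / L) * ennreal q" for q
      by (rule ennreal_mult') (use L in simp)
    ultimately have s: "ennreal (sep (- y - rotz \<theta> z) (rotz \<theta> z)) = ennreal (1 / L) * ennreal \<bar>cross2 (snd y) (rot \<theta> (snd z))\<bar>"
      by (simp only:)
    have "chi (- y - rotz \<theta> z) y (rotz \<theta> z) \<le> indicator (p1.shell A t \<epsilon>) (- snd y - rot \<theta> (snd z))"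
      by (auto simp: chi_def core_def p1.shell_def t_def abs_le_iff indicator_def)
    then have "chi (- y - rotz \<theta> z) y (rotz \<theta> z) * (ennreal (1 / L) * ennreal \<bar>cross2 (snd y) (rot \<theta> (snd z))\<bar>) * indicator {0..<2*pi} \<theta>
      \<le> indicator (p1.shell A t \<epsilon>) (- snd y - rot \<theta> (snd z)) * (ennreal (1 / L) * ennreal \<bar>cross2 (snd y) (rot \<theta> (snd z))\<bar>) * indicator {0..<2*pi} \<theta>"
      by (intro mult_right_mono) auto
    then show "(chi (- y - rotz \<theta> z) y (rotz \<theta> z) * ennreal (sep (- y - rotz \<theta> z) (rotz \<theta> z))) * indicator {0..<2*pi} \<theta>
      \<le> ennreal (1 / L) * ((ennreal \<bar>cross2 (snd y) (rot \<theta> (snd z))\<bar> * indicator (p1.shell A t \<epsilon>) (- snd y - rot \<theta> (snd z))) * indicator {0..<2*pi} \<theta>)"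
      unfolding s by (simp only: mult_ac)
  qed
  also have "\<dots> = ennreal (1 / L) * (circ (\<lambda>\<theta>. (ennreal \<bar>cross2 (snd y) (rot \<theta> (snd z))\<bar> * indicator (p1.shell A t \<epsilon>) (- snd y - rot \<theta> (snd z)))))"
    by (rule nn_integral_cmult) measurable
  also have "\<dots> \<le> ennreal (1 / L) * ennreal (8 * B * \<epsilon>)"
    using A B \<epsilon> lower by (intro mult_left_mono p1.angle_bound) auto
  also have "\<dots> = ennreal (8 * B * \<epsilon> / L)"
    using B \<epsilon> L by (simp flip: ennreal_mult)
  finally show ?thesis .
qed

lemma chi_power2: "(chi x y z)\<^sup>2 = chi x y z"
  by (simp add: chi_def)

lemma meas3_core:
  "meas3 (\<lambda>x y z. chi x y z * wt \<gamma> (sep x z))" "meas3 (\<lambda>x y z. chi x y z * ennreal (sep x z powr \<gamma>))"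
  "meas3 (\<lambda>x y z. chi x y z * ennreal (sqrt (sep x z)))" "meas3 chi"
  unfolding meas3_def by measurable

text \<open>Squaring the weight doubles its exponent, and 2\<gamma> \<le> 1/2 keeps 1/(1 -
  2\<gamma>) at most 2.\<close>

lemma trilinear_L2:
  assumes [measurable]: "h1 \<in> borel_measurable borel" "h2 \<in> borel_measurable borel" "h3 \<in> borel_measurable borel"
    and \<gamma>: "0 \<le> \<gamma>" "\<gamma> \<le> 1 / 4"
  shows "(tri (\<lambda>x y z. h1 x * h2 y * h3 z * (chi x y z * wt \<gamma> (sep x z))))\<^sup>2
    \<le> ennreal (4 * C0 * \<epsilon>\<^sup>2 * L) * (n2 h1 * n2 h2 * n2 h3)"
  unfolding n2_def
proof (rule tri_bound_fixed)
  fix x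
  have "(\<integral>\<^sup>+z. (chi x (- x - z) z * wt \<gamma> (sep x z))\<^sup>2 \<partial>lborel) \<le> ennreal (2 * C0 * \<epsilon>\<^sup>2 * L / (1 - 2 * \<gamma>))"
    using core_strip[of "2 * \<gamma>" x] \<gamma> by (simp add: power_mult_distrib chi_power2 wt_power2)
  also have "\<dots> \<le> ennreal (4 * C0 * \<epsilon>\<^sup>2 * L)"
  proof (rule ennreal_leI)
    have "2 * C0 * \<epsilon>\<^sup>2 * L * 1 \<le> 2 * C0 * \<epsilon>\<^sup>2 * L * (2 * (1 - 2 * \<gamma>))"
      using C0 L \<gamma> by (intro mult_left_mono) auto
    then show "2 * C0 * \<epsilon>\<^sup>2 * L / (1 - 2 * \<gamma>) \<le> 4 * C0 * \<epsilon>\<^sup>2 * L"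
      using \<gamma> by (simp add: pos_divide_le_eq algebra_simps)
  qed
  finally show "(\<integral>\<^sup>+z. (chi x (- x - z) z * wt \<gamma> (sep x z))\<^sup>2 \<partial>lborel) \<le> ennreal (4 * C0 * \<epsilon>\<^sup>2 * L)" .
qed (simp_all add: meas3_core)

text \<open>The weight factors as sqrt s times s^(-k) with k = (1 - 1/p)/2. The square of the first
  factor is the angular Jacobian; that of the second has exponent 1 - 1/p, and its strip integral
  costs p. The factors \<open>L\<close> and \<open>1 / L\<close> of the two bounds cancel, so no
  power of the third frequency remains.\<close>

lemma trilinear_radial:
  assumes [measurable]: "h1 \<in> borel_measurable borel" "h2 \<in> borel_measurable borel" "h3 \<in> borel_measurable borel"
    and h3: "\<And>\<theta> z. h3 (rotz \<theta> z) = h3 z"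
    and p: "2 \<le> p"
  shows "(tri (\<lambda>x y z. h1 x * h2 y * h3 z * (chi x y z * ennreal (sep x z powr (1 / (2 * p))))))\<^sup>2
    \<le> ennreal (16 * B * C0 * p * \<epsilon> ^ 3) * (n2 h1 * n2 h2 * n2 h3)"
proof -
  define k where "k = (1 - 1 / p) / 2"
  have k2: "2 * k = 1 - 1 / p" by (simp add: k_def)
  have k: "0 \<le> 2 * k" "2 * k < 1" "1 - 2 * k = 1 / p" unfolding k2 using p by simp_all
  have "tri (\<lambda>x y z. h1 x * h2 y * h3 z * (chi x y z * ennreal (sep x z powr (1 / (2 * p)))))
    \<le> tri (\<lambda>x y z. h1 x * h2 y * h3 z * ((chi x y z * ennreal (sqrt (sep x z))) * (chi x y z * wt k (sep x z))))"
  proof (intro tri_mono mult_left_mono)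
    fix x y z
    have "ennreal (sep x z powr (1 / (2 * p))) \<le> ennreal (sqrt (sep x z)) * wt k (sep x z)"
    proof (cases "sep x z = 0")
      case False
      then have s: "0 < sep x z" using sep_nonneg[of x z] by simp
      have "sqrt (sep x z) * sep x z powr (- k) = sep x z powr (1 / (2 * p))"
      proof -
        have "1 / 2 + - k = 1 / (2 * p)" using p by (simp add: k_def field_simps)
        then show ?thesis using s by (simp add: powr_half_sqrt[symmetric] powr_add[symmetric])
      qed
      then show ?thesis using s by (simp add: wt_def flip: ennreal_mult)
    qed simp
    then show "chi x y z * ennreal (sep x z powr (1 / (2 * p)))
      \<le> (chi x y z * ennreal (sqrt (sep x z))) * (chi x y z * wt k (sep x z))"
      by (simp add: chi_def)
  qed simp
  then have "(tri (\<lambda>x y z. h1 x * h2 y * h3 z * (chi x y z * ennreal (sep x z powr (1 / (2 * p))))))\<^sup>2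
    \<le> (tri (\<lambda>x y z. h1 x * h2 y * h3 z * ((chi x y z * ennreal (sqrt (sep x z))) * (chi x y z * wt k (sep x z)))))\<^sup>2"
    by (rule power_mono) simp
  also have "\<dots> \<le> ennreal (2 * C0 * \<epsilon>\<^sup>2 * L * p) * ennreal (8 * B * \<epsilon> / L) * (n2 h1 * n2 h2 * n2 h3)"
    unfolding n2_def
  proof (rule tri_bound_radial)
    fix x
    have "(\<integral>\<^sup>+z. (chi x (- x - z) z * wt k (sep x z))\<^sup>2 \<partial>lborel) \<le> ennreal (2 * C0 * \<epsilon>\<^sup>2 * L / (1 - 2 * k))"
      using core_strip[OF k(1,2), of x] by (simp only: power_mult_distrib chi_power2 wt_power2)
    also have "2 * C0 * \<epsilon>\<^sup>2 * L / (1 - 2 * k) = 2 * C0 * \<epsilon>\<^sup>2 * L * p"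
      unfolding k(3) by simp
    finally show "(\<integral>\<^sup>+z. (chi x (- x - z) z * wt k (sep x z))\<^sup>2 \<partial>lborel) \<le> ennreal (2 * C0 * \<epsilon>\<^sup>2 * L * p)" .
  next
    fix y z
    have "(ennreal (sqrt s))\<^sup>2 = ennreal s" if "0 \<le> s" for s
      using that by (simp add: ennreal_power)
    then show "(circ (\<lambda>\<theta>. (chi (- y - rotz \<theta> z) y (rotz \<theta> z) * ennreal (sqrt (sep (- y - rotz \<theta> z) (rotz \<theta> z))))\<^sup>2))
      \<le> ennreal (8 * B * \<epsilon> / L)"
      using core_angle[of y z] by (simp add: power_mult_distrib chi_power2 sep_nonneg)
  qed (simp_all add: meas3_core h3)
  also have "ennreal (2 * C0 * \<epsilon>\<^sup>2 * L * p) * ennreal (8 * B * \<epsilon> / L) = ennreal (16 * B * C0 * p * \<epsilon> ^ 3)"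
    using C0 L p B \<epsilon> by (simp add: power2_eq_square power3_eq_cube field_simps flip: ennreal_mult)
  finally show ?thesis .
qed

lemma n2_radialize: "h \<in> borel_measurable borel \<Longrightarrow> n2 (radialize h) = ennreal (2 * pi) * n2 h"
  unfolding n2_def by (rule nn_integral_radialize)

text \<open>Averaging the form puts 2 pi on the left before squaring, and two radialized functions
  put (2 pi)^2 on the right, so the factors match exactly.\<close>

lemma radialize_cancel:
  assumes "ennreal (2 * pi) * t \<le> u" and "u\<^sup>2 \<le> K * (ennreal (2 * pi) * n * (ennreal (2 * pi) * m))"
  shows "t\<^sup>2 \<le> K * (n * m)"
proof -
  have "(ennreal (2 * pi))\<^sup>2 * t\<^sup>2 \<le> u\<^sup>2"
    using power_mono[OF assms(1), of 2] by (simp add: power_mult_distrib)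
  also have "\<dots> \<le> (ennreal (2 * pi))\<^sup>2 * (K * (n * m))"
    using assms(2) by (simp add: power2_eq_square mult_ac)
  finally show ?thesis
    by (subst (asm) ennreal_mult_le_mult_iff) (simp_all add: ennreal_power)
qed

text \<open>Invariance of \<open>h1\<close> allows the other two functions to be radialized, and
  this provides the invariant third function that \<open>trilinear_radial\<close> asks for.\<close>

lemma trilinear_sup_x:
  assumes [measurable]: "h1 \<in> borel_measurable borel" "h2 \<in> borel_measurable borel" "h3 \<in> borel_measurable borel"
    and h1: "\<And>\<theta> z. h1 (rotz \<theta> z) = h1 z" and p: "2 \<le> p"
  shows "(tri (\<lambda>x y z. h1 x * h2 y * h3 z * (chi x y z * ennreal (sep x z powr (1 / (2 * p))))))\<^sup>2
    \<le> ennreal (16 * B * C0 * p * \<epsilon> ^ 3) * n2 h1 * (n2 h2 * n2 h3)"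
proof (rule radialize_cancel)
  show "ennreal (2 * pi) * tri (\<lambda>x y z. h1 x * h2 y * h3 z * (chi x y z * ennreal (sep x z powr (1 / (2 * p)))))
    \<le> tri (\<lambda>x y z. h1 x * radialize h2 y * radialize h3 z * (chi x y z * ennreal (sep x z powr (1 / (2 * p)))))"
    by (rule tri_radialize) (simp_all add: meas3_core h1 chi_rotz sep_rotz)
  have "(tri (\<lambda>x y z. h1 x * radialize h2 y * radialize h3 z * (chi x y z * ennreal (sep x z powr (1 / (2 * p))))))\<^sup>2
    \<le> ennreal (16 * B * C0 * p * \<epsilon> ^ 3) * (n2 h1 * n2 (radialize h2) * n2 (radialize h3))"
    by (rule trilinear_radial) (simp_all add: p radialize_rotz)
  then show "(tri (\<lambda>x y z. h1 x * radialize h2 y * radialize h3 z * (chi x y z * ennreal (sep x z powr (1 / (2 * p))))))\<^sup>2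
    \<le> ennreal (16 * B * C0 * p * \<epsilon> ^ 3) * n2 h1 * (ennreal (2 * pi) * n2 h2 * (ennreal (2 * pi) * n2 h3))"
    by (simp add: n2_radialize mult_ac)
qed

text \<open>The invariant function now stands in the second slot. Radialization is carried out with
  the first two slots exchanged, while the weighted bound is applied in the original order.\<close>

lemma trilinear_sup_y:
  assumes [measurable]: "h1 \<in> borel_measurable borel" "h2 \<in> borel_measurable borel" "h3 \<in> borel_measurable borel"
    and h2: "\<And>\<theta> z. h2 (rotz \<theta> z) = h2 z" and p: "2 \<le> p"
  shows "(tri (\<lambda>x y z. h1 x * h2 y * h3 z * (chi x y z * ennreal (sep x z powr (1 / (2 * p))))))\<^sup>2
    \<le> ennreal (16 * B * C0 * p * \<epsilon> ^ 3) * n2 h2 * (n2 h1 * n2 h3)"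
proof (rule radialize_cancel)
  let ?w = "\<lambda>x y z. chi x y z * ennreal (sep x z powr (1 / (2 * p)))"
  have m1: "meas3 (\<lambda>x y z. h1 x * h2 y * h3 z * ?w x y z)"
    and m2: "meas3 (\<lambda>x y z. radialize h1 x * h2 y * radialize h3 z * ?w x y z)"
    and m3: "meas3 (\<lambda>x y z. ?w y x z)"
    unfolding meas3_def by measurable
  have "ennreal (2 * pi) * tri (\<lambda>x y z. h2 x * h1 y * h3 z * ?w y x z)
    \<le> tri (\<lambda>x y z. h2 x * radialize h1 y * radialize h3 z * ?w y x z)"
    by (rule tri_radialize) (simp_all add: m3 h2 chi_rotz sep_rotz)
  then show "ennreal (2 * pi) * tri (\<lambda>x y z. h1 x * h2 y * h3 z * ?w x y z)
    \<le> tri (\<lambda>x y z. radialize h1 x * h2 y * radialize h3 z * ?w x y z)"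
    using tri_swap[OF m1] tri_swap[OF m2] by (simp add: mult_ac)
  have "(tri (\<lambda>x y z. radialize h1 x * h2 y * radialize h3 z * ?w x y z))\<^sup>2
    \<le> ennreal (16 * B * C0 * p * \<epsilon> ^ 3) * (n2 (radialize h1) * n2 h2 * n2 (radialize h3))"
    by (rule trilinear_radial) (simp_all add: p radialize_rotz)
  then show "(tri (\<lambda>x y z. radialize h1 x * h2 y * radialize h3 z * ?w x y z))\<^sup>2
    \<le> ennreal (16 * B * C0 * p * \<epsilon> ^ 3) * n2 h2 * (ennreal (2 * pi) * n2 h1 * (ennreal (2 * pi) * n2 h3))"
    by (simp add: n2_radialize mult_ac)
qed

end

section \<open>Pointwise splitting between the L^2 bound and the radial bound\<close>

section \<open>Interpolation in the angular variable\<close>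

text \<open>Let Y be the second term. If f > Y, write f = f^(p/2) f^(1 - p/2). Since 1 - p/2 \<le>
  0, replacing the second factor by Y^(1 - p/2) can only enlarge the product, and the result is
  exactly the first term. The free parameter \<open>l\<close> balances the two bounds.\<close>

lemma interpolation_pointwise:
  fixes f a s l p :: real
  assumes p: "2 \<le> p" and pos: "0 < f" "0 < a" "0 < s" "0 < l"
  shows "f \<le> l powr (2 / p - 1) * (a powr (1 - p / 2) * f powr (p / 2) * s powr (- ((1 - 2 / p) / 4)))
    + l powr (2 / p) * (a * s powr (1 / (2 * p)))"
proof (cases "f \<le> l powr (2 / p) * (a * s powr (1 / (2 * p)))")
  case True
  moreover have "0 \<le> l powr (2 / p - 1) * (a powr (1 - p / 2) * f powr (p / 2) * s powr (- ((1 - 2 / p) / 4)))" by simp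
  ultimately show ?thesis by linarith
next
  case False
  define Y where "Y = l powr (2 / p) * (a * s powr (1 / (2 * p)))"
  have Y: "0 < Y" "Y \<le> f" using False pos by (auto simp: Y_def)
  have "Y powr (1 - p / 2) = l powr (2 / p * (1 - p / 2)) * (a powr (1 - p / 2) * s powr (1 / (2 * p) * (1 - p / 2)))"
    unfolding Y_def using pos by (simp add: powr_mult powr_powr)
  also have "2 / p * (1 - p / 2) = 2 / p - 1" using p by (simp add: field_simps)
  also have "1 / (2 * p) * (1 - p / 2) = - ((1 - 2 / p) / 4)" using p by (simp add: field_simps)
  finally have Yp: "Y powr (1 - p / 2) = l powr (2 / p - 1) * (a powr (1 - p / 2) * s powr (- ((1 - 2 / p) / 4)))" .
  have "f powr (1 - p / 2) \<le> Y powr (1 - p / 2)" using Y p by (intro powr_mono2') auto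
  then have "f powr (p / 2) * f powr (1 - p / 2) \<le> f powr (p / 2) * Y powr (1 - p / 2)"
    by (rule mult_left_mono) simp
  moreover have "f powr (p / 2) * f powr (1 - p / 2) = f" using pos by (simp flip: powr_add)
  ultimately have "f \<le> f powr (p / 2) * Y powr (1 - p / 2)" by simp
  also have "\<dots> = l powr (2 / p - 1) * (a powr (1 - p / 2) * f powr (p / 2) * s powr (- ((1 - 2 / p) / 4)))"
    unfolding Yp by (simp only: mult_ac)
  finally show ?thesis using Y(1) by (simp add: Y_def)
qed

definition angular :: "(pt \<Rightarrow> real) \<Rightarrow> real \<Rightarrow> pt \<Rightarrow> ennreal" where
  "angular f p x = (circ (\<lambda>\<theta>. ennreal (f (rotz \<theta> x) powr p)))"

definition angular_norm :: "(pt \<Rightarrow> real) \<Rightarrow> real \<Rightarrow> pt \<Rightarrow> ennreal" where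
  "angular_norm f p x = ennreal_powr (angular f p x) (1 / p)"

text \<open>With \<open>A\<close> the \<open>L\<^sup>p\<close> norm of \<open>f\<close> over rotations, this is \<open>A\<^bsup>1-p/2\<^esup> f\<^bsup>p/2\<^esup>\<close>; the value infinity
  for degenerate \<open>A\<close> keeps the pointwise interpolation inequality valid everywhere.\<close>

definition angular_profile :: "(pt \<Rightarrow> real) \<Rightarrow> real \<Rightarrow> pt \<Rightarrow> ennreal" where
  "angular_profile f p x = (if angular f p x = 0 \<or> angular f p x = \<infinity> then \<infinity>
     else ennreal (enn2real (angular f p x) powr ((1 - p / 2) / p))) * ennreal (f x powr (p / 2))"

lemma ennreal_powr_measurable [measurable]:
  assumes [measurable]: "f \<in> borel_measurable M"
  shows "(\<lambda>x. ennreal_powr (f x) a) \<in> borel_measurable M"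
  unfolding ennreal_powr_def by measurable

lemma angular_measurable [measurable]:
  assumes [measurable]: "f \<in> borel_measurable borel"
  shows "angular f p \<in> borel_measurable borel"
  unfolding angular_def[abs_def] by (rule nn_integral_angle_measurable) measurable

lemma angular_norm_measurable [measurable]:
  assumes [measurable]: "f \<in> borel_measurable borel"
  shows "angular_norm f p \<in> borel_measurable borel"
  unfolding angular_norm_def[abs_def] by measurable

lemma angular_profile_measurable [measurable]:
  assumes [measurable]: "f \<in> borel_measurable borel"
  shows "angular_profile f p \<in> borel_measurable borel"
  unfolding angular_profile_def[abs_def] by measurable

lemma angular_rotz:
  assumes [measurable]: "f \<in> borel_measurable borel"
  shows "angular f p (rotz \<theta> x) = angular f p x"
  unfolding angular_def using nn_integral_rotz_angle_rotz[of "\<lambda>x. ennreal (f x powr p)"] by simp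

lemma angular_norm_rotz:
  assumes [measurable]: "f \<in> borel_measurable borel"
  shows "angular_norm f p (rotz \<theta> x) = angular_norm f p x"
  by (simp add: angular_norm_def angular_rotz)

text \<open>Averaging over rotations turns f^p into A^p, with A the angular norm, and A^(2-p) A^p =
  A^2. The infinite default does no harm: for A = 0 it is multiplied by the vanishing angular
  integral, and for infinite A the right-hand side is infinite as well.\<close>

lemma n2_angular_profile:
  assumes [measurable]: "f \<in> borel_measurable borel" and f: "\<And>x. 0 \<le> f x" and p: "2 \<le> p"
  shows "n2 (angular_profile f p) \<le> n2 (angular_norm f p)"
proof -
  define D where "D a = (if a = 0 \<or> a = \<infinity> then \<infinity> else ennreal (enn2real a powr ((1 - p / 2) / p)))" for a
  have [measurable]: "(\<lambda>x. (angular_profile f p x)\<^sup>2) \<in> borel_measurable borel" by measurable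
  have prof: "(angular_profile f p (rotz \<theta> x))\<^sup>2 = (D (angular f p x))\<^sup>2 * ennreal (f (rotz \<theta> x) powr p)" for \<theta> x
  proof -
    have "(f y powr (p / 2))\<^sup>2 = f y powr p" for y
      by (simp add: power2_eq_square flip: powr_add)
    then show ?thesis
      by (simp add: angular_profile_def D_def angular_rotz power_mult_distrib ennreal_power del: ennreal_top_mult)
  qed
  have D: "(D a)\<^sup>2 * a \<le> (ennreal_powr a (1 / p))\<^sup>2" for a
  proof (cases a)
    case (real r)
    show ?thesis
    proof (cases "r = 0")
      case False
      have sq: "(r powr e)\<^sup>2 * r = r powr (e + e + 1)" for e
        unfolding powr_add power2_eq_square using real by simp
      have "(r powr ((1 - p / 2) / p))\<^sup>2 * r = r powr ((1 - p / 2) / p + (1 - p / 2) / p + 1)" by (rule sq)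
      also have "(1 - p / 2) / p + (1 - p / 2) / p + 1 = 1 / p + 1 / p" using p by (simp add: field_simps)
      also have "r powr (1 / p + 1 / p) = (r powr (1 / p))\<^sup>2" by (simp only: powr_add power2_eq_square)
      finally have "(r powr ((1 - p / 2) / p))\<^sup>2 * r = (r powr (1 / p))\<^sup>2" .
      then show ?thesis using real False by (simp add: D_def ennreal_powr_def ennreal_power flip: ennreal_mult)
    qed (use real in simp)
  qed (simp add: ennreal_powr_def)
  have "n2 (angular_profile f p) \<le> ennreal (2 * pi) * n2 (angular_profile f p)"
  proof -
    have "1 \<le> ennreal (2 * pi)" using pi_ge_two by (simp add: ennreal_ge_1)
    then show ?thesis using mult_right_mono[of 1 "ennreal (2 * pi)" "n2 (angular_profile f p)"] by simp
  qed
  also have "\<dots> = (\<integral>\<^sup>+x. circ (\<lambda>\<theta>. (angular_profile f p (rotz \<theta> x))\<^sup>2) \<partial>lborel)"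
    unfolding n2_def by (rule nn_integral_rotz_average[symmetric]) measurable
  also have "\<dots> = (\<integral>\<^sup>+x. (D (angular f p x))\<^sup>2 * angular f p x \<partial>lborel)"
    unfolding prof mult.assoc angular_def by (intro nn_integral_cong nn_integral_cmult) measurable
  also have "\<dots> \<le> n2 (angular_norm f p)"
    unfolding n2_def angular_norm_def using D by (intro nn_integral_mono) auto
  finally show ?thesis .
qed

text \<open>If f x > 0 and the angular norm is zero or infinite, or s = 0, the first term on the
  right is infinite. All other cases with f x > 0 are the real inequality
  \<open>interpolation_pointwise\<close>.\<close>

lemma angular_interpolation:
  assumes f: "0 \<le> f x" and p: "2 \<le> p" and l: "0 < l" and s: "0 \<le> s"
  shows "ennreal (f x) \<le> ennreal (l powr (2 / p - 1)) * (angular_profile f p x * wt ((1 - 2 / p) / 4) s)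
    + ennreal (l powr (2 / p)) * (angular_norm f p x * ennreal (s powr (1 / (2 * p))))"
proof (cases "f x = 0")
  case False
  then have f0: "0 < f x" using f by simp
  show ?thesis
  proof (cases "angular f p x = 0 \<or> angular f p x = \<infinity> \<or> s = 0")
    case True
    have "angular_profile f p x * wt ((1 - 2 / p) / 4) s = \<infinity>"
    proof (cases "angular f p x = 0 \<or> angular f p x = \<infinity>")
      case True
      then have "angular_profile f p x = \<infinity>" using f0 by (simp add: angular_profile_def ennreal_mult_eq_top_iff)
      moreover have "wt ((1 - 2 / p) / 4) s \<noteq> 0" by (simp add: wt_def)
      ultimately show ?thesis by (simp add: ennreal_mult_eq_top_iff)
    next
      case False
      then obtain r where r: "angular f p x = ennreal r" "0 < r"
        by (cases "angular f p x") (auto simp: less_le)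
      then have "angular_profile f p x \<noteq> 0" using f0 False
        by (simp add: angular_profile_def)
      moreover have "wt ((1 - 2 / p) / 4) s = \<infinity>" using True False by (simp add: wt_def)
      ultimately show ?thesis by (simp add: ennreal_mult_eq_top_iff)
    qed
    then have "ennreal (l powr (2 / p - 1)) * (angular_profile f p x * wt ((1 - 2 / p) / 4) s) = \<infinity>"
      using l by (simp add: ennreal_mult_eq_top_iff)
    then show ?thesis by simp
  next
    case False
    then obtain r where r: "angular f p x = ennreal r" "0 < r"
      by (cases "angular f p x") (auto simp: less_le)
    define a where "a = r powr (1 / p)"
    have a: "0 < a" using r by (simp add: a_def)
    have ap: "a powr (1 - p / 2) = r powr ((1 - p / 2) / p)" by (simp add: a_def powr_powr)
    have s0: "0 < s" using False s by simp
    have 1: "angular_profile f p x * wt ((1 - 2 / p) / 4) s = ennreal (a powr (1 - p / 2) * f x powr (p / 2) * s powr (- ((1 - 2 / p) / 4)))"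
      using r s0 by (simp add: angular_profile_def wt_def ap flip: ennreal_mult)
    have 2: "angular_norm f p x * ennreal (s powr (1 / (2 * p))) = ennreal (a * s powr (1 / (2 * p)))"
      using r by (simp add: angular_norm_def ennreal_powr_def a_def flip: ennreal_mult)
    have nn: "0 \<le> a powr (1 - p / 2) * f x powr (p / 2) * s powr (- ((1 - 2 / p) / 4))" "0 \<le> a * s powr (1 / (2 * p))"
      using a by simp_all
    have "ennreal (f x) \<le> ennreal (l powr (2 / p - 1) * (a powr (1 - p / 2) * f x powr (p / 2) * s powr (- ((1 - 2 / p) / 4)))
      + l powr (2 / p) * (a * s powr (1 / (2 * p))))"
      by (intro ennreal_leI interpolation_pointwise p f0 a s0 l)
    also have "\<dots> = ennreal (l powr (2 / p - 1)) * ennreal (a powr (1 - p / 2) * f x powr (p / 2) * s powr (- ((1 - 2 / p) / 4)))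
      + ennreal (l powr (2 / p)) * ennreal (a * s powr (1 / (2 * p)))"
      using nn by (subst ennreal_plus) (simp_all only: ennreal_mult powr_ge_zero mult_nonneg_nonneg)
    finally show ?thesis unfolding 1 2 .
  qed
qed simp

lemma le_mult_esqrt:
  assumes "t\<^sup>2 \<le> ennreal (q\<^sup>2) * N" "0 \<le> q"
  shows "t \<le> ennreal q * esqrt N"
  by (rule ennreal_power2_le_imp_le) (use assms in \<open>simp add: power_mult_distrib ennreal_power\<close>)

context trilinear
begin

text \<open>Up to constants the two bounds are \<epsilon> sqrt L and sqrt p \<epsilon>^(3/2). The
  choice of \<open>l\<close> is the quotient of \<epsilon> sqrt L by \<epsilon>^(3/2), which makes
  both terms the same power \<open>R\<close>; 6 is the sum of the numerical factors 2 and 4.\<close>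

lemma combine_bounds:
  assumes p: "2 \<le> p" and l: "l = sqrt L * \<epsilon> powr (- 1 / 2)"
    and T2: "T2\<^sup>2 \<le> ennreal (4 * C0 * \<epsilon>\<^sup>2 * L) * n" and Tinf: "Tinf\<^sup>2 \<le> ennreal (16 * B * C0 * p * \<epsilon> ^ 3) * n"
  shows "ennreal (l powr (2 / p - 1)) * T2 + ennreal (l powr (2 / p)) * Tinf
    \<le> ennreal (6 * sqrt (B * C0 * p) * \<epsilon> powr (3 / 2 - 1 / p) * L powr (1 / p)) * esqrt n"
proof -
  define R where "R = \<epsilon> powr (3 / 2 - 1 / p) * L powr (1 / p)"
  have lp: "l powr e = L powr (e / 2) * \<epsilon> powr (- e / 2)" for e
    using L \<epsilon> unfolding l by (simp add: powr_mult powr_powr powr_half_sqrt[symmetric] mult.commute)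
  have R1: "l powr (2 / p - 1) * (\<epsilon> * sqrt L) = R"
  proof -
    have "l powr (2 / p - 1) * (\<epsilon> * sqrt L) = (L powr ((2 / p - 1) / 2) * L powr (1 / 2)) * (\<epsilon> powr (- (2 / p - 1) / 2) * \<epsilon> powr 1)"
      using L \<epsilon> by (simp add: lp powr_half_sqrt)
    also have "\<dots> = L powr ((2 / p - 1) / 2 + 1 / 2) * \<epsilon> powr (- (2 / p - 1) / 2 + 1)"
      by (simp only: powr_add)
    also have "(2 / p - 1) / 2 + 1 / 2 = 1 / p" using p by (simp add: field_simps)
    also have "- (2 / p - 1) / 2 + 1 = 3 / 2 - 1 / p" using p by (simp add: field_simps)
    finally show ?thesis by (simp add: R_def)
  qed
  have R2: "l powr (2 / p) * \<epsilon> powr (3 / 2) = R"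
  proof -
    have "l powr (2 / p) * \<epsilon> powr (3 / 2) = L powr (2 / p / 2) * \<epsilon> powr (- (2 / p) / 2 + 3 / 2)"
      unfolding lp powr_add by simp
    also have "2 / p / 2 = 1 / p" by simp
    also have "- (2 / p) / 2 + 3 / 2 = 3 / 2 - 1 / p" by simp
    finally show ?thesis by (simp add: R_def)
  qed
  have e3: "(\<epsilon> powr (3 / 2))\<^sup>2 = \<epsilon> ^ 3"
  proof -
    have "(\<epsilon> powr (3 / 2))\<^sup>2 = \<epsilon> powr 3" by (simp add: power2_eq_square flip: powr_add)
    then show ?thesis using \<epsilon> by simp
  qed
  have t2: "T2 \<le> ennreal (2 * sqrt C0 * (\<epsilon> * sqrt L)) * esqrt n"
  proof (rule le_mult_esqrt)
    have "(2 * sqrt C0 * (\<epsilon> * sqrt L))\<^sup>2 = 4 * C0 * \<epsilon>\<^sup>2 * L" using C0 L by (simp add: power_mult_distrib)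
    then show "T2\<^sup>2 \<le> ennreal ((2 * sqrt C0 * (\<epsilon> * sqrt L))\<^sup>2) * n" using T2 by (simp only:)
  qed (use \<epsilon> C0 L in simp)
  have ti: "Tinf \<le> ennreal (4 * sqrt (B * C0 * p) * \<epsilon> powr (3 / 2)) * esqrt n"
  proof (rule le_mult_esqrt)
    have "(4 * sqrt (B * C0 * p) * \<epsilon> powr (3 / 2))\<^sup>2 = 16 * B * C0 * p * \<epsilon> ^ 3"
      using C0 B p by (simp add: power_mult_distrib e3)
    then show "Tinf\<^sup>2 \<le> ennreal ((4 * sqrt (B * C0 * p) * \<epsilon> powr (3 / 2))\<^sup>2) * n" using Tinf by (simp only:)
  qed (use \<epsilon> C0 B p in simp)
  have "ennreal (l powr (2 / p - 1)) * T2 + ennreal (l powr (2 / p)) * Tinf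
    \<le> ennreal (l powr (2 / p - 1)) * (ennreal (2 * sqrt C0 * (\<epsilon> * sqrt L)) * esqrt n)
      + ennreal (l powr (2 / p)) * (ennreal (4 * sqrt (B * C0 * p) * \<epsilon> powr (3 / 2)) * esqrt n)"
    using t2 ti by (intro add_mono mult_left_mono) auto
  also have "\<dots> = (ennreal (l powr (2 / p - 1)) * ennreal (2 * sqrt C0 * (\<epsilon> * sqrt L))
      + ennreal (l powr (2 / p)) * ennreal (4 * sqrt (B * C0 * p) * \<epsilon> powr (3 / 2))) * esqrt n"
    by (simp only: distrib_right mult.assoc)
  also have "ennreal (l powr (2 / p - 1)) * ennreal (2 * sqrt C0 * (\<epsilon> * sqrt L)) = ennreal (2 * sqrt C0 * R)"
    unfolding R1[symmetric] using C0 \<epsilon> L by (simp add: mult_ac flip: ennreal_mult)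
  also have "ennreal (l powr (2 / p)) * ennreal (4 * sqrt (B * C0 * p) * \<epsilon> powr (3 / 2)) = ennreal (4 * sqrt (B * C0 * p) * R)"
    unfolding R2[symmetric] using C0 B p by (simp add: mult_ac flip: ennreal_mult)
  also have "ennreal (2 * sqrt C0 * R) + ennreal (4 * sqrt (B * C0 * p) * R) = ennreal (2 * sqrt C0 * R + 4 * sqrt (B * C0 * p) * R)"
    using C0 B p by (intro ennreal_plus[symmetric]) (simp_all add: R_def)
  also have "\<dots> \<le> ennreal (6 * sqrt (B * C0 * p) * R)"
  proof (rule ennreal_leI)
    have "1 * 1 \<le> B * p" using B p by (intro mult_mono) auto
    then have "1 * C0 \<le> (B * p) * C0" using C0 by (intro mult_right_mono) auto
    then have "sqrt C0 \<le> sqrt (B * C0 * p)" by (simp add: mult_ac)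
    then have "2 * sqrt C0 * R \<le> 2 * sqrt (B * C0 * p) * R"
      by (intro mult_right_mono) (auto simp: R_def)
    then show "2 * sqrt C0 * R + 4 * sqrt (B * C0 * p) * R \<le> 6 * sqrt (B * C0 * p) * R" by linarith
  qed
  finally show ?thesis by (simp add: R_def mult_right_mono mult.assoc)
qed

text \<open>\<open>\<pi>\<close> selects the variable that carries the angular norm, so one argument
  serves both slots; \<open>m\<close> stands for the squared norms of the other two
  functions.\<close>

lemma trilinear_interpolate:
  assumes [measurable]: "f \<in> borel_measurable borel" and f: "\<And>x. 0 \<le> f x" and p: "2 \<le> p"
    and H: "meas3 H" and \<pi>: "\<pi> = (\<lambda>x y. x) \<or> \<pi> = (\<lambda>x y. y)"
    and T2: "(tri (\<lambda>x y z. angular_profile f p (\<pi> x y) * H x y z * (chi x y z * wt ((1 - 2 / p) / 4) (sep x z))))\<^sup>2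
      \<le> ennreal (4 * C0 * \<epsilon>\<^sup>2 * L) * (n2 (angular_profile f p) * m)"
    and Tinf: "(tri (\<lambda>x y z. angular_norm f p (\<pi> x y) * H x y z * (chi x y z * ennreal (sep x z powr (1 / (2 * p))))))\<^sup>2
      \<le> ennreal (16 * B * C0 * p * \<epsilon> ^ 3) * (n2 (angular_norm f p) * m)"
  shows "tri (\<lambda>x y z. ennreal (f (\<pi> x y)) * H x y z * chi x y z)
    \<le> ennreal (6 * sqrt (B * C0 * p) * \<epsilon> powr (3 / 2 - 1 / p) * L powr (1 / p)) * esqrt (n2 (angular_norm f p) * m)"
proof -
  note [measurable (raw)] = meas3D[OF H]
  define l where "l = sqrt L * \<epsilon> powr (- 1 / 2)"
  have l: "0 < l" using L \<epsilon> by (simp add: l_def)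
  have [measurable (raw)]: "(\<lambda>w. \<pi> (u w) (v w)) \<in> borel_measurable N"
    if "u \<in> borel_measurable N" "v \<in> borel_measurable N" for u v and N :: "'z measure"
    using \<pi> that by auto
  let ?F2 = "\<lambda>x y z. angular_profile f p (\<pi> x y) * H x y z * (chi x y z * wt ((1 - 2 / p) / 4) (sep x z))"
  let ?Finf = "\<lambda>x y z. angular_norm f p (\<pi> x y) * H x y z * (chi x y z * ennreal (sep x z powr (1 / (2 * p))))"
  have m: "meas3 ?F2" "meas3 ?Finf" unfolding meas3_def by measurable
  then have m': "meas3 (\<lambda>x y z. ennreal u * ?F2 x y z)" "meas3 (\<lambda>x y z. ennreal u * ?Finf x y z)" for u
    unfolding meas3_def by measurable
  have "tri (\<lambda>x y z. ennreal (f (\<pi> x y)) * H x y z * chi x y z)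
    \<le> tri (\<lambda>x y z. ennreal (l powr (2 / p - 1)) * ?F2 x y z + ennreal (l powr (2 / p)) * ?Finf x y z)"
  proof (rule tri_mono)
    fix x y z
    have "ennreal (f (\<pi> x y)) * (H x y z * chi x y z) \<le> (ennreal (l powr (2 / p - 1)) * (angular_profile f p (\<pi> x y) * wt ((1 - 2 / p) / 4) (sep x z))
      + ennreal (l powr (2 / p)) * (angular_norm f p (\<pi> x y) * ennreal (sep x z powr (1 / (2 * p))))) * (H x y z * chi x y z)"
      by (intro mult_right_mono angular_interpolation f p l sep_nonneg) simp
    then show "ennreal (f (\<pi> x y)) * H x y z * chi x y z \<le> ennreal (l powr (2 / p - 1)) * ?F2 x y z + ennreal (l powr (2 / p)) * ?Finf x y z"
      by (simp only: mult_ac distrib_left distrib_right)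
  qed
  also have "\<dots> = ennreal (l powr (2 / p - 1)) * tri ?F2 + ennreal (l powr (2 / p)) * tri ?Finf"
    unfolding tri_add[OF m'] tri_cmult[OF m(1)] tri_cmult[OF m(2)] ..
  also have "\<dots> \<le> ennreal (6 * sqrt (B * C0 * p) * \<epsilon> powr (3 / 2 - 1 / p) * L powr (1 / p)) * esqrt (n2 (angular_norm f p) * m)"
  proof (rule combine_bounds[OF p l_def _ Tinf])
    show "(tri ?F2)\<^sup>2 \<le> ennreal (4 * C0 * \<epsilon>\<^sup>2 * L) * (n2 (angular_norm f p) * m)"
      using T2 by (rule order_trans) (intro mult_left_mono mult_right_mono n2_angular_profile f p; simp)
  qed
  finally show ?thesis .
qed

lemma exponent_bounds: "2 \<le> p \<Longrightarrow> 0 \<le> (1 - 2 / p) / 4" "2 \<le> p \<Longrightarrow> (1 - 2 / p) / 4 \<le> 1 / (4 :: real)"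
  by simp_all

lemma trilinear_mixed_x:
  assumes [measurable]: "f \<in> borel_measurable borel" "h2 \<in> borel_measurable borel" "h3 \<in> borel_measurable borel"
    and f: "\<And>x. 0 \<le> f x" and p: "2 \<le> p"
  shows "tri (\<lambda>x y z. ennreal (f x) * h2 y * h3 z * chi x y z)
    \<le> ennreal (6 * sqrt (B * C0 * p) * \<epsilon> powr (3 / 2 - 1 / p) * L powr (1 / p)) * esqrt (n2 (angular_norm f p) * n2 h2 * n2 h3)"
proof -
  have H: "meas3 (\<lambda>x y z. h2 y * h3 z)" unfolding meas3_def by measurable
  have "tri (\<lambda>x y z. ennreal (f x) * (h2 y * h3 z) * chi x y z)
    \<le> ennreal (6 * sqrt (B * C0 * p) * \<epsilon> powr (3 / 2 - 1 / p) * L powr (1 / p)) * esqrt (n2 (angular_norm f p) * (n2 h2 * n2 h3))"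
  proof (rule trilinear_interpolate[OF _ f p H, where \<pi>="\<lambda>x y. x"])
    show "(tri (\<lambda>x y z. angular_profile f p x * (h2 y * h3 z) * (chi x y z * wt ((1 - 2 / p) / 4) (sep x z))))\<^sup>2
      \<le> ennreal (4 * C0 * \<epsilon>\<^sup>2 * L) * (n2 (angular_profile f p) * (n2 h2 * n2 h3))"
      unfolding mult.assoc[symmetric, of "angular_profile f p _"] mult.assoc[symmetric, of "n2 (angular_profile f p)"]
      by (rule trilinear_L2[OF _ _ _ exponent_bounds[OF p]]) simp_all
    show "(tri (\<lambda>x y z. angular_norm f p x * (h2 y * h3 z) * (chi x y z * ennreal (sep x z powr (1 / (2 * p))))))\<^sup>2
      \<le> ennreal (16 * B * C0 * p * \<epsilon> ^ 3) * (n2 (angular_norm f p) * (n2 h2 * n2 h3))"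
      unfolding mult.assoc[symmetric, of "angular_norm f p _"] mult.assoc[symmetric, of _ "n2 (angular_norm f p)"]
      by (rule trilinear_sup_x) (simp_all add: p angular_norm_rotz)
  qed simp_all
  then show ?thesis by (simp only: mult.assoc)
qed

text \<open>This is the case in which the fixed frequency does not belong to the function with the
  angular norm. The L^2 bound treats the slots alike; the radial bound is the one that needs
  \<open>trilinear_sup_y\<close>.\<close>

lemma trilinear_mixed_y:
  assumes [measurable]: "h1 \<in> borel_measurable borel" "f \<in> borel_measurable borel" "h3 \<in> borel_measurable borel"
    and f: "\<And>x. 0 \<le> f x" and p: "2 \<le> p"
  shows "tri (\<lambda>x y z. h1 x * ennreal (f y) * h3 z * chi x y z)
    \<le> ennreal (6 * sqrt (B * C0 * p) * \<epsilon> powr (3 / 2 - 1 / p) * L powr (1 / p)) * esqrt (n2 (angular_norm f p) * n2 h1 * n2 h3)"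
proof -
  have H: "meas3 (\<lambda>x y z. h1 x * h3 z)" unfolding meas3_def by measurable
  have comm: "u * (h1 x * h3 z) = h1 x * u * h3 z" for u x z by (simp only: mult_ac)
  have "tri (\<lambda>x y z. ennreal (f y) * (h1 x * h3 z) * chi x y z)
    \<le> ennreal (6 * sqrt (B * C0 * p) * \<epsilon> powr (3 / 2 - 1 / p) * L powr (1 / p)) * esqrt (n2 (angular_norm f p) * (n2 h1 * n2 h3))"
  proof (rule trilinear_interpolate[OF _ f p H, where \<pi>="\<lambda>x y. y"])
    have "(tri (\<lambda>x y z. h1 x * angular_profile f p y * h3 z * (chi x y z * wt ((1 - 2 / p) / 4) (sep x z))))\<^sup>2
      \<le> ennreal (4 * C0 * \<epsilon>\<^sup>2 * L) * (n2 h1 * n2 (angular_profile f p) * n2 h3)"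
      by (rule trilinear_L2[OF _ _ _ exponent_bounds[OF p]]) simp_all
    then show "(tri (\<lambda>x y z. angular_profile f p y * (h1 x * h3 z) * (chi x y z * wt ((1 - 2 / p) / 4) (sep x z))))\<^sup>2
      \<le> ennreal (4 * C0 * \<epsilon>\<^sup>2 * L) * (n2 (angular_profile f p) * (n2 h1 * n2 h3))"
      unfolding comm by (simp only: mult_ac)
    show "(tri (\<lambda>x y z. angular_norm f p y * (h1 x * h3 z) * (chi x y z * ennreal (sep x z powr (1 / (2 * p))))))\<^sup>2
      \<le> ennreal (16 * B * C0 * p * \<epsilon> ^ 3) * (n2 (angular_norm f p) * (n2 h1 * n2 h3))"
      unfolding comm mult.assoc[symmetric, of _ "n2 (angular_norm f p)"]
      by (rule trilinear_sup_y) (simp_all add: p angular_norm_rotz)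
  qed simp_all
  then show ?thesis unfolding comm by (simp only: mult.assoc)
qed

end

section \<open>From Lebesgue measurable functions and polar mixed norms to Borel moduli\<close>

section \<open>Representatives and mixed norms\<close>

lemma AE_nn_integral_0:
  assumes "(\<integral>\<^sup>+x. f x \<partial>M) = 0" "f \<in> borel_measurable M"
  shows "AE x in M. f x = 0"
  using assms by (simp add: nn_integral_0_iff_AE)

text \<open>\<open>grad\<close> is a definite description, so both existence and uniqueness enter:
  the coefficients of the derivative in the orthonormal basis give a gradient, and two gradients
  have a difference orthogonal to itself.\<close>

lemma GDERIV_grad:
  fixes f :: "'a::euclidean_space \<Rightarrow> real"
  assumes "f differentiable (at x)"
  shows "GDERIV f x :> grad f x"
proof -
  obtain D where D: "(f has_derivative D) (at x)" using assms by (auto simp: differentiable_def)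
  have "linear D" using D by (rule has_derivative_linear)
  then have "D v = v \<bullet> (\<Sum>b\<in>Basis. D b *\<^sub>R b)" for v
  proof -
    have "D v = D (\<Sum>b\<in>Basis. (v \<bullet> b) *\<^sub>R b)" by (simp add: euclidean_representation)
    also have "\<dots> = (\<Sum>b\<in>Basis. (v \<bullet> b) * D b)"
      using \<open>linear D\<close> by (simp add: linear_sum linear_cmul)
    finally show ?thesis by (simp add: inner_sum_right mult.commute)
  qed
  then have "D = (\<lambda>v. v \<bullet> (\<Sum>b\<in>Basis. D b *\<^sub>R b))" by (rule ext)
  with D have ex: "GDERIV f x :> (\<Sum>b\<in>Basis. D b *\<^sub>R b)" by (simp add: gderiv_def)
  have uniq: "d = d'" if "GDERIV f x :> d" "GDERIV f x :> d'" for d d'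
  proof -
    have "(\<lambda>h. h \<bullet> d) = (\<lambda>h. h \<bullet> d')"
      using that unfolding gderiv_def by (rule has_derivative_unique)
    then have "(d - d') \<bullet> d = (d - d') \<bullet> d'" by (rule fun_cong)
    then have "(d - d') \<bullet> (d - d') = 0" by (simp add: inner_diff_right)
    then show ?thesis by simp
  qed
  show ?thesis unfolding grad_def by (rule theI[where P="\<lambda>D. GDERIV f x :> D", OF ex]) (rule uniq[OF _ ex])
qed

text \<open>Setting the phase and its gradient to 0 outside the open set \<open>B2\<close> makes
  them Borel on the plane without changing derivatives inside. The Hoelder seminorm is one summand
  of the given norm, and \<open>max M 0\<close> makes the constant nonnegative.\<close>

lemma radial_C1_extend:
  assumes f: "f \<in> C1_holder \<beta> B2" "C1_holder_norm \<beta> B2 f \<le> ennreal M" and rad: "radial_on B2 f"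
    and \<beta>: "0 < \<beta>" "\<beta> \<le> 1"
  shows "radial_C1 (max M 0) \<beta> (\<lambda>x. if x \<in> B2 then f x else 0) (\<lambda>x. if x \<in> B2 then grad f x else 0)"
proof
  have op: "open (B2 :: (real^2) set)" by (simp add: B2_def)
  have diff: "f differentiable (at x)" if "x \<in> B2" for x using f that by (simp add: C1_holder_def)
  have der: "(f has_derivative (\<lambda>v. v \<bullet> grad f x)) (at x)" if "x \<in> B2" for x
    using GDERIV_grad[OF diff[OF that]] by (simp add: gderiv_def)
  show "0 \<le> max M 0" "0 < \<beta>" "\<beta> \<le> 1" using \<beta> by simp_all
  have "continuous_on B2 f"
    using der has_derivative_continuous continuous_at_imp_continuous_on by blast
  then show "(\<lambda>x. if x \<in> B2 then f x else 0) \<in> borel_measurable borel"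
    by (intro borel_measurable_continuous_on_if continuous_intros) simp
  have "continuous_on B2 (grad f)" using f by (simp add: C1_holder_def)
  then show "(\<lambda>x. if x \<in> B2 then grad f x else 0) \<in> borel_measurable borel"
    by (intro borel_measurable_continuous_on_if continuous_intros) simp
  show "((\<lambda>x. if x \<in> B2 then f x else 0) has_derivative (\<lambda>v. v \<bullet> (if x \<in> B2 then grad f x else 0))) (at x)"
    if "x \<in> B2" for x
  proof -
    have "((\<lambda>x. if x \<in> B2 then f x else 0) has_derivative (\<lambda>v. v \<bullet> grad f x)) (at x)"
      by (rule has_derivative_transform_within_open[OF der[OF that] op that]) simp
    then show ?thesis using that by simp
  qed
  show "norm ((if x \<in> B2 then grad f x else 0) - (if y \<in> B2 then grad f y else 0)) \<le> max M 0 * norm (x - y) powr \<beta>"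
    if xy: "x \<in> B2" "y \<in> B2" for x y
  proof (cases "x = y")
    case False
    have "ennreal (norm (grad f x - grad f y) / norm (x - y) powr \<beta>)
      \<le> (SUP (x, y)\<in>{(x, y). x \<in> B2 \<and> y \<in> B2 \<and> x \<noteq> y}. ennreal (norm (grad f x - grad f y) / norm (x - y) powr \<beta>))"
      using xy False by (intro SUP_upper2[of "(x, y)"]) auto
    also have "\<dots> \<le> C1_holder_norm \<beta> B2 f" unfolding C1_holder_norm_def by simp
    also have "\<dots> \<le> ennreal (max M 0)" using f(2) by (rule order_trans) (simp add: ennreal_leI)
    finally have "norm (grad f x - grad f y) / norm (x - y) powr \<beta> \<le> max M 0" by (simp add: ennreal_le_iff)
    then show ?thesis using xy False by (simp add: pos_divide_le_eq)
  qed simp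
  show "(if rot \<theta> x \<in> B2 then f (rot \<theta> x) else 0) = (if x \<in> B2 then f x else 0)" if "x \<in> B2" for x \<theta>
  proof -
    have rx: "rot \<theta> x \<in> B2" using that by (simp add: B2_def)
    then have "f (rot \<theta> x) = f x" using rad that norm_rot unfolding radial_on_def by blast
    then show ?thesis using rx that by simp
  qed
qed

lemma esqrt_mult: "esqrt (a * b) = esqrt a * esqrt b"
  by (rule antisym; rule ennreal_power2_le_imp_le) (simp_all add: power_mult_distrib)

text \<open>In suitable coordinates the preimage of \<open>Z\<close> under each of the three maps is
  \<open>Z\<close> times the whole space, a null set. Functions known only almost everywhere can
  therefore be replaced under the trilinear integral.\<close>

lemma AE_projections:
  assumes Z: "Z \<in> null_sets (lborel :: pt measure)"
  shows "AE w in (lborel :: (pt \<times> pt) measure). fst w \<notin> Z \<and> snd w \<notin> Z \<and> - fst w - snd w \<notin> Z"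
proof -
  have [measurable]: "Z \<in> sets borel" using Z by auto
  have z: "(\<integral>\<^sup>+x. indicator Z x \<partial>lborel) = 0" using Z by (simp add: null_setsD1)
  have m: "meas3 (\<lambda>x y z. indicator Z x)" "meas3 (\<lambda>x y z. indicator Z y)" "meas3 (\<lambda>x y z. indicator Z z)"
    unfolding meas3_def by measurable
  have "tri (\<lambda>x y z. indicator Z y) = 0" "tri (\<lambda>x y z. indicator Z z) = 0"
    by (simp_all add: tri_12[OF m(2)] tri_13[OF m(3)] z)
  moreover have "tri (\<lambda>x y z. indicator Z x) = 0"
    by (simp add: tri_21[OF m(1)] z)
  ultimately have "AE w in (lborel :: (pt \<times> pt) measure). indicator Z (fst w) = (0::ennreal)"
    "AE w in (lborel :: (pt \<times> pt) measure). indicator Z (snd w) = (0::ennreal)"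
    "AE w in (lborel :: (pt \<times> pt) measure). indicator Z (- fst w - snd w) = (0::ennreal)"
    unfolding tri_def by (auto intro!: AE_nn_integral_0)
  then show ?thesis by eventually_elim (auto simp: indicator_eq_0_iff)
qed

text \<open>A non-integrable integrand has integral 0 by default, and then the bound is trivial;
  otherwise the modulus moves inside the integral.\<close>

lemma triple_conv_le:
  fixes f1 f2 f3 :: "pt \<Rightarrow> complex"
  assumes Z: "Z \<in> null_sets lborel"
    and k: "\<And>x. x \<notin> Z \<Longrightarrow> cmod (f1 x) = k1 x" "\<And>x. x \<notin> Z \<Longrightarrow> cmod (f2 x) = k2 x" "\<And>x. x \<notin> Z \<Longrightarrow> cmod (f3 x) = k3 x"
  shows "ennreal (cmod (triple_conv_0 f1 f2 f3)) \<le> tri (\<lambda>x y z. ennreal (k1 x) * ennreal (k2 y) * ennreal (k3 z))"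
proof -
  let ?F = "\<lambda>w. f1 (fst w) * f2 (snd w) * f3 (- fst w - snd w)"
  have "ennreal (cmod (triple_conv_0 f1 f2 f3)) \<le> (\<integral>\<^sup>+w. ennreal (cmod (?F w)) \<partial>(lebesgue :: (pt \<times> pt) measure))"
  proof (cases "integrable (lebesgue :: (pt \<times> pt) measure) ?F")
    case True
    then show ?thesis unfolding triple_conv_0_def case_prod_beta
      by (rule integral_norm_bound_ennreal)
  next
    case False
    then have "triple_conv_0 f1 f2 f3 = 0" unfolding triple_conv_0_def case_prod_beta
      by (rule not_integrable_integral_eq)
    then show ?thesis by simp
  qed
  also have "\<dots> = (\<integral>\<^sup>+w. ennreal (cmod (?F w)) \<partial>lborel)" by (rule nn_integral_completion)
  also have "\<dots> = tri (\<lambda>x y z. ennreal (k1 x) * ennreal (k2 y) * ennreal (k3 z))"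
    unfolding tri_def
  proof (rule nn_integral_cong_AE)
    show "AE w in lborel. ennreal (cmod (?F w)) = ennreal (k1 (fst w)) * ennreal (k2 (snd w)) * ennreal (k3 (- fst w - snd w))"
      using AE_projections[OF Z]
    proof eventually_elim
      case (elim w)
      have "0 \<le> k1 (fst w)" "0 \<le> k2 (snd w)" using k elim by (metis norm_ge_zero)+
      then show ?case using k elim by (simp add: norm_mult ennreal_mult')
    qed
  qed
  finally show ?thesis .
qed

lemma L2_norm_on_eq:
  fixes f :: "pt \<Rightarrow> complex"
  assumes Z: "Z \<in> null_sets lborel" and k: "\<And>x. x \<notin> Z \<Longrightarrow> cmod (f x) = k x"
    and S: "\<And>x. x \<notin> S \<Longrightarrow> f x = 0"
  shows "L2_norm_on S f = esqrt (n2 (\<lambda>x. ennreal (k x)))"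
proof -
  have "(\<integral>\<^sup>+x. indicator S x * ennreal (cmod (f x) ^ 2) \<partial>lebesgue) = (\<integral>\<^sup>+x. indicator S x * ennreal (cmod (f x) ^ 2) \<partial>lborel)"
    by (rule nn_integral_completion)
  also have "\<dots> = n2 (\<lambda>x. ennreal (k x))"
    unfolding n2_def
  proof (rule nn_integral_cong_AE)
    show "AE x in lborel. indicator S x * ennreal (cmod (f x) ^ 2) = (ennreal (k x))\<^sup>2"
      using AE_not_in[OF Z]
    proof eventually_elim
      case (elim x)
      have "0 \<le> k x" using k[OF elim] by (metis norm_ge_zero)
      then show ?case using k[OF elim] S[of x] by (cases "x \<in> S") (auto simp: ennreal_power)
    qed
  qed
  finally show ?thesis by (simp add: L2_norm_on_def esqrt_def)
qed

text \<open>The inner angular norm of the mixed norm for finite exponent, on the circle of radius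
  \<open>r\<close> at time \<open>\<tau>\<close>.\<close>

definition ring_norm :: "real \<Rightarrow> pt set \<Rightarrow> (pt \<Rightarrow> complex) \<Rightarrow> real \<Rightarrow> real \<Rightarrow> ennreal" where
  "ring_norm p S f \<tau> r = ennreal_powr (circ (\<lambda>\<theta>. ennreal_powr (indicator S (\<tau>, polar r \<theta>) * ennreal (cmod (f (\<tau>, polar r \<theta>)))) p
   )) (1 / p)"

abbreviation ring_energy :: "real \<Rightarrow> pt set \<Rightarrow> (pt \<Rightarrow> complex) \<Rightarrow> ennreal" where
  "ring_energy p S f \<equiv> \<integral>\<^sup>+\<tau>. \<integral>\<^sup>+r. (ring_norm p S f \<tau> r)\<^sup>2 * ennreal r * indicator {0<..} r \<partial>lborel \<partial>lborel"

text \<open>For Borel functions this is integration in polar coordinates, with 2 pi from the density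
  2 pi r. The mixed norm, however, evaluates \<open>f\<close> on circles, which are null sets, and
  \<open>k\<close> agrees with \<open>cmod (f x)\<close> only off \<open>Z\<close>. The replacement
  is justified because \<open>Z\<close> meets almost every circle in a null set of angles.\<close>

lemma n2_angular_norm:
  fixes f :: "pt \<Rightarrow> complex"
  assumes Z: "Z \<in> null_sets lborel" and k: "\<And>x. x \<notin> Z \<Longrightarrow> cmod (f x) = k x"
    and S: "\<And>x. x \<notin> S \<Longrightarrow> f x = 0" and [measurable]: "k \<in> borel_measurable borel" and p: "0 < p"
  shows "n2 (angular_norm k p) = ennreal (2 * pi) * ring_energy p S f"
proof -
  have [measurable]: "Z \<in> sets borel" using Z by auto
  have pol: "polar r \<theta> = rot \<theta> (vector [r, 0])" for r \<theta> using rot_polar[of \<theta> r 0] by (simp add: polar_def)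
  have vec: "(\<lambda>r. vector [r, 0] :: real^2) = (\<lambda>r. r *\<^sub>R axis 1 1)"
    by (auto simp: vec_eq_iff forall_2 axis_def fun_eq_iff)
  have polm [measurable (raw)]: "(\<lambda>w. polar (u w) (v w)) \<in> borel_measurable N"
    if [measurable]: "u \<in> borel_measurable N" "v \<in> borel_measurable N" for u v and N :: "'z measure"
  proof -
    have "(\<lambda>w. rot (v w) (u w *\<^sub>R axis 1 1)) \<in> borel_measurable N" by measurable
    then show ?thesis using fun_cong[OF vec] by (simp add: pol)
  qed
  have ringm [measurable]: "(\<lambda>w. circ (\<lambda>\<theta>. q (fst w, polar (snd w) \<theta>))) \<in> borel_measurable (lborel \<Otimes>\<^sub>M lborel)"
    if [measurable]: "q \<in> borel_measurable borel" for q :: "pt \<Rightarrow> ennreal"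
  proof -
    have "(\<lambda>w. q (fst (fst w), polar (snd (fst w)) (snd w)) * indicator {0..<2*pi} (snd w)) \<in> borel_measurable ((lborel \<Otimes>\<^sub>M lborel) \<Otimes>\<^sub>M lborel)"
      by measurable
    from lborel.borel_measurable_nn_integral_fst[OF this] show ?thesis by simp
  qed
  have ringm2 [measurable]: "(\<lambda>r. circ (\<lambda>\<theta>. q (\<tau>, polar r \<theta>))) \<in> borel_measurable borel"
    if q: "q \<in> borel_measurable borel" for q :: "pt \<Rightarrow> ennreal" and \<tau>
  proof -
    have "(\<lambda>r. (\<tau>, r)) \<in> lborel \<rightarrow>\<^sub>M lborel \<Otimes>\<^sub>M lborel" by measurable
    from measurable_compose[OF this ringm[OF q]] show ?thesis by simp
  qed
  have radial: "(\<integral>\<^sup>+x. h (circ (\<lambda>\<theta>. q (rotz \<theta> x))) \<partial>lborel)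
    = (\<integral>\<^sup>+\<tau>. \<integral>\<^sup>+r. h (circ (\<lambda>\<theta>. q (\<tau>, polar r \<theta>))) * ennreal (2 * pi * r) * indicator {0..} r \<partial>lborel \<partial>lborel)"
    if [measurable]: "q \<in> borel_measurable borel" "h \<in> borel_measurable borel" for q :: "pt \<Rightarrow> ennreal" and h :: "ennreal \<Rightarrow> ennreal"
  proof -
    have "(\<lambda>x. h (circ (\<lambda>\<theta>. q (rotz \<theta> x)))) \<in> borel_measurable borel"
      using nn_integral_angle_measurable[of q] by measurable
    then have m3: "(\<lambda>x. h (circ (\<lambda>\<theta>. q (rotz \<theta> x)))) \<in> borel_measurable (lborel \<Otimes>\<^sub>M lborel)"
      by (simp add: lborel_prod)
    have "(\<integral>\<^sup>+x. h (circ (\<lambda>\<theta>. q (rotz \<theta> x))) \<partial>lborel)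
      = (\<integral>\<^sup>+\<tau>. \<integral>\<^sup>+\<xi>. h (circ (\<lambda>\<theta>. q (rotz \<theta> (\<tau>, \<xi>)))) \<partial>lborel \<partial>lborel)"
      unfolding lborel_prod[where 'a=real and 'b="real^2", symmetric]
      by (rule lborel.nn_integral_fst[symmetric, OF m3])
    also have "\<dots> = (\<integral>\<^sup>+\<tau>. \<integral>\<^sup>+\<xi>. h (circ (\<lambda>\<theta>. q (\<tau>, polar (norm (\<xi> :: real^2)) \<theta>))) \<partial>lborel \<partial>lborel)"
      by (simp add: nn_integral_rotz_angle)
    also have "\<dots> = (\<integral>\<^sup>+\<tau>. \<integral>\<^sup>+r. h (circ (\<lambda>\<theta>. q (\<tau>, polar r \<theta>))) * ennreal (2 * pi * r) * indicator {0..} r \<partial>lborel \<partial>lborel)"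
    proof (rule nn_integral_cong)
      fix \<tau>
      have "(\<lambda>r. h (circ (\<lambda>\<theta>. q (\<tau>, polar r \<theta>)))) \<in> borel_measurable borel" by measurable
      from nn_integral_radial[OF this]
      show "(\<integral>\<^sup>+\<xi>. h (circ (\<lambda>\<theta>. q (\<tau>, polar (norm (\<xi> :: real^2)) \<theta>))) \<partial>lborel)
        = (\<integral>\<^sup>+r. h (circ (\<lambda>\<theta>. q (\<tau>, polar r \<theta>))) * ennreal (2 * pi * r) * indicator {0..} r \<partial>lborel)" .
    qed
    finally show ?thesis .
  qed
  \<comment> \<open>Polar coordinates for the indicator of \<open>Z\<close>: total integral 0 forces
    the angular integral to vanish for almost every \<open>\<tau>\<close> and almost every radius at
    which the density \<open>2 * pi * r\<close> is positive.\<close>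
  have AE_ring: "AE \<tau> in lborel. AE r in lborel. 0 < r \<longrightarrow> (AE \<theta> in lborel. \<theta> \<in> {0..<2*pi} \<longrightarrow> (\<tau>, polar r \<theta>) \<notin> Z)"
  proof -
    let ?q = "\<lambda>\<tau> r. circ (\<lambda>\<theta>. indicator Z (\<tau>, polar r \<theta>))"
    have m [measurable]: "(\<lambda>w. ?q (fst w) (snd w)) \<in> borel_measurable (lborel \<Otimes>\<^sub>M lborel)"
      by (rule ringm) measurable
    have m2 [measurable]: "?q \<tau> \<in> borel_measurable borel" for \<tau>
      by (rule ringm2) measurable
    have m3: "(\<lambda>\<tau>. \<integral>\<^sup>+r. ?q \<tau> r * ennreal (2 * pi * r) * indicator {0..} r \<partial>lborel) \<in> borel_measurable lborel"
    proof -
      have "(\<lambda>w. ?q (fst w) (snd w) * ennreal (2 * pi * snd w) * indicator {0..} (snd w)) \<in> borel_measurable (lborel \<Otimes>\<^sub>M lborel)"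
        by measurable
      from lborel.borel_measurable_nn_integral_fst[OF this] show ?thesis by simp
    qed
    have "(\<integral>\<^sup>+\<tau>. \<integral>\<^sup>+r. ?q \<tau> r * ennreal (2 * pi * r) * indicator {0..} r \<partial>lborel \<partial>lborel) = ennreal (2 * pi) * (\<integral>\<^sup>+x. indicator Z x \<partial>lborel)"
      by (rule trans[OF radial[of "indicator Z" "\<lambda>x. x", symmetric] nn_integral_rotz_average]) measurable
    also have "\<dots> = 0" using Z by (simp add: null_setsD1)
    finally have "AE \<tau> in lborel. (\<integral>\<^sup>+r. ?q \<tau> r * ennreal (2 * pi * r) * indicator {0..} r \<partial>lborel) = 0"
      using nn_integral_0_iff_AE[OF m3] by simp
    then show ?thesis
    proof eventually_elim
      case (elim \<tau>)
      have "AE r in lborel. ?q \<tau> r * ennreal (2 * pi * r) * indicator {0..} r = 0"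
        using elim by (rule AE_nn_integral_0) measurable
      then show ?case
      proof eventually_elim
        case (elim r)
        show ?case
        proof
          assume r: "0 < r"
          have "\<not> pi * r \<le> 0" unfolding not_le by (rule mult_pos_pos[OF pi_gt_zero r])
          then have "?q \<tau> r = 0" using elim r by (simp add: ennreal_eq_0_iff)
          then have "AE \<theta> in lborel. indicator Z (\<tau>, polar r \<theta>) * indicator {0..<2*pi} \<theta> = (0::ennreal)"
            by (rule AE_nn_integral_0) measurable
          then show "AE \<theta> in lborel. \<theta> \<in> {0..<2*pi} \<longrightarrow> (\<tau>, polar r \<theta>) \<notin> Z"
            by eventually_elim (auto simp: indicator_def split: if_splits)
        qed
      qed
    qed
  qed
  have ring: "AE \<tau> in lborel. AE r in lborel. 0 < r \<longrightarrow>
    (circ (\<lambda>\<theta>. ennreal (k (\<tau>, polar r \<theta>) powr p)))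
    = (circ (\<lambda>\<theta>. ennreal_powr (indicator S (\<tau>, polar r \<theta>) * ennreal (cmod (f (\<tau>, polar r \<theta>)))) p))"
    using AE_ring
  proof eventually_elim
    case (elim \<tau>)
    then show ?case
    proof eventually_elim
      case (elim r)
      show ?case
      proof
        assume "0 < r"
        with elim have "AE \<theta> in lborel. \<theta> \<in> {0..<2*pi} \<longrightarrow> (\<tau>, polar r \<theta>) \<notin> Z" by blast
        then have "AE \<theta> in lborel. ennreal (k (\<tau>, polar r \<theta>) powr p) * indicator {0..<2*pi} \<theta>
          = ennreal_powr (indicator S (\<tau>, polar r \<theta>) * ennreal (cmod (f (\<tau>, polar r \<theta>)))) p * indicator {0..<2*pi} \<theta>"
        proof eventually_elim
          case (elim \<theta>)
          show ?case
          proof (cases "\<theta> \<in> {0..<2*pi}")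
            case True
            then have kk: "k (\<tau>, polar r \<theta>) = cmod (f (\<tau>, polar r \<theta>))" using elim k by simp
            show ?thesis
            proof (cases "(\<tau>, polar r \<theta>) \<in> S")
              case True
              then show ?thesis by (simp add: ennreal_powr_def kk)
            next
              case False
              then show ?thesis using S[OF False] by (simp add: ennreal_powr_def kk)
            qed
          qed simp
        qed
        then show "(circ (\<lambda>\<theta>. ennreal (k (\<tau>, polar r \<theta>) powr p)))
          = (circ (\<lambda>\<theta>. ennreal_powr (indicator S (\<tau>, polar r \<theta>) * ennreal (cmod (f (\<tau>, polar r \<theta>)))) p))"
          by (rule nn_integral_cong_AE)
      qed
    qed
  qed
  define h where "h a = (ennreal_powr a (1 / p))\<^sup>2" for a
  have [measurable]: "h \<in> borel_measurable borel" unfolding h_def by measurable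
  have "n2 (angular_norm k p) = (\<integral>\<^sup>+x. h (circ (\<lambda>\<theta>. ennreal (k (rotz \<theta> x) powr p))) \<partial>lborel)"
    by (simp add: n2_def angular_norm_def angular_def h_def)
  also have "\<dots> = (\<integral>\<^sup>+\<tau>. \<integral>\<^sup>+r. h (circ (\<lambda>\<theta>. ennreal (k (\<tau>, polar r \<theta>) powr p))) * ennreal (2 * pi * r) * indicator {0..} r \<partial>lborel \<partial>lborel)"
    by (rule radial[of "\<lambda>x. ennreal (k x powr p)"]) measurable
  also have "\<dots> = (\<integral>\<^sup>+\<tau>. \<integral>\<^sup>+r. h (circ (\<lambda>\<theta>. ennreal (k (\<tau>, polar r \<theta>) powr p))) * ennreal r * indicator {0<..} r * ennreal (2 * pi) \<partial>lborel \<partial>lborel)"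
    by (intro nn_integral_cong) (auto simp: indicator_def ennreal_mult mult_ac)
  also have "\<dots> = ennreal (2 * pi) * (\<integral>\<^sup>+\<tau>. \<integral>\<^sup>+r. h (circ (\<lambda>\<theta>. ennreal (k (\<tau>, polar r \<theta>) powr p))) * ennreal r * indicator {0<..} r \<partial>lborel \<partial>lborel)"
  proof -
    let ?G = "\<lambda>\<tau> r. h (circ (\<lambda>\<theta>. ennreal (k (\<tau>, polar r \<theta>) powr p))) * ennreal r * indicator {0<..} r"
    have m [measurable]: "(\<lambda>w. circ (\<lambda>\<theta>. ennreal (k (fst w, polar (snd w) \<theta>) powr p))) \<in> borel_measurable (lborel \<Otimes>\<^sub>M lborel)"
      by (rule ringm[of "\<lambda>x. ennreal (k x powr p)"]) measurable
    have m2 [measurable]: "(\<lambda>r. circ (\<lambda>\<theta>. ennreal (k (\<tau>, polar r \<theta>) powr p))) \<in> borel_measurable borel" for \<tau>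
      by (rule ringm2[of "\<lambda>x. ennreal (k x powr p)"]) measurable
    have "(\<lambda>w. ?G (fst w) (snd w)) \<in> borel_measurable (lborel \<Otimes>\<^sub>M lborel)" by measurable
    from lborel.borel_measurable_nn_integral_fst[OF this]
    have m3: "(\<lambda>\<tau>. \<integral>\<^sup>+r. ?G \<tau> r \<partial>lborel) \<in> borel_measurable lborel" by simp
    have "(\<integral>\<^sup>+r. ?G \<tau> r * ennreal (2 * pi) \<partial>lborel) = (\<integral>\<^sup>+r. ?G \<tau> r \<partial>lborel) * ennreal (2 * pi)" for \<tau>
      by (rule nn_integral_multc) measurable
    then show ?thesis using nn_integral_multc[OF m3] by (simp add: mult.commute)
  qed
  also have "(\<integral>\<^sup>+\<tau>. \<integral>\<^sup>+r. h (circ (\<lambda>\<theta>. ennreal (k (\<tau>, polar r \<theta>) powr p))) * ennreal r * indicator {0<..} r \<partial>lborel \<partial>lborel)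
    = ring_energy p S f"
  proof (rule nn_integral_cong_AE)
    show "AE \<tau> in lborel. (\<integral>\<^sup>+r. h (circ (\<lambda>\<theta>. ennreal (k (\<tau>, polar r \<theta>) powr p))) * ennreal r * indicator {0<..} r \<partial>lborel)
      = (\<integral>\<^sup>+r. (ring_norm p S f \<tau> r)\<^sup>2 * ennreal r * indicator {0<..} r \<partial>lborel)"
      using ring
    proof eventually_elim
      case (elim \<tau>)
      show ?case
      proof (rule nn_integral_cong_AE)
        show "AE r in lborel. h (circ (\<lambda>\<theta>. ennreal (k (\<tau>, polar r \<theta>) powr p))) * ennreal r * indicator {0<..} r
          = (ring_norm p S f \<tau> r)\<^sup>2 * ennreal r * indicator {0<..} r"
          using elim
        proof eventually_elim
          case (elim r)
          then show ?case by (cases "0 < r") (simp_all add: ring_norm_def h_def)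
        qed
      qed
    qed
  qed
  finally show ?thesis .
qed

lemma mixed_norm_on_ennreal:
  assumes "0 < p"
  shows "mixed_norm_on (ennreal p) S f
    = esqrt (ring_energy p S f)"
  using assms unfolding mixed_norm_on_def esqrt_def Lp_theta_def ring_norm_def nn_integral_completion
  by simp

text \<open>Replaces \<open>nn_integral_cmult\<close> for functions that need not be measurable, such as the supremum over the
  angle in the mixed norm with \<open>p = \<infinity>\<close>.\<close>

lemma nn_integral_cmult_le:
  assumes a: "0 < a"
  shows "(\<integral>\<^sup>+x. ennreal a * g x \<partial>M) \<le> ennreal a * (\<integral>\<^sup>+x. g x \<partial>M)"
  unfolding nn_integral_def[of M "\<lambda>x. ennreal a * g x"]
proof (rule SUP_least)
  fix u assume "u \<in> {g'. simple_function M g' \<and> g' \<le> (\<lambda>x. ennreal a * g x)}"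
  then have u: "simple_function M u" and le: "u x \<le> ennreal a * g x" for x by (auto simp: le_fun_def)
  have a1: "ennreal (1 / a) * ennreal a = 1" using a by (simp flip: ennreal_mult)
  define v where "v x = ennreal (1 / a) * u x" for x
  have v: "simple_function M v" unfolding v_def using u by (intro simple_function_mult) auto
  have [measurable]: "v \<in> borel_measurable M" using v by (rule borel_measurable_simple_function)
  have uv: "u x = ennreal a * v x" for x
    by (simp add: v_def a1[unfolded mult.commute[of "ennreal (1/a)"]] flip: mult.assoc)
  have "v x \<le> g x" for x
  proof -
    have "v x \<le> ennreal (1 / a) * (ennreal a * g x)" unfolding v_def using le by (rule mult_left_mono) simp
    then show ?thesis by (simp add: a1 flip: mult.assoc)
  qed
  then have "(\<integral>\<^sup>+x. v x \<partial>M) \<le> (\<integral>\<^sup>+x. g x \<partial>M)" by (intro nn_integral_mono)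
  have "simple_integral M u = (\<integral>\<^sup>+x. u x \<partial>M)" using u by (simp add: nn_integral_eq_simple_integral)
  also have "\<dots> = ennreal a * (\<integral>\<^sup>+x. v x \<partial>M)" unfolding uv by (rule nn_integral_cmult) measurable
  also have "\<dots> \<le> ennreal a * (\<integral>\<^sup>+x. g x \<partial>M)"
    using \<open>(\<integral>\<^sup>+x. v x \<partial>M) \<le> (\<integral>\<^sup>+x. g x \<partial>M)\<close> by (rule mult_left_mono) simp
  finally show "simple_integral M u \<le> ennreal a * (\<integral>\<^sup>+x. g x \<partial>M)" .
qed

text \<open>On a circle the angular norm is at most (2 pi)^(1/p) times the supremum, and this factor
  is at most 2 pi. A constant independent of \<open>p\<close> is essential, because \<open>p\<close>
  will depend on \<epsilon>.\<close>

lemma mixed_norm_on_top_ge: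
  assumes "1 \<le> p"
  shows "esqrt (ring_energy p S f)
    \<le> ennreal (2 * pi) * mixed_norm_on \<infinity> S f"
proof -
  define s where "s \<tau> r = (SUP \<theta>\<in>{0..<2*pi}. indicator S (\<tau>, polar r \<theta>) * ennreal (cmod (f (\<tau>, polar r \<theta>))))" for \<tau> r
  have le: "ring_norm p S f \<tau> r \<le> ennreal (2 * pi) * s \<tau> r" for \<tau> r
  proof (cases "s \<tau> r")
    case (real m)
    have "(circ (\<lambda>\<theta>. ennreal_powr (indicator S (\<tau>, polar r \<theta>) * ennreal (cmod (f (\<tau>, polar r \<theta>)))) p))
      \<le> (circ (\<lambda>\<theta>. ennreal (m powr p)))"
    proof (rule nn_integral_mono)
      fix \<theta> :: real
      show "ennreal_powr (indicator S (\<tau>, polar r \<theta>) * ennreal (cmod (f (\<tau>, polar r \<theta>)))) p * indicator {0..<2*pi} \<theta>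
        \<le> ennreal (m powr p) * indicator {0..<2*pi} \<theta>"
      proof (cases "\<theta> \<in> {0..<2*pi}")
        case True
        define u where "u = indicator S (\<tau>, polar r \<theta>) * cmod (f (\<tau>, polar r \<theta>))"
        have u: "0 \<le> u" "indicator S (\<tau>, polar r \<theta>) * ennreal (cmod (f (\<tau>, polar r \<theta>))) = ennreal u"
          by (auto simp: u_def indicator_def)
        have "ennreal u \<le> s \<tau> r" unfolding s_def u(2)[symmetric] by (rule SUP_upper[OF True])
        then have "u \<le> m" using real by simp
        then have "u powr p \<le> m powr p" using u assms by (intro powr_mono2) auto
        then show ?thesis using u True by (simp add: ennreal_powr_def ennreal_leI)
      qed simp
    qed
    also have "\<dots> = ennreal (m powr p * (2 * pi))"
      by (subst nn_integral_cmult_indicator) (simp_all add: ennreal_mult)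
    finally have I: "(circ (\<lambda>\<theta>. ennreal_powr (indicator S (\<tau>, polar r \<theta>) * ennreal (cmod (f (\<tau>, polar r \<theta>)))) p))
      \<le> ennreal (m powr p * (2 * pi))" .
    define J where "J = (circ (\<lambda>\<theta>. ennreal_powr (indicator S (\<tau>, polar r \<theta>) * ennreal (cmod (f (\<tau>, polar r \<theta>)))) p))"
    have "J < top" using I unfolding J_def[symmetric] by (rule order_le_less_trans) simp
    then obtain i where i: "J = ennreal i" "0 \<le> i" by (cases J) auto
    then have "i \<le> m powr p * (2 * pi)" using I real unfolding J_def[symmetric] by (simp add: ennreal_le_iff)
    then have "i powr (1 / p) \<le> (m powr p * (2 * pi)) powr (1 / p)"
      using i assms by (intro powr_mono2) auto
    also have "\<dots> = m * (2 * pi) powr (1 / p)"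
      using real assms by (simp add: powr_mult powr_powr)
    also have "\<dots> \<le> m * (2 * pi) powr 1"
      using real assms pi_ge_two by (intro mult_left_mono powr_mono) auto
    finally have "i powr (1 / p) \<le> 2 * pi * m" by (simp add: mult.commute)
    then show ?thesis
      unfolding ring_norm_def J_def[symmetric] using real i by (simp add: ennreal_powr_def ennreal_leI flip: ennreal_mult)
  qed (simp add: ennreal_mult_top)
  have "esqrt (ring_energy p S f)
    \<le> ennreal (2 * pi) * esqrt (\<integral>\<^sup>+\<tau>. \<integral>\<^sup>+r. (s \<tau> r)\<^sup>2 * ennreal r * indicator {0<..} r \<partial>lborel \<partial>lborel)"
  proof (rule ennreal_power2_le_imp_le)
    let ?s = "\<lambda>\<tau> r. (s \<tau> r)\<^sup>2 * ennreal r * indicator {0<..} r"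
    have "ring_energy p S f
      \<le> (\<integral>\<^sup>+\<tau>. \<integral>\<^sup>+r. ennreal ((2 * pi)\<^sup>2) * ?s \<tau> r \<partial>lborel \<partial>lborel)"
    proof (intro nn_integral_mono)
      fix \<tau> r :: real
      have "(ring_norm p S f \<tau> r)\<^sup>2 \<le> (ennreal (2 * pi) * s \<tau> r)\<^sup>2" using le by (rule power_mono) simp
      also have "\<dots> = ennreal ((2 * pi)\<^sup>2) * (s \<tau> r)\<^sup>2" by (simp add: power_mult_distrib ennreal_power)
      finally show "(ring_norm p S f \<tau> r)\<^sup>2 * ennreal r * indicator {0<..} r \<le> ennreal ((2 * pi)\<^sup>2) * ?s \<tau> r"
        unfolding mult.assoc[symmetric] by (intro mult_right_mono) auto
    qed
    also have "\<dots> \<le> (\<integral>\<^sup>+\<tau>. ennreal ((2 * pi)\<^sup>2) * (\<integral>\<^sup>+r. ?s \<tau> r \<partial>lborel) \<partial>lborel)"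
      by (intro nn_integral_mono nn_integral_cmult_le) simp
    also have "\<dots> \<le> ennreal ((2 * pi)\<^sup>2) * (\<integral>\<^sup>+\<tau>. \<integral>\<^sup>+r. ?s \<tau> r \<partial>lborel \<partial>lborel)"
      by (rule nn_integral_cmult_le) simp
    finally show "(esqrt (ring_energy p S f))\<^sup>2
      \<le> (ennreal (2 * pi) * esqrt (\<integral>\<^sup>+\<tau>. \<integral>\<^sup>+r. ?s \<tau> r \<partial>lborel \<partial>lborel))\<^sup>2"
      by (simp add: power_mult_distrib ennreal_power)
  qed
  also have "esqrt (\<integral>\<^sup>+\<tau>. \<integral>\<^sup>+r. (s \<tau> r)\<^sup>2 * ennreal r * indicator {0<..} r \<partial>lborel \<partial>lborel) = mixed_norm_on \<infinity> S f"
    unfolding mixed_norm_on_def esqrt_def Lp_theta_def s_def nn_integral_completion by simp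
  finally show ?thesis .
qed

section \<open>The estimate with explicit dependence on the exponent, and the endpoint\<close>

section \<open>The estimate\<close>

text \<open>The modulus agrees with a Borel function off a null set. Cutting that function off to
  \<open>U\<close> makes the support condition true at every point, although the equality holds only
  off \<open>Z\<close>.\<close>

lemma borel_modulus:
  fixes f :: "pt \<Rightarrow> complex"
  assumes f: "f \<in> borel_measurable lebesgue" and U: "U \<in> sets borel" and 0: "\<And>x. x \<notin> U \<Longrightarrow> f x = 0"
  obtains k Z where "k \<in> borel_measurable borel" "\<And>x. 0 \<le> k x" "Z \<in> null_sets lborel"
    "\<And>x. x \<notin> Z \<Longrightarrow> cmod (f x) = k x" "\<And>x. x \<notin> U \<Longrightarrow> k x = 0"
proof -
  have "(\<lambda>x. cmod (f x)) \<in> borel_measurable (completion lborel)" using f by measurable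
  from completion_ex_borel_measurable_real[OF this]
  obtain h where h: "h \<in> borel_measurable lborel" and ae: "AE x in lborel. cmod (f x) = h x" by blast
  from ae obtain Z where Z: "{x \<in> space lborel. \<not> cmod (f x) = h x} \<subseteq> Z" "emeasure lborel Z = 0" "Z \<in> sets lborel"
    by (rule AE_E)
  have [measurable]: "h \<in> borel_measurable borel" "U \<in> sets borel" using h U by simp_all
  show thesis
  proof (rule that[of "\<lambda>x. if x \<in> U then \<bar>h x\<bar> else 0" Z])
    show "(\<lambda>x. if x \<in> U then \<bar>h x\<bar> else 0) \<in> borel_measurable borel" by measurable
    show "Z \<in> null_sets lborel" using Z by (simp add: null_setsI)
    show "cmod (f x) = (if x \<in> U then \<bar>h x\<bar> else 0)" if "x \<notin> Z" for x
    proof -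
      have "cmod (f x) = h x" using Z(1) that by auto
      then show ?thesis using 0[of x] by (metis abs_norm_cancel norm_zero)
    qed
  qed simp_all
qed

text \<open>An abbreviation and not a definition, so that the hypotheses of the theorem match it
  without unfolding.\<close>

abbreviation phases where
  "phases \<beta> M A B c (\<phi> :: nat \<Rightarrow> real^2 \<Rightarrow> real) \<equiv>
     (\<forall>i\<in>{1,2,3}. \<phi> i \<in> C1_holder \<beta> B2 \<and> C1_holder_norm \<beta> B2 (\<phi> i) \<le> ennreal M
        \<and> radial_on B2 (\<phi> i) \<and> gradient_condition A B (\<phi> i)) \<and>
     transversality_condition A B c (\<phi> 1) (\<phi> 2) (\<phi> 3)"

abbreviation inputs where
  "inputs K \<phi> (\<epsilon> :: real) (N :: nat \<Rightarrow> real) (f :: nat \<Rightarrow> pt \<Rightarrow> complex) \<equiv> 0 < \<epsilon> \<and>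
     (\<forall>i\<in>{1,2,3}. N i \<in> dyadic \<and> f i \<in> L2_on (thickened (\<phi> i) \<epsilon>)
          \<and> closure {\<zeta>. f i \<zeta> \<noteq> 0} \<subseteq> {(\<tau>, \<xi>). comparable K (norm \<xi>) (N i)}) \<and>
     lesssim K (N 3) (N 1) \<and> comparable K (N 1) (N 2) \<and> comparable K (N 2) 1"

text \<open>\<open>C\<close> is chosen before \<open>P\<close>, and \<open>P\<close> enters the
  bound only through the displayed factors; this permits an exponent depending on
  \<open>\<epsilon>\<close>. The bounds on \<open>N 3\<close> are returned for the endpoint, where
  \<open>N 3 powr (1 / P)\<close> has to be absorbed.\<close>

lemma trilinear_estimate:
  fixes \<beta> M A B c K :: real
  assumes \<beta>: "0 < \<beta>" "\<beta> \<le> 1" and K: "1 \<le> K" and KA: "K ^ 4 \<le> A" and B: "1 \<le> B" and c: "0 < c"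
  obtains C where "0 < C"
    "\<And>\<phi> \<epsilon> N f P.
      phases \<beta> M A B c \<phi> \<Longrightarrow> inputs K \<phi> \<epsilon> N f \<Longrightarrow> 2 \<le> P \<Longrightarrow>
      0 < N 3 \<and> N 3 \<le> A \<and>
      ennreal (cmod (triple_conv_0 (f 1) (f 2) (f 3)))
        \<le> ennreal (C * sqrt P * \<epsilon> powr (3 / 2 - 1 / P) * N 3 powr (1 / P))
          * esqrt (ring_energy P (thickened (\<phi> 1) \<epsilon>) (f 1))
          * L2_norm_on (thickened (\<phi> 2) \<epsilon>) (f 2)
          * L2_norm_on (thickened (\<phi> 3) \<epsilon>) (f 3)"
proof -
  have K4: "K \<le> K ^ 4" "K ^ 2 \<le> K ^ 4" "K ^ 3 \<le> K ^ 4"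
    using power_increasing[of 1 4 K] power_increasing[of 2 4 K] power_increasing[of 3 4 K] K by simp_all
  have A: "1 \<le> A" using K K4 KA by linarith
  \<comment> \<open>The 3 comes from the triangle inequality: the sum in the transversality
    condition is at most \<bar>g1 - g3\<bar> + 2 \<bar>g2 - g3\<bar>, so one of these two
    differences is at least 1/(3B).\<close>
  define b where "b = 1 / (3 * B)"
  have b: "0 < b" using B by (simp add: b_def)
  obtain C0 where C0: "C0 > 0" and strip:
    "\<And>\<phi>2 g2 \<phi>3 g3 \<epsilon> L \<kappa> t \<xi>1. radial_C1 (max M 0) \<beta> \<phi>2 g2 \<Longrightarrow> radial_C1 (max M 0) \<beta> \<phi>3 g3 \<Longrightarrow> 0 < \<epsilon> \<Longrightarrow> 0 < L \<Longrightarrow> L \<le> A \<Longrightarrow>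
       0 \<le> \<kappa> \<Longrightarrow> \<kappa> < 1 \<Longrightarrow> 1 / A \<le> norm \<xi>1 \<Longrightarrow>
      strip_integral \<phi>2 g2 \<phi>3 g3 b c \<epsilon> L t \<kappa> \<xi>1 \<le> ennreal (C0 * \<epsilon> * L / (1 - \<kappa>))"
    by (rule strip_bound[OF \<beta> _ A b c, of "max M 0"]) (simp, blast)
  \<comment> \<open>Two regions, the factor 6 of each, 2 pi from the polar form of the angular norm,
    and \<open>K\<close> from \<open>L powr (1 / P)\<close>.\<close>
  define C where "C = 24 * pi * K * sqrt (B * C0)"
  show thesis
  proof (rule that[of C])
    show "0 < C" using K B C0 by (simp add: C_def)
    fix \<phi> :: "nat \<Rightarrow> real^2 \<Rightarrow> real" and \<epsilon> P :: real and N :: "nat \<Rightarrow> real" and f :: "nat \<Rightarrow> pt \<Rightarrow> complex"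
    assume "phases \<beta> M A B c \<phi>" and "inputs K \<phi> \<epsilon> N f" and P: "2 \<le> P"
    then have \<phi>: "\<forall>i\<in>{1,2,3::nat}. \<phi> i \<in> C1_holder \<beta> B2 \<and> C1_holder_norm \<beta> B2 (\<phi> i) \<le> ennreal M
        \<and> radial_on B2 (\<phi> i) \<and> gradient_condition A B (\<phi> i)"
      and trans: "transversality_condition A B c (\<phi> 1) (\<phi> 2) (\<phi> 3)" and \<epsilon>: "0 < \<epsilon>"
      and f: "\<forall>i\<in>{1,2,3}. N i \<in> dyadic \<and> f i \<in> L2_on (thickened (\<phi> i) \<epsilon>)
          \<and> closure {\<zeta>. f i \<zeta> \<noteq> 0} \<subseteq> {(\<tau>, \<xi>). comparable K (norm \<xi>) (N i)}"
      and N31: "lesssim K (N 3) (N 1)" and N12: "comparable K (N 1) (N 2)" and N2: "comparable K (N 2) 1"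
      by blast+
    note One_nat_def [simp del]
    define \<psi> where "\<psi> i = (\<lambda>x. if x \<in> B2 then \<phi> i x else 0)" for i
    define g where "g i = (\<lambda>x. if x \<in> B2 then grad (\<phi> i) x else 0)" for i
    have rad: "radial_C1 (max M 0) \<beta> (\<psi> i) (g i)" if "i \<in> {1,2,3}" for i
      unfolding \<psi>_def g_def using bspec[OF \<phi> that] \<beta> by (intro radial_C1_extend) simp_all
    interpret p1: radial_C1 "max M 0" \<beta> "\<psi> 1" "g 1" by (rule rad) simp
    interpret p2: radial_C1 "max M 0" \<beta> "\<psi> 2" "g 2" by (rule rad) simp
    interpret p3: radial_C1 "max M 0" \<beta> "\<psi> 3" "g 3" by (rule rad) simp
    have lower: "1 / B \<le> norm (g i x)" if "i \<in> {1,2,3}" "x \<in> B2" "1 / A \<le> norm x" "norm x \<le> A" for i x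
    proof -
      have "1 \<le> A * norm x" using that(3) A by (simp add: pos_divide_le_eq mult.commute)
      then have cA: "comparable A (norm x) 1" using that(4) by (simp add: comparable_def lesssim_def)
      have "gradient_condition A B (\<phi> i)" using bspec[OF \<phi> that(1)] by blast
      then have "comparable B (norm (grad (\<phi> i) x)) 1"
        using that(2) cA unfolding gradient_condition_def by blast
      then have "1 \<le> B * norm (g i x)" using that(2) by (simp add: comparable_def lesssim_def g_def)
      then show ?thesis using B by (simp add: pos_divide_le_eq mult.commute)
    qed
    have N1_le: "N 1 \<le> K * N 2" "N 2 \<le> K * N 1" "N 2 \<le> K" "1 \<le> K * N 2" "N 3 \<le> K * N 1"
      using N12 N2 N31 by (auto simp: comparable_def lesssim_def)
    have "N 3 \<in> dyadic" using bspec[OF f, of 3] by simp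
    then have N3: "0 < N 3" by (auto simp: dyadic_def)
    have N1K: "N 1 \<le> K\<^sup>2"
    proof -
      have "K * N 2 \<le> K * K" using N1_le(3) K by (intro mult_left_mono) auto
      then show ?thesis using N1_le(1) unfolding power2_eq_square by linarith
    qed
    have N3K: "N 3 \<le> K ^ 3"
    proof -
      have "K * N 1 \<le> K * K\<^sup>2" using N1K K by (intro mult_left_mono) auto
      also have "\<dots> = K ^ 3" by (simp add: power3_eq_cube power2_eq_square)
      finally show ?thesis using N1_le(5) by linarith
    qed
    define L where "L = K * N 3"
    have L: "0 < L" "L \<le> A"
    proof -
      show "0 < L" using K N3 by (simp add: L_def)
      have "L \<le> K * K ^ 3" unfolding L_def using N3K K by (intro mult_left_mono) auto
      also have "\<dots> = K ^ 4" by (simp add: power3_eq_cube power4_eq_xxxx)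
      finally show "L \<le> A" using KA by linarith
    qed
    have sB: "strip_integral (\<psi> i) (g i) (\<psi> 3) (g 3) b c \<epsilon> L t \<kappa> \<xi>1 \<le> ennreal (C0 * \<epsilon> * L / (1 - \<kappa>))"
      if "i \<in> {1,2,3}" "0 \<le> \<kappa>" "\<kappa> < 1" "1 / A \<le> norm \<xi>1" for i \<kappa> t \<xi>1
      by (rule strip[OF rad[OF that(1)] p3.radial_C1_axioms \<epsilon> L that(2-4)])
    interpret T1: trilinear "max M 0" \<beta> "\<psi> 1" "g 1" "\<psi> 2" "g 2" "\<psi> 3" "g 3" A B b c \<epsilon> L C0
    proof
      show "1 / B \<le> norm (g 1 x)" if "x \<in> B2" "1 / A \<le> norm x" "norm x \<le> A" for x
        using that by (intro lower) auto
    qed (use A B \<epsilon> L C0 sB[of 2] in simp_all)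
    \<comment> \<open>Phases 1 and 2 are exchanged, for the region where the first gradient differs
      from the third.\<close>
    interpret T2: trilinear "max M 0" \<beta> "\<psi> 2" "g 2" "\<psi> 1" "g 1" "\<psi> 3" "g 3" A B b c \<epsilon> L C0
    proof
      show "1 / B \<le> norm (g 2 x)" if "x \<in> B2" "1 / A \<le> norm x" "norm x \<le> A" for x
        using that by (intro lower) auto
    qed (use A B \<epsilon> L C0 sB[of 1] in simp_all)
    \<comment> \<open>The support region is written with \<open>\<psi>\<close>, which is Borel on
      the whole plane and equals \<open>\<phi>\<close> on \<open>B2\<close>.\<close>
    define U where "U i = {x :: pt. snd x \<in> B2 \<and> \<bar>fst x - \<psi> i (snd x)\<bar> \<le> \<epsilon> \<and> comparable K (norm (snd x)) (N i)}" for i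
    have U: "U i \<in> sets borel" if "i \<in> {1,2,3}" for i
    proof -
      have [measurable]: "\<psi> i \<in> borel_measurable borel" using rad[OF that] by (simp add: radial_C1_def)
      show ?thesis unfolding U_def comparable_def lesssim_def by measurable
    qed
    have fi: "f i \<in> L2_on (thickened (\<phi> i) \<epsilon>)" "closure {\<zeta>. f i \<zeta> \<noteq> 0} \<subseteq> {(\<tau>, \<xi>). comparable K (norm \<xi>) (N i)}"
      if "i \<in> {1,2,3}" for i
      using bspec[OF f that] by simp_all
    have thick0: "x \<notin> thickened (\<phi> i) \<epsilon> \<Longrightarrow> f i x = 0" if "i \<in> {1,2,3}" for i x
      using fi(1)[OF that, unfolded L2_on_def mem_Collect_eq] by blast
    have f0: "f i x = 0" if "i \<in> {1,2,3}" "x \<notin> U i" for i x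
    proof (rule ccontr)
      assume nz: "f i x \<noteq> 0"
      then have "x \<in> thickened (\<phi> i) \<epsilon>" using thick0[OF that(1), of x] by blast
      moreover have "x \<in> {(\<tau>, \<xi>). comparable K (norm \<xi>) (N i)}"
        using fi(2)[OF that(1)] nz closure_subset[of "{\<zeta>. f i \<zeta> \<noteq> 0}"] by blast
      ultimately have "x \<in> U i" by (auto simp: U_def thickened_def \<psi>_def)
      then show False using that(2) by blast
    qed
    have fm: "f i \<in> borel_measurable lebesgue" if "i \<in> {1,2,3}" for i
      using fi(1)[OF that, unfolded L2_on_def mem_Collect_eq] by blast
    have "\<exists>k Z. k \<in> borel_measurable borel \<and> (\<forall>x. 0 \<le> k x) \<and> Z \<in> null_sets lborel
      \<and> (\<forall>x. x \<notin> Z \<longrightarrow> cmod (f i x) = k x) \<and> (\<forall>x. x \<notin> U i \<longrightarrow> k x = 0)" if i: "i \<in> {1,2,3}" for i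
      by (rule borel_modulus[OF fm[OF i] U[OF i] f0[OF i]]) blast+
    then obtain k Z where kZ: "\<And>i. i \<in> {1,2,3} \<Longrightarrow> k i \<in> borel_measurable borel \<and> (\<forall>x. 0 \<le> k i x) \<and> Z i \<in> null_sets lborel
      \<and> (\<forall>x. x \<notin> Z i \<longrightarrow> cmod (f i x) = k i x) \<and> (\<forall>x. x \<notin> U i \<longrightarrow> k i x = 0)"
      by metis
    have k_nonneg: "\<And>x. 0 \<le> k i x" and k_eq: "\<And>x. x \<notin> Z i \<Longrightarrow> cmod (f i x) = k i x" and k_0: "\<And>x. x \<notin> U i \<Longrightarrow> k i x = 0"
      if "i \<in> {1,2,3}" for i
      using kZ[OF that] by blast+
    have [measurable]: "k 1 \<in> borel_measurable borel" "k 2 \<in> borel_measurable borel" "k 3 \<in> borel_measurable borel"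
      using kZ by auto
    have Znull: "Z 1 \<in> null_sets lborel" "Z 2 \<in> null_sets lborel" "Z 3 \<in> null_sets lborel"
      using kZ[of 1] kZ[of 2] kZ[of 3] by auto
    \<comment> \<open>If \<open>3 * \<epsilon> \<le> c\<close>, the phases sum to at most
      \<open>c\<close>, because the times sum to zero, and the largest frequency is comparable to 1,
      because the first is. Transversality then separates the second or the first gradient from the
      third; in the latter case the first two arguments change places.\<close>
    have cover: "T1.core x y z \<or> T2.core y x z"
      if s: "x + y + z = 0" and x: "x \<in> U 1" and y: "y \<in> U 2" and z: "z \<in> U 3" for x y z
    proof -
      have fs: "fst x + fst y + fst z = 0" and ss: "snd x + snd y + snd z = 0"
        using s by (simp_all add: prod_eq_iff)
      have r1: "norm (snd x) \<le> K * N 1" "N 1 \<le> K * norm (snd x)"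
        and r2: "norm (snd y) \<le> K * N 2" "N 2 \<le> K * norm (snd y)"
        and r3: "norm (snd z) \<le> L"
        using x y z by (auto simp: U_def comparable_def lesssim_def L_def)
      have B2s: "snd x \<in> B2" "snd y \<in> B2" "snd z \<in> B2" using x y z by (auto simp: U_def)
      have th: "\<bar>fst x - \<psi> 1 (snd x)\<bar> \<le> \<epsilon>" "\<bar>fst y - \<psi> 2 (snd y)\<bar> \<le> \<epsilon>" "\<bar>fst z - \<psi> 3 (snd z)\<bar> \<le> \<epsilon>"
        using x y z by (auto simp: U_def)
      have xA: "norm (snd x) \<le> A"
      proof -
        have "norm (snd x) \<le> K * K\<^sup>2" using r1(1) mult_left_mono[OF N1K, of K] K by linarith
        then show ?thesis using K4 KA by (simp add: power2_eq_square power3_eq_cube)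
      qed
      have yA: "norm (snd y) \<le> A"
      proof -
        have "norm (snd y) \<le> K * K" using r2(1) mult_left_mono[OF N1_le(3), of K] K by linarith
        then show ?thesis using K4 KA by (simp add: power2_eq_square)
      qed
      have Ay: "1 \<le> A * norm (snd y)"
      proof -
        have "1 \<le> K\<^sup>2 * norm (snd y)"
        proof -
          have "K * N 2 \<le> K * (K * norm (snd y))" using r2(2) K by (intro mult_left_mono) auto
          then show ?thesis using N1_le(4) by (simp add: power2_eq_square)
        qed
        also have "\<dots> \<le> A * norm (snd y)" using K4 KA by (intro mult_right_mono) auto
        finally show ?thesis .
      qed
      have Ax: "1 \<le> A * norm (snd x)"
      proof -
        have "1 \<le> K * (K * N 1)" using N1_le(4) mult_left_mono[OF N1_le(2), of K] K by linarith
        also have "\<dots> \<le> K * (K * (K * norm (snd x)))" using r1(2) K by (intro mult_left_mono) auto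
        also have "\<dots> = K ^ 3 * norm (snd x)" by (simp add: power3_eq_cube)
        also have "\<dots> \<le> A * norm (snd x)" using K4 KA by (intro mult_right_mono) auto
        finally show ?thesis .
      qed
      have inv: "1 / A \<le> norm (snd x)" "1 / A \<le> norm (snd y)" using Ax Ay A by (simp_all add: field_simps)
      have "c < 3 * \<epsilon> \<or> b \<le> norm (g 2 (snd y) - g 3 (snd z)) \<or> b \<le> norm (g 1 (snd x) - g 3 (snd z))"
      proof (cases "c < 3 * \<epsilon>")
        case False
        have "\<bar>\<phi> 1 (snd x) + \<phi> 2 (snd y) + \<phi> 3 (snd z)\<bar> \<le> c"
          using th fs False B2s by (auto simp: \<psi>_def)
        moreover have "comparable A (Max {norm (snd x), norm (snd y), norm (snd z)}) 1"
        proof -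
          have "norm (snd z) \<le> A" using r3 L by linarith
          then have "Max {norm (snd x), norm (snd y), norm (snd z)} \<le> A" using xA yA by simp
          moreover have "A * norm (snd x) \<le> A * Max {norm (snd x), norm (snd y), norm (snd z)}"
            using A by (intro mult_left_mono) auto
          ultimately show ?thesis using Ax unfolding comparable_def lesssim_def by linarith
        qed
        ultimately have "comparable B (norm (grad (\<phi> 1) (snd x) - grad (\<phi> 2) (snd y)) + norm (grad (\<phi> 2) (snd y) - grad (\<phi> 3) (snd z))) 1"
          using trans B2s ss unfolding transversality_condition_def by blast
        then have "1 \<le> B * (norm (g 1 (snd x) - g 2 (snd y)) + norm (g 2 (snd y) - g 3 (snd z)))"
          using B2s by (simp add: comparable_def lesssim_def g_def)
        then have "3 * b \<le> norm (g 1 (snd x) - g 2 (snd y)) + norm (g 2 (snd y) - g 3 (snd z))"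
          using B by (simp add: b_def field_simps)
        moreover have "norm (g 1 (snd x) - g 2 (snd y)) \<le> norm (g 1 (snd x) - g 3 (snd z)) + norm (g 2 (snd y) - g 3 (snd z))"
          using norm_triangle_ineq4[of "g 1 (snd x) - g 3 (snd z)" "g 2 (snd y) - g 3 (snd z)"] by simp
        ultimately show ?thesis using b by linarith
      qed simp
      then show ?thesis
        unfolding T1.core_def T2.core_def using B2s th xA yA inv r3 by blast
    qed
    define I where "I = ring_energy P (thickened (\<phi> 1) \<epsilon>) (f 1)"
    define X where "X = 6 * sqrt (B * C0 * P) * \<epsilon> powr (3 / 2 - 1 / P) * L powr (1 / P)"
    define n where "n = esqrt (n2 (angular_norm (k 1) P) * n2 (\<lambda>x. ennreal (k 2 x)) * n2 (\<lambda>x. ennreal (k 3 x)))"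
    let ?F = "\<lambda>x y z. ennreal (k 1 x) * ennreal (k 2 y) * ennreal (k 3 z)"
    have "ennreal (cmod (triple_conv_0 (f 1) (f 2) (f 3))) \<le> tri ?F"
    proof (rule triple_conv_le)
      show "Z 1 \<union> Z 2 \<union> Z 3 \<in> null_sets lborel" using Znull by (intro null_sets.Un)
    qed (simp_all add: k_eq)
    also have "tri ?F \<le> tri (\<lambda>x y z. ?F x y z * T1.chi x y z + ?F x y z * T2.chi y x z)"
    proof (rule tri_mono)
      fix x y z :: pt assume s: "x + y + z = 0"
      show "?F x y z \<le> ?F x y z * T1.chi x y z + ?F x y z * T2.chi y x z"
      proof (cases "x \<in> U 1 \<and> y \<in> U 2 \<and> z \<in> U 3")
        case True
        then have "T1.core x y z \<or> T2.core y x z" using cover[OF s] by blast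
        then show ?thesis
        proof
          assume "T1.core x y z"
          then have "T1.chi x y z = 1" by (simp add: T1.chi_def)
          then show ?thesis by simp
        next
          assume "T2.core y x z"
          then have "T2.chi y x z = 1" by (simp add: T2.chi_def)
          then show ?thesis by simp
        qed
      next
        case False
        then have "k 1 x = 0 \<or> k 2 y = 0 \<or> k 3 z = 0" using k_0[of 1 x] k_0[of 2 y] k_0[of 3 z] by simp blast
        then show ?thesis by auto
      qed
    qed
    also have "\<dots> = tri (\<lambda>x y z. ?F x y z * T1.chi x y z) + tri (\<lambda>x y z. ?F x y z * T2.chi y x z)"
      by (rule tri_add) (simp_all add: meas3_def)
    also have "tri (\<lambda>x y z. ?F x y z * T2.chi y x z) = tri (\<lambda>x y z. ennreal (k 2 x) * ennreal (k 1 y) * ennreal (k 3 z) * T2.chi x y z)"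
    proof -
      have "meas3 (\<lambda>x y z. ennreal (k 2 x) * ennreal (k 1 y) * ennreal (k 3 z) * T2.chi x y z)"
        unfolding meas3_def by measurable
      from tri_swap[OF this] show ?thesis by (simp only: mult_ac)
    qed
    also have "tri (\<lambda>x y z. ?F x y z * T1.chi x y z) + \<dots> \<le> ennreal X * n + ennreal X * n"
      unfolding X_def n_def
    proof (rule add_mono)
      show "tri (\<lambda>x y z. ?F x y z * T1.chi x y z)
        \<le> ennreal (6 * sqrt (B * C0 * P) * \<epsilon> powr (3 / 2 - 1 / P) * L powr (1 / P))
          * esqrt (n2 (angular_norm (k 1) P) * n2 (\<lambda>x. ennreal (k 2 x)) * n2 (\<lambda>x. ennreal (k 3 x)))"
        by (rule T1.trilinear_mixed_x) (use k_nonneg P in simp_all)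
      show "tri (\<lambda>x y z. ennreal (k 2 x) * ennreal (k 1 y) * ennreal (k 3 z) * T2.chi x y z)
        \<le> ennreal (6 * sqrt (B * C0 * P) * \<epsilon> powr (3 / 2 - 1 / P) * L powr (1 / P))
          * esqrt (n2 (angular_norm (k 1) P) * n2 (\<lambda>x. ennreal (k 2 x)) * n2 (\<lambda>x. ennreal (k 3 x)))"
        by (rule T2.trilinear_mixed_y) (use k_nonneg P in simp_all)
    qed
    also have "\<dots> = ennreal (2 * X) * n"
    proof -
      have "0 \<le> X" using B C0 P by (simp add: X_def)
      then have "ennreal (2 * X) = ennreal X + ennreal X" by (simp flip: ennreal_plus)
      then show ?thesis by (simp only: distrib_right)
    qed
    \<comment> \<open>The square root of 2 pi that polar coordinates produce is rounded up to 2
      pi.\<close>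
    also have "n \<le> (ennreal (2 * pi) * esqrt I) * L2_norm_on (thickened (\<phi> 2) \<epsilon>) (f 2) * L2_norm_on (thickened (\<phi> 3) \<epsilon>) (f 3)"
    proof -
      have e1: "n2 (angular_norm (k 1) P) = ennreal (2 * pi) * I"
        unfolding I_def by (rule n2_angular_norm[OF Znull(1)]) (use P in \<open>simp_all add: k_eq thick0\<close>)
      have "(2 * pi) * 1 \<le> (2 * pi) * (2 * pi)" using pi_ge_two by (intro mult_left_mono) auto
      then have "ennreal (2 * pi) \<le> ennreal ((2 * pi)\<^sup>2)" by (intro ennreal_leI) (simp add: power2_eq_square)
      also have "\<dots> = (ennreal (2 * pi))\<^sup>2" by (simp add: ennreal_power)
      finally have e2: "esqrt (ennreal (2 * pi)) \<le> ennreal (2 * pi)"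
        by (intro ennreal_power2_le_imp_le[of "esqrt (ennreal (2 * pi))"]) (simp only: esqrt_power2)
      have e3: "L2_norm_on (thickened (\<phi> 2) \<epsilon>) (f 2) = esqrt (n2 (\<lambda>x. ennreal (k 2 x)))"
        by (rule L2_norm_on_eq[OF Znull(2)]) (simp_all add: k_eq thick0)
      have e4: "L2_norm_on (thickened (\<phi> 3) \<epsilon>) (f 3) = esqrt (n2 (\<lambda>x. ennreal (k 3 x)))"
        by (rule L2_norm_on_eq[OF Znull(3)]) (simp_all add: k_eq thick0)
      show ?thesis unfolding n_def e1 e3 e4 esqrt_mult by (intro mult_right_mono e2) simp_all
    qed
    also have "ennreal (2 * X) * ((ennreal (2 * pi) * esqrt I) * L2_norm_on (thickened (\<phi> 2) \<epsilon>) (f 2) * L2_norm_on (thickened (\<phi> 3) \<epsilon>) (f 3))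
      = ennreal (4 * pi * X) * esqrt I * L2_norm_on (thickened (\<phi> 2) \<epsilon>) (f 2) * L2_norm_on (thickened (\<phi> 3) \<epsilon>) (f 3)"
    proof -
      have "0 \<le> X" using B C0 P by (simp add: X_def)
      then have "ennreal (4 * pi * X) = ennreal (2 * X) * ennreal (2 * pi)" by (simp add: mult_ac flip: ennreal_mult)
      then show ?thesis by (simp only: mult.assoc)
    qed
    also have "\<dots> \<le> ennreal (C * sqrt P * \<epsilon> powr (3 / 2 - 1 / P) * N 3 powr (1 / P)) * esqrt I
        * L2_norm_on (thickened (\<phi> 2) \<epsilon>) (f 2) * L2_norm_on (thickened (\<phi> 3) \<epsilon>) (f 3)"
    proof (intro mult_right_mono ennreal_leI)
      have "L powr (1 / P) = K powr (1 / P) * N 3 powr (1 / P)" using K N3 by (simp add: L_def powr_mult)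
      also have "\<dots> \<le> K powr 1 * N 3 powr (1 / P)" using K P by (intro mult_right_mono powr_mono) auto
      finally have LN: "L powr (1 / P) \<le> K * N 3 powr (1 / P)" using K by simp
      have "4 * pi * X = (24 * pi * sqrt (B * C0) * sqrt P * \<epsilon> powr (3 / 2 - 1 / P)) * L powr (1 / P)"
        by (simp add: X_def real_sqrt_mult)
      also have "\<dots> \<le> (24 * pi * sqrt (B * C0) * sqrt P * \<epsilon> powr (3 / 2 - 1 / P)) * (K * N 3 powr (1 / P))"
        using LN B C0 P by (intro mult_left_mono) auto
      finally show "4 * pi * X \<le> C * sqrt P * \<epsilon> powr (3 / 2 - 1 / P) * N 3 powr (1 / P)"
        by (simp add: C_def mult_ac)
    qed auto
    finally have main: "ennreal (cmod (triple_conv_0 (f 1) (f 2) (f 3))) \<le> ennreal (C * sqrt P * \<epsilon> powr (3 / 2 - 1 / P) * N 3 powr (1 / P)) * esqrt I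
        * L2_norm_on (thickened (\<phi> 2) \<epsilon>) (f 2) * L2_norm_on (thickened (\<phi> 3) \<epsilon>) (f 3)"
      by (simp add: mult_left_mono)
    have "N 3 \<le> A" using N3K K4 KA by linarith
    with N3 main show "0 < N 3 \<and> N 3 \<le> A \<and>
      ennreal (cmod (triple_conv_0 (f 1) (f 2) (f 3)))
        \<le> ennreal (C * sqrt P * \<epsilon> powr (3 / 2 - 1 / P) * N 3 powr (1 / P))
          * esqrt (ring_energy P (thickened (\<phi> 1) \<epsilon>) (f 1))
          * L2_norm_on (thickened (\<phi> 2) \<epsilon>) (f 2)
          * L2_norm_on (thickened (\<phi> 3) \<epsilon>) (f 3)"
      unfolding I_def by blast
  qed
qed

text \<open>The exponent \<open>p = 2 + \<bar>ln \<epsilon>\<bar>\<close> turns the factor \<open>sqrt p\<close> into the logarithm of the endpoint.\<close>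

lemma log_optimization:
  fixes \<epsilon> N A :: real
  assumes \<epsilon>: "0 < \<epsilon>" and N: "0 < N" "N \<le> A" and A: "1 \<le> A" and P: "P = 2 + \<bar>ln \<epsilon>\<bar>"
  shows "sqrt P * \<epsilon> powr (3 / 2 - 1 / P) * N powr (1 / P) \<le> 2 * exp 1 * A * (japanese (ln \<epsilon>) * \<epsilon> powr (3 / 2))"
proof -
  have P2: "2 \<le> P" using P by simp
  define t where "t = \<bar>ln \<epsilon>\<bar>"
  \<comment> \<open>This expression is 4 (1 + t^2) - (2 + t) with the square completed.\<close>
  have "0 \<le> (2 * t - 1)\<^sup>2 + 1 + 3 * t" by (simp add: t_def)
  then have "P \<le> 4 * (1 + t\<^sup>2)" by (simp add: P t_def[symmetric] power2_eq_square algebra_simps)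
  then have "sqrt P \<le> sqrt (4 * (1 + t\<^sup>2))" by simp
  also have "\<dots> = 2 * japanese (ln \<epsilon>)" unfolding real_sqrt_mult japanese_def t_def by simp
  finally have 1: "sqrt P \<le> 2 * japanese (ln \<epsilon>)" .
  \<comment> \<open>For \<open>\<epsilon> < 1\<close> the left side is \<bar>ln \<epsilon>\<bar> /
    P, so an exponent above \<bar>ln \<epsilon>\<bar> loses no more than a factor e.\<close>
  have "- (1 / P) * ln \<epsilon> \<le> 1"
  proof -
    have "- ln \<epsilon> \<le> P" using P by simp
    then show ?thesis using P2 by (simp add: field_simps)
  qed
  then have "\<epsilon> powr (- (1 / P)) \<le> exp 1" using \<epsilon> by (simp add: powr_def)
  then have "\<epsilon> powr (3 / 2) * \<epsilon> powr (- (1 / P)) \<le> \<epsilon> powr (3 / 2) * exp 1" by (rule mult_left_mono) simp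
  then have 2: "\<epsilon> powr (3 / 2 - 1 / P) \<le> \<epsilon> powr (3 / 2) * exp 1" by (simp flip: powr_add)
  have "N powr (1 / P) \<le> A powr (1 / P)" using N P2 by (intro powr_mono2) auto
  also have "\<dots> \<le> A powr 1" using A P2 by (intro powr_mono) auto
  finally have 3: "N powr (1 / P) \<le> A" using A by simp
  have "sqrt P * \<epsilon> powr (3 / 2 - 1 / P) * N powr (1 / P) \<le> (2 * japanese (ln \<epsilon>)) * (\<epsilon> powr (3 / 2) * exp 1) * A"
    using 1 2 3 P2 by (intro mult_mono) (auto simp: japanese_def)
  then show ?thesis by (simp add: mult_ac)
qed

theorem theorem3p4:
  fixes \<beta> M A B c K :: real and p :: ennreal
  assumes "0 < \<beta>" and "\<beta> \<le> 1"
    and "2 \<le> p"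
    and "1 \<le> K" and "K ^ 4 \<le> A"
    and "1 \<le> B" and "0 < c"
  shows "\<exists>C>0. \<forall>\<phi> :: nat \<Rightarrow> real^2 \<Rightarrow> real.
    (\<forall>i\<in>{1,2,3}. \<phi> i \<in> C1_holder \<beta> B2 \<and> C1_holder_norm \<beta> B2 (\<phi> i) \<le> ennreal M
        \<and> radial_on B2 (\<phi> i) \<and> gradient_condition A B (\<phi> i)) \<and>
    transversality_condition A B c (\<phi> 1) (\<phi> 2) (\<phi> 3) \<longrightarrow>
    (\<forall>(\<epsilon>::real) (N :: nat \<Rightarrow> real) (f :: nat \<Rightarrow> real \<times> (real^2) \<Rightarrow> complex).
      0 < \<epsilon> \<and>
      (\<forall>i\<in>{1,2,3}. N i \<in> dyadic \<and> f i \<in> L2_on (thickened (\<phi> i) \<epsilon>)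
          \<and> closure {\<zeta>. f i \<zeta> \<noteq> 0} \<subseteq> {(\<tau>, \<xi>). comparable K (norm \<xi>) (N i)}) \<and>
      lesssim K (N 3) (N 1) \<and> comparable K (N 1) (N 2) \<and> comparable K (N 2) 1 \<longrightarrow>
      ennreal (cmod (triple_conv_0 (f 1) (f 2) (f 3)))
        \<le> ennreal (C * conv_const \<epsilon> p (N 3))
          * mixed_norm_on p (thickened (\<phi> 1) \<epsilon>) (f 1)
          * L2_norm_on (thickened (\<phi> 2) \<epsilon>) (f 2)
          * L2_norm_on (thickened (\<phi> 3) \<epsilon>) (f 3))"
proof -
  have "1 \<le> K ^ 4" using assms(4) by simp
  then have A: "1 \<le> A" using assms(5) by linarith
  obtain C where C: "0 < C" and est:
    "\<And>\<phi> \<epsilon> N f P.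
      phases \<beta> M A B c \<phi> \<Longrightarrow> inputs K \<phi> \<epsilon> N f \<Longrightarrow> 2 \<le> P \<Longrightarrow>
      0 < N 3 \<and> N 3 \<le> A \<and>
      ennreal (cmod (triple_conv_0 (f 1) (f 2) (f 3)))
        \<le> ennreal (C * sqrt P * \<epsilon> powr (3 / 2 - 1 / P) * N 3 powr (1 / P))
          * esqrt (ring_energy P (thickened (\<phi> 1) \<epsilon>) (f 1))
          * L2_norm_on (thickened (\<phi> 2) \<epsilon>) (f 2)
          * L2_norm_on (thickened (\<phi> 3) \<epsilon>) (f 3)"
    by (rule trilinear_estimate[OF assms(1,2,4-7), of M]) blast
  show ?thesis
  proof (cases p)
    case (real P)
    have P: "2 \<le> P" using assms(3) real by (metis ennreal_le_iff ennreal_numeral)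
    have p: "enn2real p = P" "p \<noteq> \<infinity>" "0 < P" using real P by simp_all
    show ?thesis
      \<comment> \<open>For a fixed finite exponent the factor \<open>sqrt P\<close> is part of the
        constant.\<close>
      apply (rule exI[of _ "C * sqrt P"])
      apply (intro conjI allI impI)
      subgoal using C P by simp
      subgoal for \<phi> \<epsilon> N f
        using est[of \<phi> \<epsilon> N f P] P
        unfolding real(2) mixed_norm_on_ennreal[OF p(3)] conv_const_def
        by (simp add: real(1) mult.assoc)
      done
  next
    case top
    \<comment> \<open>\<open>2 * exp 1 * A\<close> is the loss from the choice of \<open>P\<close>,
      and \<open>2 * pi\<close> the loss from bounding the angular norm by the supremum.\<close>
    define C' where "C' = C * (2 * exp 1 * A) * (2 * pi)"
    show ?thesis
    proof (intro exI[of _ C'] conjI allI impI)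
      show "0 < C'" using C A by (simp add: C'_def)
      fix \<phi> :: "nat \<Rightarrow> real^2 \<Rightarrow> real" and \<epsilon> :: real and N :: "nat \<Rightarrow> real" and f :: "nat \<Rightarrow> real \<times> (real^2) \<Rightarrow> complex"
      assume in_hyps: "phases \<beta> M A B c \<phi>" "inputs K \<phi> \<epsilon> N f"
      then have 2: "0 < \<epsilon>" by blast
      define P where "P = 2 + \<bar>ln \<epsilon>\<bar>"
      have P: "2 \<le> P" by (simp add: P_def)
      let ?S = "thickened (\<phi> 1) \<epsilon>"
      let ?I = "ring_energy P ?S (f 1)"
      have e: "0 < N 3 \<and> N 3 \<le> A \<and>
        ennreal (cmod (triple_conv_0 (f 1) (f 2) (f 3)))
        \<le> ennreal (C * sqrt P * \<epsilon> powr (3 / 2 - 1 / P) * N 3 powr (1 / P)) * esqrt ?I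
          * L2_norm_on (thickened (\<phi> 2) \<epsilon>) (f 2) * L2_norm_on (thickened (\<phi> 3) \<epsilon>) (f 3)"
        by (rule est[OF in_hyps P])
      have cc: "conv_const \<epsilon> p (N 3) = japanese (ln \<epsilon>) * \<epsilon> powr (3 / 2)" using top by (simp add: conv_const_def)
      have "ennreal (C * sqrt P * \<epsilon> powr (3 / 2 - 1 / P) * N 3 powr (1 / P)) * esqrt ?I
        \<le> ennreal (C * (2 * exp 1 * A * conv_const \<epsilon> p (N 3))) * (ennreal (2 * pi) * mixed_norm_on p ?S (f 1))"
      proof (rule mult_mono)
        have "sqrt P * \<epsilon> powr (3 / 2 - 1 / P) * N 3 powr (1 / P) \<le> 2 * exp 1 * A * conv_const \<epsilon> p (N 3)"
          unfolding cc using e 2 A by (intro log_optimization P_def) auto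
        then have "C * (sqrt P * \<epsilon> powr (3 / 2 - 1 / P) * N 3 powr (1 / P)) \<le> C * (2 * exp 1 * A * conv_const \<epsilon> p (N 3))"
          using C by (intro mult_left_mono) auto
        then show "ennreal (C * sqrt P * \<epsilon> powr (3 / 2 - 1 / P) * N 3 powr (1 / P)) \<le> ennreal (C * (2 * exp 1 * A * conv_const \<epsilon> p (N 3)))"
          by (intro ennreal_leI) (simp only: mult.assoc)
        show "esqrt ?I \<le> ennreal (2 * pi) * mixed_norm_on p ?S (f 1)"
          using mixed_norm_on_top_ge[of P ?S "f 1"] P top by simp
      qed simp_all
      also have "\<dots> = ennreal (C' * conv_const \<epsilon> p (N 3)) * mixed_norm_on p ?S (f 1)"
      proof -
        have "0 \<le> conv_const \<epsilon> p (N 3)" unfolding cc by (simp add: japanese_def)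
        then have "ennreal (C' * conv_const \<epsilon> p (N 3)) = ennreal (C * (2 * exp 1 * A * conv_const \<epsilon> p (N 3))) * ennreal (2 * pi)"
          using C A by (simp add: C'_def mult_ac flip: ennreal_mult)
        then show ?thesis by (simp only: mult.assoc)
      qed
      finally have "ennreal (C * sqrt P * \<epsilon> powr (3 / 2 - 1 / P) * N 3 powr (1 / P)) * esqrt ?I
          * L2_norm_on (thickened (\<phi> 2) \<epsilon>) (f 2) * L2_norm_on (thickened (\<phi> 3) \<epsilon>) (f 3)
        \<le> ennreal (C' * conv_const \<epsilon> p (N 3)) * mixed_norm_on p ?S (f 1)
          * L2_norm_on (thickened (\<phi> 2) \<epsilon>) (f 2) * L2_norm_on (thickened (\<phi> 3) \<epsilon>) (f 3)"
        by (intro mult_right_mono) auto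
      then show "ennreal (cmod (triple_conv_0 (f 1) (f 2) (f 3)))
        \<le> ennreal (C' * conv_const \<epsilon> p (N 3)) * mixed_norm_on p ?S (f 1)
          * L2_norm_on (thickened (\<phi> 2) \<epsilon>) (f 2) * L2_norm_on (thickened (\<phi> 3) \<epsilon>) (f 3)"
        using e by (meson order_trans)
    qed
  qed
qed

end
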